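(* Let $\varphi\in H$ and let $f\in C([0,T];D(A^{\varepsilon}))$ for some $\varepsilon\in(0,1)$. Then the forward problem $$\sum_{j=1}^{M} q_j\,\partial_t^{\rho_j}u(t)+Au(t)=f(t),\quad 0<t<T,\qquad u(0)=\varphi,$$ has a unique solution $u$. Moreover, there exists a constant $C$, depending on $\varepsilon$ and $\rho_1$, such that for all $t$ with $0<t\le T$ $$\|u(t)\|_1\le C\Big(\|\varphi\|\sum_{j=1}^{M}t^{-\rho_j}+\max_{s\in[0,T]}\|f(s)\|_{\varepsilon}\Big).$$
   Context: $H$ is a separable Hilbert space with inner product $(\cdot,\cdot)$ and norm $\|\cdot\|$. $A$ is a positive self-adjoint operator in $H$ with domain $D(A)$ and compact inverse $A^{-1}$. Hence $A$ has a complete orthonormal system of eigenfunctions $\{v_k\}_{k\ge1}$ with eigenvalues $0<\lambda_1\le\lambda_2\le\cdots\to+\infty$. For $g\in H$ put $g_k=(g,v_k)$. For real $\varepsilon$: $D(A^{\varepsilon})=\{g\in H:\sum_{k=1}^\infty\lambda_k^{2\varepsilon}|g_k|^2<\infty\}$, $A^{\varepsilon}g=\sum_{k=1}^\infty\lambda_k^{\varepsilon}g_kv_k$, and $\|g\|_{\varepsilon}=\|A^{\varepsilon}g\|=\big(\sum_{k=1}^\infty\lambda_k^{2\varepsilon}|g_k|^2\big)^{1/2}$; in particular $\|g\|_1=\|Ag\|$. Continuity of functions with values in $D(A^\varepsilon)$ is with respect to $\|\cdot\|_\varepsilon$. $T>0$, $M\ge1$ is an integer, $0<\rho_M<\rho_{M-1}<\cdots<\rho_1<1$,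 $q_j>0$ for $j=1,\dots,M$, and $q_1=1$. The Caputo derivative of order $\rho_j$ is $$\partial_t^{\rho_j}h(t)=\frac{1}{\Gamma(1-\rho_j)}\int_0^t\frac{h'(s)}{(t-s)^{\rho_j}}\,ds,\quad t>0,$$ provided the right-hand side exists. The data $H$, $A$, $M$, $\rho_j$, $q_j$, $T$ are fixed; the constant does not depend on $\varphi$, $f$, $u$ or $t$. A solution is a function $u\in C([0,T];H)$ such that for $0<t<T$ one has $u(t)\in D(A)$, the derivatives $\partial_t^{\rho_j}u(t)$ exist in $H$, and the equation holds in $H$, and such that the initial condition $u(0)=\varphi$ holds. The bound on $\|u(t)\|_1$ includes the assertion $u(t)\in D(A)$ for $0<t\le T$.
   Formalization: In the Caputo derivative, h'(s)ds is read as dh(s) (a Henstock–Stieltjes integral, equal to the stated formula for differentiable h), since for merely continuous f the solution need not be differentiable; H is taken real, a complex H being covered via Re(·,·). *)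

theory Defs
  imports "HOL-Analysis.Analysis"
begin

text \<open>Unbounded operators are given by a domain \<open>D\<close> and a function \<open>A\<close>, which is only
  relevant on \<open>D\<close>.\<close>

definition linear_operator_on :: "'a::real_vector set \<Rightarrow> ('a \<Rightarrow> 'a) \<Rightarrow> bool" where
  "linear_operator_on D A \<longleftrightarrow> subspace D \<and>
     (\<forall>x\<in>D. \<forall>y\<in>D. A (x + y) = A x + A y) \<and> (\<forall>c. \<forall>x\<in>D. A (c *\<^sub>R x) = c *\<^sub>R A x)"

text \<open>The last conjunct says that the graph of the adjoint of \<open>A\<close> is the graph of \<open>A\<close>; in
  particular the domains coincide.\<close>

definition self_adjoint_operator :: "'a::real_inner set \<Rightarrow> ('a \<Rightarrow> 'a) \<Rightarrow> bool" where
  "self_adjoint_operator D A \<longleftrightarrow> linear_operator_on D A \<and> closure D = UNIV \<and>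
     (\<forall>y z. (\<forall>x\<in>D. A x \<bullet> y = x \<bullet> z) \<longleftrightarrow> (y \<in> D \<and> A y = z))"

definition positive_operator :: "'a::real_inner set \<Rightarrow> ('a \<Rightarrow> 'a) \<Rightarrow> bool" where
  "positive_operator D A \<longleftrightarrow> (\<forall>x\<in>D. x \<noteq> 0 \<longrightarrow> A x \<bullet> x > 0)"

definition compact_inverse :: "'a::real_normed_vector set \<Rightarrow> ('a \<Rightarrow> 'a) \<Rightarrow> bool" where
  "compact_inverse D A \<longleftrightarrow> bij_betw A D UNIV \<and>
     (\<forall>S. bounded S \<longrightarrow> compact (closure (inv_into D A ` S)))"

text \<open>Eigenfunctions and eigenvalues are numbered from 0 instead of 1.\<close>

definition eigen_system ::
  "'a::real_inner set \<Rightarrow> ('a \<Rightarrow> 'a) \<Rightarrow> (nat \<Rightarrow> 'a) \<Rightarrow> (nat \<Rightarrow> real) \<Rightarrow> bool" where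
  "eigen_system D A v lam \<longleftrightarrow>
     (\<forall>k. v k \<in> D \<and> A (v k) = lam k *\<^sub>R v k) \<and>
     (\<forall>i j. v i \<bullet> v j = (if i = j then 1 else 0)) \<and>
     closure (span (range v)) = UNIV \<and>
     0 < lam 0 \<and> mono lam \<and> filterlim lam at_top sequentially"

definition pow_domain :: "(nat \<Rightarrow> 'a::real_inner) \<Rightarrow> (nat \<Rightarrow> real) \<Rightarrow> real \<Rightarrow> 'a set" where
  "pow_domain v lam \<epsilon> = {g. summable (\<lambda>k. lam k powr (2 * \<epsilon>) * \<bar>g \<bullet> v k\<bar>\<^sup>2)}"

definition pow_op :: "(nat \<Rightarrow> 'a::real_inner) \<Rightarrow> (nat \<Rightarrow> real) \<Rightarrow> real \<Rightarrow> 'a \<Rightarrow> 'a" where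
  "pow_op v lam \<epsilon> g = (\<Sum>k. (lam k powr \<epsilon> * (g \<bullet> v k)) *\<^sub>R v k)"

definition pow_norm :: "(nat \<Rightarrow> 'a::real_inner) \<Rightarrow> (nat \<Rightarrow> real) \<Rightarrow> real \<Rightarrow> 'a \<Rightarrow> real" where
  "pow_norm v lam \<epsilon> g = norm (pow_op v lam \<epsilon> g)"

definition pow_continuous_on ::
  "(nat \<Rightarrow> 'a::real_inner) \<Rightarrow> (nat \<Rightarrow> real) \<Rightarrow> real \<Rightarrow> real set \<Rightarrow> (real \<Rightarrow> 'a) \<Rightarrow> bool" where
  "pow_continuous_on v lam \<epsilon> S f \<longleftrightarrow>
     (\<forall>t\<in>S. f t \<in> pow_domain v lam \<epsilon> \<and>
        ((\<lambda>s. pow_norm v lam \<epsilon> (f s - f t)) \<longlongrightarrow> 0) (at t within S))"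

text \<open>The Henstock--Stieltjes integral of \<open>k\<close> against \<open>dh\<close> over \<open>[a, b]\<close>: the definition of
  \<^const>\<open>has_integral\<close> on an interval (lemma \<open>has_integral_real\<close>), with the length of a
  subinterval replaced by the increment of \<open>h\<close>.\<close>

definition has_stieltjes_integral ::
  "(real \<Rightarrow> real) \<Rightarrow> (real \<Rightarrow> 'a::real_normed_vector) \<Rightarrow> 'a \<Rightarrow> real \<Rightarrow> real \<Rightarrow> bool" where
  "has_stieltjes_integral k h I a b \<longleftrightarrow>
     (\<forall>e>0. \<exists>\<gamma>. gauge \<gamma> \<and>
       (\<forall>\<D>. \<D> tagged_division_of {a..b} \<and> \<gamma> fine \<D> \<longrightarrow>
          norm ((\<Sum>(x, K)\<in>\<D>. k x *\<^sub>R (h (Sup K) - h (Inf K))) - I) < e))"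

text \<open>The Caputo derivative
  \<open>(1 / \<Gamma>(1 - \<rho>)) \<integral>\<^sub>0\<^sup>t h'(s) (t - s)\<^sup>-\<^sup>\<rho> ds\<close>, with \<open>h'(s) ds\<close> read as \<open>dh(s)\<close>.
  If \<open>h\<close> is differentiable on \<open>(0, t)\<close> and continuous on \<open>[0, t]\<close>, this is exactly the formula
  with the pointwise derivative \<open>h'\<close>, including existence (lemma
  \<open>has_caputo_derivative_iff_has_integral\<close> below). Solutions of fractional equations with a
  merely continuous right-hand side need not be differentiable in \<open>t\<close>: if \<open>w\<close> is continuous,
  the solution of \<open>\<partial>\<^sup>\<rho> y = w\<close>, \<open>y(0) = 0\<close> is the fractional integral of \<open>w\<close> of order \<open>\<rho> < 1\<close>,
  which may fail to have a derivative.
  The value of the kernel at \<open>s = t\<close> is \<open>0 powr - \<rho> = 0\<close>.\<close>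

definition has_caputo_derivative ::
  "real \<Rightarrow> (real \<Rightarrow> 'a::real_normed_vector) \<Rightarrow> 'a \<Rightarrow> real \<Rightarrow> bool" where
  "has_caputo_derivative \<rho> h d t \<longleftrightarrow>
     (\<exists>I. has_stieltjes_integral (\<lambda>s. (t - s) powr (- \<rho>)) h I 0 t \<and>
          d = (1 / Gamma (1 - \<rho>)) *\<^sub>R I)"

definition is_solution ::
  "'a::real_inner set \<Rightarrow> ('a \<Rightarrow> 'a) \<Rightarrow> nat \<Rightarrow> (nat \<Rightarrow> real) \<Rightarrow> (nat \<Rightarrow> real) \<Rightarrow> real \<Rightarrow>
     (real \<Rightarrow> 'a) \<Rightarrow> 'a \<Rightarrow> (real \<Rightarrow> 'a) \<Rightarrow> bool" where
  "is_solution D A M \<rho> q T f \<phi> u \<longleftrightarrow>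
     continuous_on {0..T} u \<and> u 0 = \<phi> \<and>
     (\<forall>t\<in>{0<..<T}. u t \<in> D \<and>
        (\<exists>d. (\<forall>j\<in>{1..M}. has_caputo_derivative (\<rho> j) u (d j) t) \<and>
             (\<Sum>j=1..M. q j *\<^sub>R d j) + A (u t) = f t))"

lemma stieltjes_endpoint_sum:
  fixes h :: "real \<Rightarrow> 'a::real_normed_vector"
  assumes D: "\<D> tagged_division_of {0..t}" and c: "0 \<le> c"
    and small: "\<And>K. (0, K) \<in> \<D> \<Longrightarrow> norm (h (Sup K) - h (Inf K)) \<le> c"
  shows "(\<Sum>(x, K)\<in>\<D>. if x = 0 then norm (h (Sup K) - h (Inf K)) else 0) \<le> c"
proof -
  let ?g = "\<lambda>(x::real, K). if x = 0 then norm (h (Sup K) - h (Inf K)) else (0::real)"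
  have fin: "finite \<D>" using D by blast
  define P where "P = {p \<in> \<D>. ?g p \<noteq> 0}"
  have shape: "\<exists>v>0. K = {0..v}" if "(x, K) \<in> P" for x K
  proof -
    have xK: "(x, K) \<in> \<D>" "x = 0" "h (Sup K) \<noteq> h (Inf K)"
      using that by (auto simp: P_def split: if_splits)
    obtain a b where ab: "K = cbox a b" using tagged_division_ofD(4)[OF D xK(1)] by blast
    have "0 \<in> K" "K \<subseteq> {0..t}" using tagged_division_ofD(2,3)[OF D xK(1)] xK(2) by auto
    with ab have "a \<le> 0" "0 \<le> b" "0 \<le> a" by auto
    with ab xK(3) have "a = 0" "b > 0" by (auto simp: order_less_le)
    with ab show ?thesis by auto
  qed
  have uniq: "p = p'" if p: "p \<in> P" and p': "p' \<in> P" for p p'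
  proof (rule ccontr)
    assume ne: "p \<noteq> p'"
    obtain x K x' K' where eq: "p = (x, K)" "p' = (x', K')" by fastforce
    obtain v v' where v: "v > 0" "K = {0..v}" "v' > 0" "K' = {0..v'}"
      using shape p p' eq by blast
    have "interior K \<inter> interior K' = {}"
      using tagged_division_ofD(5)[OF D, of x K x' K'] p p' eq ne by (auto simp: P_def)
    moreover have "min v v' / 2 \<in> interior K \<inter> interior K'" using v by (auto simp: min_def)
    ultimately show False by blast
  qed
  have "sum ?g \<D> = sum ?g P"
    by (rule sum.mono_neutral_right) (use fin in \<open>auto simp: P_def\<close>)
  also have "\<dots> \<le> c"
  proof (cases "P = {}")
    case False
    then obtain p where "P = {p}" using uniq by blast
    then show ?thesis using small c by (cases p) (auto simp: P_def)
  qed (use c in simp)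
  finally show ?thesis .
qed

lemma stieltjes_gauge:
  fixes h h' :: "real \<Rightarrow> 'a::real_normed_vector" and k :: "real \<Rightarrow> real"
  assumes t: "0 < t" and kt: "k t = 0" and e: "0 < e"
    and cont: "continuous_on {0..t} h"
    and der: "\<And>s. \<lbrakk>0 < s; s < t\<rbrakk> \<Longrightarrow> (h has_vector_derivative h' s) (at s)"
  shows "\<exists>\<gamma>. gauge \<gamma> \<and> (\<forall>\<D>. \<D> tagged_division_of {0..t} \<and> \<gamma> fine \<D> \<longrightarrow>
     norm ((\<Sum>(x, K)\<in>\<D>. k x *\<^sub>R (h (Sup K) - h (Inf K))) -
           (\<Sum>(x, K)\<in>\<D>. measure lborel K *\<^sub>R (if 0 < x \<and> x < t then k x *\<^sub>R h' x else 0))) < e)"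
proof -
  define \<eta> where "\<eta> x = e / (4 * t * (1 + \<bar>k x\<bar>))" for x
  have \<eta>: "\<eta> x > 0" "\<bar>k x\<bar> * \<eta> x \<le> e / (4 * t)" for x
  proof -
    show "\<eta> x > 0"
      unfolding \<eta>_def using t e by (intro divide_pos_pos mult_pos_pos) auto
    have "\<bar>k x\<bar> * \<eta> x = e / (4 * t) * (\<bar>k x\<bar> / (1 + \<bar>k x\<bar>))"
      by (simp add: \<eta>_def)
    also have "\<dots> \<le> e / (4 * t) * 1"
      by (rule mult_left_mono) (use t e in auto)
    finally show "\<bar>k x\<bar> * \<eta> x \<le> e / (4 * t)" by simp
  qed
  have "\<exists>\<delta>>0. (0 < x \<and> x < t \<longrightarrow> (\<forall>y. \<bar>y - x\<bar> < \<delta> \<longrightarrow>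
             norm (h y - h x - (y - x) *\<^sub>R h' x) \<le> \<eta> x * \<bar>y - x\<bar>)) \<and>
           (x = 0 \<longrightarrow> (\<forall>y\<in>{0..t}. \<bar>y\<bar> < \<delta> \<longrightarrow> norm (h y - h 0) \<le> e / (4 * (1 + \<bar>k 0\<bar>))))" for x
  proof (cases "0 < x \<and> x < t")
    case True
    then have "(h has_derivative (\<lambda>y. y *\<^sub>R h' x)) (at x)"
      using der by (simp add: has_vector_derivative_def)
    then show ?thesis using \<eta>(1)[of x] True
      unfolding has_derivative_at_alt by fastforce
  next
    case False
    show ?thesis
    proof (cases "x = 0")
      case True
      have "e / (4 * (1 + \<bar>k 0\<bar>)) > 0" using e by (intro divide_pos_pos) auto
      then obtain d where "d > 0"
        "\<forall>y\<in>{0..t}. dist y 0 < d \<longrightarrow> dist (h y) (h 0) < e / (4 * (1 + \<bar>k 0\<bar>))"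
        using cont t unfolding continuous_on_iff by force
      then show ?thesis using True
        by (intro exI[of _ d]) (auto simp: dist_norm less_imp_le)
    qed (use False in \<open>auto intro: exI[of _ 1]\<close>)
  qed
  then obtain \<delta> where \<delta>: "\<And>x. \<delta> x > 0"
    "\<And>x y. \<lbrakk>0 < x; x < t; \<bar>y - x\<bar> < \<delta> x\<rbrakk> \<Longrightarrow>
       norm (h y - h x - (y - x) *\<^sub>R h' x) \<le> \<eta> x * \<bar>y - x\<bar>"
    "\<And>y. \<lbrakk>y \<in> {0..t}; \<bar>y\<bar> < \<delta> 0\<rbrakk> \<Longrightarrow> norm (h y - h 0) \<le> e / (4 * (1 + \<bar>k 0\<bar>))"
    by metis
  define \<gamma> where "\<gamma> x = ball x (\<delta> x)" for x
  have "norm ((\<Sum>(x, K)\<in>\<D>. k x *\<^sub>R (h (Sup K) - h (Inf K))) -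
           (\<Sum>(x, K)\<in>\<D>. measure lborel K *\<^sub>R (if 0 < x \<and> x < t then k x *\<^sub>R h' x else 0))) < e"
    if D: "\<D> tagged_division_of {0..t}" and fine: "\<gamma> fine \<D>" for \<D>
  proof -
    define z where "z = (\<lambda>(x::real, K). if x = 0 then norm (h (Sup K) - h (Inf K)) else (0::real))"
    have bd: "norm (k x *\<^sub>R (h (Sup K) - h (Inf K)) -
                measure lborel K *\<^sub>R (if 0 < x \<and> x < t then k x *\<^sub>R h' x else 0))
              \<le> e / (4 * t) * measure lborel K + \<bar>k 0\<bar> * z (x, K)" (is "?L \<le> ?R")
      and zb: "x = 0 \<Longrightarrow> norm (h (Sup K) - h (Inf K)) \<le> e / (4 * (1 + \<bar>k 0\<bar>))"
      if xK: "(x, K) \<in> \<D>" for x K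
    proof -
      obtain a b where ab: "K = {a..b}" using tagged_division_ofD(4)[OF D xK] by auto
      have sub: "x \<in> K" "K \<subseteq> {0..t}" using tagged_division_ofD(2,3)[OF D xK] by auto
      have axb: "a \<le> x" "x \<le> b" "0 \<le> a" "b \<le> t" using sub ab by auto
      have "K \<subseteq> ball x (\<delta> x)" using fine xK by (auto simp: fine_def \<gamma>_def)
      moreover have "a \<in> K" "b \<in> K" using ab axb by auto
      ultimately have near: "\<bar>a - x\<bar> < \<delta> x" "\<bar>b - x\<bar> < \<delta> x"
        by (auto simp: dist_real_def abs_minus_commute subset_iff)
      have SI: "Sup K = b" "Inf K = a" "measure lborel K = b - a" using ab axb by auto
      show "norm (h (Sup K) - h (Inf K)) \<le> e / (4 * (1 + \<bar>k 0\<bar>))" if "x = 0"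
      proof -
        have "a = 0" using that axb by simp
        then show ?thesis using \<delta>(3)[of b] near that axb SI by simp
      qed
      have z0: "0 \<le> z (x, K)" by (simp add: z_def)
      have c0: "0 \<le> e / (4 * t) * measure lborel K" using e t SI axb by simp
      consider "0 < x" "x < t" | "x = 0" | "x = t" using axb by linarith
      then show "?L \<le> ?R"
      proof cases
        case 1
        have "norm (h b - h a - (b - a) *\<^sub>R h' x)
            = norm ((h b - h x - (b - x) *\<^sub>R h' x) - (h a - h x - (a - x) *\<^sub>R h' x))"
          by (simp add: algebra_simps)
        also have "\<dots> \<le> \<eta> x * \<bar>b - x\<bar> + \<eta> x * \<bar>a - x\<bar>"
          by (rule order_trans[OF norm_triangle_ineq4 add_mono]) (use \<delta>(2) 1 near in auto)
        also have "\<dots> = \<eta> x * (b - a)" using axb by (simp add: algebra_simps)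
        finally have "\<bar>k x\<bar> * norm (h b - h a - (b - a) *\<^sub>R h' x) \<le> \<bar>k x\<bar> * (\<eta> x * (b - a))"
          by (rule mult_left_mono) simp
        also have "\<dots> \<le> e / (4 * t) * (b - a)"
          using mult_right_mono[OF \<eta>(2)[of x], of "b - a"] axb by (simp add: mult.assoc)
        finally have "norm (k x *\<^sub>R (h b - h a - (b - a) *\<^sub>R h' x)) \<le> e / (4 * t) * (b - a)"
          by simp
        moreover have "k x *\<^sub>R (h b - h a - (b - a) *\<^sub>R h' x)
            = k x *\<^sub>R (h b - h a) - (b - a) *\<^sub>R (k x *\<^sub>R h' x)"
          by (simp add: scaleR_diff_right mult.commute)
        moreover have "0 \<le> \<bar>k 0\<bar> * z (x, K)" using z0 by simp
        ultimately show ?thesis using 1 SI by simp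
      next
        case 2
        then show ?thesis using c0 by (simp add: z_def)
      next
        case 3
        then show ?thesis using c0 z0 kt by simp
      qed
    qed
    have "norm ((\<Sum>(x, K)\<in>\<D>. k x *\<^sub>R (h (Sup K) - h (Inf K))) -
           (\<Sum>(x, K)\<in>\<D>. measure lborel K *\<^sub>R (if 0 < x \<and> x < t then k x *\<^sub>R h' x else 0)))
        = norm (\<Sum>(x, K)\<in>\<D>. k x *\<^sub>R (h (Sup K) - h (Inf K)) -
           measure lborel K *\<^sub>R (if 0 < x \<and> x < t then k x *\<^sub>R h' x else 0))"
      by (simp add: sum_subtractf[symmetric] split_beta del: sum_subtractf)
    also have "\<dots> \<le> (\<Sum>(x, K)\<in>\<D>. e / (4 * t) * measure lborel K + \<bar>k 0\<bar> * z (x, K))"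
      by (rule sum_norm_le) (use bd in auto)
    also have "\<dots> = e / (4 * t) * (\<Sum>(x, K)\<in>\<D>. measure lborel K) + \<bar>k 0\<bar> * sum z \<D>"
      by (simp add: sum.distrib sum_distrib_left split_beta)
    also have "(\<Sum>(x, K)\<in>\<D>. measure lborel K) = t"
      using additive_content_tagged_division[of \<D> 0 t] D t by simp
    finally have 1: "norm ((\<Sum>(x, K)\<in>\<D>. k x *\<^sub>R (h (Sup K) - h (Inf K))) -
           (\<Sum>(x, K)\<in>\<D>. measure lborel K *\<^sub>R (if 0 < x \<and> x < t then k x *\<^sub>R h' x else 0)))
        \<le> e / (4 * t) * t + \<bar>k 0\<bar> * sum z \<D>" .
    have "sum z \<D> \<le> e / (4 * (1 + \<bar>k 0\<bar>))"
      unfolding z_def by (rule stieltjes_endpoint_sum[OF D]) (use zb e in auto)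
    then have "\<bar>k 0\<bar> * sum z \<D> \<le> \<bar>k 0\<bar> * (e / (4 * (1 + \<bar>k 0\<bar>)))"
      by (rule mult_left_mono) simp
    also have "\<dots> \<le> e / 4"
      using e by (simp add: divide_simps)
    finally show ?thesis using 1 t e by simp
  qed
  moreover have "gauge \<gamma>" unfolding gauge_def \<gamma>_def using \<delta>(1) by simp
  ultimately show ?thesis by blast
qed

text \<open>For differentiable \<open>h\<close> the definition is the classical Caputo formula.\<close>

lemma has_caputo_derivative_iff_has_integral:
  fixes h h' :: "real \<Rightarrow> 'a::banach"
  assumes t: "0 < t" and \<rho>: "0 < \<rho>" "\<rho> < 1"
    and cont: "continuous_on {0..t} h"
    and der: "\<And>s. \<lbrakk>0 < s; s < t\<rbrakk> \<Longrightarrow> (h has_vector_derivative h' s) (at s)"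
  shows "has_caputo_derivative \<rho> h d t \<longleftrightarrow>
    (\<exists>I. ((\<lambda>s. (1 / (t - s) powr \<rho>) *\<^sub>R h' s) has_integral I) {0..t} \<and>
         d = (1 / Gamma (1 - \<rho>)) *\<^sub>R I)"
proof -
  define k where "k = (\<lambda>s. (t - s) powr (- \<rho>))"
  define g where "g = (\<lambda>x. if 0 < x \<and> x < t then k x *\<^sub>R h' x else 0)"
  let ?S = "\<lambda>\<D>. \<Sum>(x, K)\<in>\<D>. k x *\<^sub>R (h (Sup K) - h (Inf K))"
  let ?R = "\<lambda>\<D>. \<Sum>(x, K)\<in>\<D>. measure lborel K *\<^sub>R g x"
  have kt: "k t = 0" by (simp add: k_def)
  have gauge: "\<exists>\<gamma>. gauge \<gamma> \<and> (\<forall>\<D>. \<D> tagged_division_of {0..t} \<and> \<gamma> fine \<D> \<longrightarrow>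
      norm (?S \<D> - ?R \<D>) < e)" if "e > 0" for e
    using stieltjes_gauge[where k = k and h = h and h' = h', OF t kt that cont der] unfolding g_def .
  have transfer: "\<forall>e>0. \<exists>\<gamma>. gauge \<gamma> \<and> (\<forall>\<D>. \<D> tagged_division_of {0..t} \<and> \<gamma> fine \<D> \<longrightarrow>
      norm (Y \<D> - I) < e)"
    if X: "\<forall>e>0. \<exists>\<gamma>. gauge \<gamma> \<and> (\<forall>\<D>. \<D> tagged_division_of {0..t} \<and> \<gamma> fine \<D> \<longrightarrow>
      norm (X \<D> - I) < e)"
    and XY: "\<And>\<D>. norm (Y \<D> - X \<D>) = norm (?S \<D> - ?R \<D>)"
    for X Y :: "(real \<times> real set) set \<Rightarrow> 'a" and I
  proof (intro allI impI)
    fix e :: real assume e: "e > 0"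
    obtain \<gamma>1 where 1: "gauge \<gamma>1" "\<And>\<D>. \<lbrakk>\<D> tagged_division_of {0..t}; \<gamma>1 fine \<D>\<rbrakk> \<Longrightarrow>
        norm (X \<D> - I) < e / 2" using X e by (meson half_gt_zero)
    obtain \<gamma>2 where 2: "gauge \<gamma>2" "\<And>\<D>. \<lbrakk>\<D> tagged_division_of {0..t}; \<gamma>2 fine \<D>\<rbrakk> \<Longrightarrow>
        norm (?S \<D> - ?R \<D>) < e / 2" using gauge[of "e / 2"] e by auto
    have "norm (Y \<D> - I) < e" if "\<D> tagged_division_of {0..t}" "(\<lambda>x. \<gamma>1 x \<inter> \<gamma>2 x) fine \<D>" for \<D>
    proof -
      have "norm (Y \<D> - I) \<le> norm (Y \<D> - X \<D>) + norm (X \<D> - I)"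
        using norm_triangle_ineq[of "Y \<D> - X \<D>" "X \<D> - I"] by simp
      moreover have "norm (Y \<D> - X \<D>) < e / 2" "norm (X \<D> - I) < e / 2"
        using 1(2) 2(2) XY that by (auto simp: fine_Int)
      ultimately show ?thesis by simp
    qed
    then show "\<exists>\<gamma>. gauge \<gamma> \<and> (\<forall>\<D>. \<D> tagged_division_of {0..t} \<and> \<gamma> fine \<D> \<longrightarrow>
      norm (Y \<D> - I) < e)"
      using gauge_Int[OF 1(1) 2(1)] by blast
  qed
  have "has_stieltjes_integral k h I 0 t \<longleftrightarrow> (g has_integral I) {0..t}" for I
    unfolding has_stieltjes_integral_def has_integral_real
    using transfer[of ?S I ?R] transfer[of ?R I ?S] by (auto simp: norm_minus_commute)
  moreover have "(g has_integral I) {0..t} \<longleftrightarrow>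
      ((\<lambda>s. (1 / (t - s) powr \<rho>) *\<^sub>R h' s) has_integral I) {0..t}" for I
    by (rule has_integral_spike_finite_eq[of "{0, t}"])
      (auto simp: g_def k_def powr_minus divide_inverse)
  ultimately show ?thesis by (simp add: has_caputo_derivative_def k_def)
qed

end

theory Submission
  imports Defs
begin

text \<open>Expanding in the eigenbasis turns the problem into the scalar equations
  \<open>\<Sum>\<^sub>j q j * D\<^sup>\<rho>\<^sup>j y + lam * y = f\<^sub>k\<close>, one for each eigenvalue, and everything depends on estimates that are
  uniform in \<open>lam\<close>. Let \<open>g a t = t powr (a - 1) / Gamma a\<close> and let \<open>*\<close> denote convolution on \<open>[0, t]\<close>. The
  substitution \<open>y = c + g (\<rho> 1) * w\<close> gives the Volterra equation \<open>w + (m + lam g (\<rho> 1)) * w = f\<^sub>k - lam c\<close> with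
  \<open>m = \<Sum>\<^sub>j\<^sub>\<ge>\<^sub>2 q j g (\<rho> 1 - \<rho> j)\<close>. With the fundamental solution \<open>G\<close>, defined by
  \<open>G + (m + lam g (\<rho> 1)) * G = g (\<rho> 1)\<close>, and \<open>E = 1 - lam (1 * G)\<close> its solution is \<open>y = c E + G * f\<^sub>k\<close>.

  All estimates follow from the positivity of \<open>G\<close> (\<open>green_nonneg\<close>), which is a consequence of a comparison
  principle for Caputo derivatives (\<open>caputo_comparison\<close>): if a function attains its maximum over
  \<open>[0, t]\<close> at \<open>t\<close>, all its Caputo derivatives at \<open>t\<close> are nonnegative (\<open>caputo_at_maximum\<close>). With the memory kernel
  \<open>\<kappa> = \<Sum>\<^sub>j q j g (1 - \<rho> j)\<close> the equation of \<open>G\<close>, convolved with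
  \<open>g (1 - \<rho> 1)\<close>, becomes \<open>\<kappa> * G + lam (1 * G) = 1\<close>, that is \<open>E = \<kappa> * G\<close>. So \<open>E\<close> is nonnegative and
  decreasing, and

  \<^item> \<open>lam t E \<le> lam (1 * E) = \<kappa> * (1 - E) \<le> 1 * \<kappa>\<close>, which bounds the contribution of \<open>\<phi>\<close> to \<open>A u\<close> by
    a multiple of \<open>\<Sum>\<^sub>j t powr (- \<rho> j)\<close> (\<open>relaxation_decay\<close>);

  \<^item> \<open>G \<le> g (\<rho> 1)\<close>, and \<open>lam t G \<le> 1\<close> because multiplication by \<open>t\<close> is a derivation of convolution:
    \<open>t G = N * G * G\<close> with \<open>N \<le> \<kappa>\<close>, and \<open>\<kappa> * G * G = E * G \<le> 1 * G \<le> 1 / lam\<close> (\<open>green_decay\<close>). Interpolating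
    the two bounds gives \<open>lam G \<le> const lam powr \<epsilon> t powr (\<epsilon> \<rho> 1 - 1)\<close> (\<open>green_interpolated\<close>), a kernel that
    is integrable and, after \<open>lam powr \<epsilon>\<close> has been absorbed by the norm of \<open>f\<close>, the same for all
    eigenvalues. Minkowski's inequality then bounds the contribution of \<open>f\<close> to \<open>A u\<close>.

  The same estimates for blocks of coefficients show that the series for \<open>u\<close> and \<open>A u\<close> converge uniformly, so
  that \<open>u\<close> is continuous on \<open>[0, T]\<close> and \<open>A u\<close> on \<open>(0, T]\<close>.

  It remains to see that \<open>u\<close> has Caputo derivatives at every point. As \<open>f\<close> is merely continuous, \<open>u\<close> need not be
  differentiable, and the Stieltjes integral has to be treated as it stands. The vector-valued Volterra
  equation \<open>w + m * w = f - A u\<close> has a solution that is continuous on \<open>(0, T]\<close> and integrable at \<open>0\<close>, and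
  \<open>u = \<phi> + g (\<rho> 1) * w = \<phi> + g (\<rho> j) * (g (\<rho> 1 - \<rho> j) * w)\<close>. The Caputo derivative of order \<open>a\<close> inverts the
  convolution with \<open>g a\<close> at points of continuity (\<open>caputo_frac_integral\<close>): after integration by parts the
  truncated integrals are convolutions with an explicit approximate identity. Hence
  \<open>\<Sum>\<^sub>j q j D\<^sup>\<rho>\<^sup>j u = w + m * w = f - A u\<close> (\<open>spectral_solution\<close>).

  Uniqueness is the comparison principle for the coordinates of the difference of two solutions.\<close>

section \<open>Orthonormal bases\<close>

definition orthonormal_basis :: "(nat \<Rightarrow> 'a::real_inner) \<Rightarrow> bool" where
  "orthonormal_basis v \<longleftrightarrow> (\<forall>i j. v i \<bullet> v j = (if i = j then 1 else 0)) \<and>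
     closure (span (range v)) = UNIV"

lemma inner_orthonormal_sum:
  assumes "orthonormal_basis v" "finite A"
  shows "(\<Sum>k\<in>A. c k *\<^sub>R v k) \<bullet> v j = (if j \<in> A then c j else 0)"
  using assms by (simp add: orthonormal_basis_def inner_sum_left if_distrib[of "(*) _"] sum.delta cong: if_cong)

lemma norm_orthonormal_sum:
  assumes "orthonormal_basis v" "finite A"
  shows "(norm (\<Sum>k\<in>A. c k *\<^sub>R v k))\<^sup>2 = (\<Sum>k\<in>A. (c k)\<^sup>2)"
proof -
  define s where "s = (\<Sum>k\<in>A. c k *\<^sub>R v k)"
  have "(norm s)\<^sup>2 = s \<bullet> (\<Sum>k\<in>A. c k *\<^sub>R v k)" by (simp add: power2_norm_eq_inner s_def)
  also have "\<dots> = (\<Sum>j\<in>A. c j * (s \<bullet> v j))" by (simp add: inner_sum_right)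
  finally have "(norm (\<Sum>k\<in>A. c k *\<^sub>R v k))\<^sup>2 = (\<Sum>j\<in>A. c j * ((\<Sum>k\<in>A. c k *\<^sub>R v k) \<bullet> v j))"
    by (simp add: s_def)
  also have "\<dots> = (\<Sum>j\<in>A. (c j)\<^sup>2)"
    by (rule sum.cong) (simp_all add: inner_orthonormal_sum[OF assms] power2_eq_square)
  finally show ?thesis .
qed

lemma bessel_inequality:
  assumes "orthonormal_basis v" "finite A"
  shows "(\<Sum>k\<in>A. (x \<bullet> v k)\<^sup>2) \<le> (norm x)\<^sup>2"
proof -
  let ?p = "\<Sum>k\<in>A. (x \<bullet> v k) *\<^sub>R v k"
  have "?p \<bullet> ?p = (\<Sum>k\<in>A. (x \<bullet> v k)\<^sup>2)"
    using norm_orthonormal_sum[OF assms] by (simp add: power2_norm_eq_inner)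
  moreover have "x \<bullet> ?p = (\<Sum>k\<in>A. (x \<bullet> v k)\<^sup>2)"
    by (simp add: inner_sum_right power2_eq_square)
  moreover have "0 \<le> (x - ?p) \<bullet> (x - ?p)" by simp
  ultimately show ?thesis
    by (simp add: inner_diff_left inner_diff_right power2_norm_eq_inner inner_commute)
qed

text \<open>The difference is orthogonal to the span of the basis, hence to its closure, hence to itself.\<close>

lemma orthonormal_basis_eqI:
  assumes v: "orthonormal_basis v" and eq: "\<And>k. x \<bullet> v k = y \<bullet> v k"
  shows "x = y"
proof -
  have "(x - y) \<bullet> z = 0" for z
  proof -
    have "span (range v) \<subseteq> {z. (x - y) \<bullet> z = 0}"
    proof (rule span_minimal)
      show "range v \<subseteq> {z. (x - y) \<bullet> z = 0}" using eq by (auto simp: inner_diff_left)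
    qed (rule subspace_hyperplane)
    then have "closure (span (range v)) \<subseteq> {z. (x - y) \<bullet> z = 0}"
      by (rule closure_minimal) (rule closed_hyperplane)
    then show ?thesis using v unfolding orthonormal_basis_def by auto
  qed
  from this[of "x - y"] show ?thesis by simp
qed

text \<open>The Cauchy criterion for \<open>\<Sum>\<^sub>k (c k x)\<^sup>2\<close>, uniform in \<open>x \<in> S\<close>. By orthonormality it is the same as
  uniform convergence of \<open>\<Sum>\<^sub>k c k x *\<^sub>R v k\<close>, so continuity of vector-valued series reduces to
  estimates of finite sums of squares.\<close>

definition uniform_tails :: "'b set \<Rightarrow> (nat \<Rightarrow> 'b \<Rightarrow> real) \<Rightarrow> bool" where
  "uniform_tails S c \<longleftrightarrow>
     (\<forall>e>0. \<exists>n0. \<forall>n\<ge>n0. \<forall>N. \<forall>x\<in>S. (\<Sum>k=n..<N. (c k x)\<^sup>2) \<le> e)"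

text \<open>The comparison parameter \<open>y\<close> may depend on \<open>x\<close> and on the block of indices, because the
  coefficients of a convolution at time \<open>t\<close> are controlled by those of the convolved function at the
  time where that block is largest, and not at \<open>t\<close> itself.\<close>

lemma uniform_tails_dominated:
  assumes c: "uniform_tails S' c"
    and le: "\<And>n N x. x \<in> S \<Longrightarrow> \<exists>y\<in>S'. (\<Sum>k=n..<N. (b k x)\<^sup>2) \<le> B * (\<Sum>k=n..<N. (c k y)\<^sup>2)"
  shows "uniform_tails S b"
  unfolding uniform_tails_def
proof (intro allI impI)
  fix e :: real assume e: "e > 0"
  then have "e / (\<bar>B\<bar> + 1) > 0" by simp
  then obtain n0 where n0: "\<And>n N x. \<lbrakk>n \<ge> n0; x \<in> S'\<rbrakk> \<Longrightarrow> (\<Sum>k=n..<N. (c k x)\<^sup>2) \<le> e / (\<bar>B\<bar> + 1)"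
    using c unfolding uniform_tails_def by meson
  have "(\<Sum>k=n..<N. (b k x)\<^sup>2) \<le> e" if n: "n \<ge> n0" and x: "x \<in> S" for n N x
  proof -
    obtain y where y: "y \<in> S'" "(\<Sum>k=n..<N. (b k x)\<^sup>2) \<le> B * (\<Sum>k=n..<N. (c k y)\<^sup>2)"
      using le[OF x] by blast
    have "B * (\<Sum>k=n..<N. (c k y)\<^sup>2) \<le> (\<bar>B\<bar> + 1) * (e / (\<bar>B\<bar> + 1))"
      by (intro mult_mono n0 n y) (auto intro: sum_nonneg)
    also have "\<dots> = e" by simp
    finally show ?thesis using y(2) by simp
  qed
  then show "\<exists>n0. \<forall>n\<ge>n0. \<forall>N. \<forall>x\<in>S. (\<Sum>k=n..<N. (b k x)\<^sup>2) \<le> e" by blast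
qed

lemma orthonormal_expansion:
  fixes v :: "nat \<Rightarrow> 'a::{real_inner, banach}"
  assumes v: "orthonormal_basis v" and c: "uniform_tails S c"
    and cont: "\<And>k. continuous_on S (c k)"
  shows "continuous_on S (\<lambda>x. \<Sum>k. c k x *\<^sub>R v k)"
    and "x \<in> S \<Longrightarrow> (\<lambda>k. c k x *\<^sub>R v k) sums (\<Sum>k. c k x *\<^sub>R v k)"
    and "x \<in> S \<Longrightarrow> (\<Sum>k. c k x *\<^sub>R v k) \<bullet> v j = c j x"
proof -
  have "uniformly_Cauchy_on S (\<lambda>N x. \<Sum>k<N. c k x *\<^sub>R v k)"
  proof (rule uniformly_Cauchy_onI')
    fix e :: real assume e: "e > 0"
    then have "(e / 2)\<^sup>2 > 0" by simp
    then obtain n0 where n0: "\<And>n N x. \<lbrakk>n \<ge> n0; x \<in> S\<rbrakk> \<Longrightarrow> (\<Sum>k=n..<N. (c k x)\<^sup>2) \<le> (e / 2)\<^sup>2"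
      using c unfolding uniform_tails_def by meson
    have "dist (\<Sum>k<n. c k x *\<^sub>R v k) (\<Sum>k<N. c k x *\<^sub>R v k) < e" if "x \<in> S" "n \<ge> n0" "N > n" for x n N
    proof -
      have "(\<Sum>k<N. c k x *\<^sub>R v k) - (\<Sum>k<n. c k x *\<^sub>R v k) = (\<Sum>k=n..<N. c k x *\<^sub>R v k)"
        using sum_diff_nat_ivl[of 0 n N "\<lambda>k. c k x *\<^sub>R v k"] that by (simp add: lessThan_atLeast0)
      moreover have "(norm (\<Sum>k=n..<N. c k x *\<^sub>R v k))\<^sup>2 \<le> (e / 2)\<^sup>2"
        using norm_orthonormal_sum[OF v, of "{n..<N}" "\<lambda>k. c k x"] n0[of n x N] that by simp
      then have "norm (\<Sum>k=n..<N. c k x *\<^sub>R v k) \<le> e / 2"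
        by (rule power2_le_imp_le) (use e in simp)
      ultimately show ?thesis using e by (simp add: dist_norm norm_minus_commute)
    qed
    then show "\<exists>M. \<forall>x\<in>S. \<forall>m\<ge>M. \<forall>n>m. dist (\<Sum>k<m. c k x *\<^sub>R v k) (\<Sum>k<n. c k x *\<^sub>R v k) < e"
      by blast
  qed
  then have "uniformly_convergent_on S (\<lambda>N x. \<Sum>k<N. c k x *\<^sub>R v k)"
    by (rule Cauchy_uniformly_convergent)
  then have ul: "uniform_limit S (\<lambda>N x. \<Sum>k<N. c k x *\<^sub>R v k) (\<lambda>x. \<Sum>k. c k x *\<^sub>R v k) sequentially"
    by (simp add: uniformly_convergent_uniform_limit_iff suminf_eq_lim)
  show "continuous_on S (\<lambda>x. \<Sum>k. c k x *\<^sub>R v k)"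
    by (rule uniform_limit_theorem[OF _ ul]) (auto intro!: always_eventually continuous_intros cont)
  have sums: "(\<lambda>k. c k x *\<^sub>R v k) sums (\<Sum>k. c k x *\<^sub>R v k)" if "x \<in> S" for x
    using tendsto_uniform_limitI[OF ul that] by (simp add: sums_def)
  show "(\<lambda>k. c k x *\<^sub>R v k) sums (\<Sum>k. c k x *\<^sub>R v k)" if "x \<in> S" using sums[OF that] .
  show "(\<Sum>k. c k x *\<^sub>R v k) \<bullet> v j = c j x" if "x \<in> S"
  proof -
    have "(\<lambda>N. (\<Sum>k<N. c k x *\<^sub>R v k) \<bullet> v j) \<longlonglongrightarrow> (\<Sum>k. c k x *\<^sub>R v k) \<bullet> v j"
      using sums[OF that] unfolding sums_def by (intro tendsto_intros)
    moreover have "\<forall>\<^sub>F N in sequentially. (\<Sum>k<N. c k x *\<^sub>R v k) \<bullet> v j = c j x"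
      using eventually_gt_at_top[of j]
      by eventually_elim (simp add: inner_orthonormal_sum[OF v])
    then have "(\<lambda>N. (\<Sum>k<N. c k x *\<^sub>R v k) \<bullet> v j) \<longlonglongrightarrow> c j x" by (rule tendsto_eventually)
    ultimately show ?thesis by (rule LIMSEQ_unique)
  qed
qed

lemma uniform_tails_summable:
  assumes "summable (\<lambda>k. (c k)\<^sup>2)"
  shows "uniform_tails S (\<lambda>k _. c k)"
  unfolding uniform_tails_def
proof (intro allI impI)
  fix e :: real assume e: "e > 0"
  obtain n0 where "\<And>m n. m \<ge> n0 \<Longrightarrow> norm (\<Sum>k=m..<n. (c k)\<^sup>2) < e"
    using assms e unfolding summable_Cauchy by meson
  then show "\<exists>n0. \<forall>n\<ge>n0. \<forall>N. \<forall>x\<in>S. (\<Sum>k=n..<N. (c k)\<^sup>2) \<le> e"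
    by (intro exI[of _ n0]) (auto intro: less_imp_le order_trans[OF abs_ge_self])
qed

lemma uniform_tails_const:
  assumes "orthonormal_basis v"
  shows "uniform_tails S (\<lambda>k _. g \<bullet> v k)"
proof (rule uniform_tails_summable)
  show "summable (\<lambda>k. (g \<bullet> v k)\<^sup>2)"
    by (rule bounded_imp_summable[of _ "(norm g)\<^sup>2"])
      (use bessel_inequality[OF assms, of "{.._}" g] in auto)
qed

lemma orthonormal_sums:
  fixes v :: "nat \<Rightarrow> 'a::{real_inner, banach}"
  assumes v: "orthonormal_basis v"
  shows "(\<lambda>k. (x \<bullet> v k) *\<^sub>R v k) sums x"
proof -
  note E = orthonormal_expansion[where S = "UNIV :: real set" and c = "\<lambda>k _. x \<bullet> v k",
      OF v uniform_tails_const[OF v] continuous_on_const]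
  have "(\<Sum>k. (x \<bullet> v k) *\<^sub>R v k) = x"
    by (rule orthonormal_basis_eqI[OF v]) (use E(3) in simp)
  then show ?thesis using E(2) by simp
qed

text \<open>The image of \<open>F\<close> is totally bounded, so up to \<open>\<eta>\<close> only finitely many vectors occur, and each of
  them has small tails; Bessel's inequality bounds the tails of the remainder by \<open>\<eta>\<^sup>2\<close>.\<close>

lemma uniform_tails_compact:
  fixes F :: "'b::metric_space \<Rightarrow> 'a::real_inner"
  assumes v: "orthonormal_basis v" and S: "compact S" and F: "continuous_on S F"
  shows "uniform_tails S (\<lambda>k x. F x \<bullet> v k)"
  unfolding uniform_tails_def
proof (intro allI impI)
  fix e :: real assume e: "e > 0"
  define \<eta> where "\<eta> = sqrt (e / 4)"
  have \<eta>: "\<eta> > 0" "\<eta>\<^sup>2 = e / 4" using e by (auto simp: \<eta>_def)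
  have "compact (F ` S)" using F S by (rule compact_continuous_image)
  then obtain X where X: "finite X" "F ` S \<subseteq> (\<Union>y\<in>X. ball y \<eta>)"
    using \<eta>(1) unfolding compact_eq_totally_bounded by meson
  have "\<exists>n0. \<forall>n\<ge>n0. \<forall>N. (\<Sum>k=n..<N. (y \<bullet> v k)\<^sup>2) \<le> e / 4" for y
    using uniform_tails_const[OF v, of "UNIV :: unit set" y, unfolded uniform_tails_def,
        THEN spec, THEN mp, of "e / 4"] e by simp
  then obtain n0 where n0: "\<And>y n N. n \<ge> n0 y \<Longrightarrow> (\<Sum>k=n..<N. (y \<bullet> v k)\<^sup>2) \<le> e / 4" by metis
  have "(\<Sum>k=n..<N. (F x \<bullet> v k)\<^sup>2) \<le> e" if n: "n \<ge> Max (insert 0 (n0 ` X))" and x: "x \<in> S" for n N x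
  proof -
    obtain y where y: "y \<in> X" "dist y (F x) < \<eta>" using X(2) x by auto
    have "n0 y \<le> n" using n X(1) y(1) by simp
    have "(F x \<bullet> v k)\<^sup>2 \<le> 2 * ((F x - y) \<bullet> v k)\<^sup>2 + 2 * (y \<bullet> v k)\<^sup>2" for k
      using sum_squares_bound[of "(F x - y) \<bullet> v k" "y \<bullet> v k"]
      by (simp add: inner_diff_left power2_eq_square algebra_simps)
    then have "(\<Sum>k=n..<N. (F x \<bullet> v k)\<^sup>2) \<le> (\<Sum>k=n..<N. 2 * ((F x - y) \<bullet> v k)\<^sup>2 + 2 * (y \<bullet> v k)\<^sup>2)"
      by (rule sum_mono)
    also have "\<dots> = 2 * (\<Sum>k=n..<N. ((F x - y) \<bullet> v k)\<^sup>2) + 2 * (\<Sum>k=n..<N. (y \<bullet> v k)\<^sup>2)"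
      by (simp add: sum.distrib sum_distrib_left)
    also have "\<dots> \<le> 2 * (e / 4) + 2 * (e / 4)"
    proof (intro add_mono mult_left_mono)
      show "(\<Sum>k=n..<N. (y \<bullet> v k)\<^sup>2) \<le> e / 4" using \<open>n0 y \<le> n\<close> by (rule n0)
      have "(\<Sum>k=n..<N. ((F x - y) \<bullet> v k)\<^sup>2) \<le> (norm (F x - y))\<^sup>2"
        by (rule bessel_inequality[OF v]) simp
      also have "\<dots> \<le> \<eta>\<^sup>2" using y(2) by (intro power_mono) (auto simp: dist_norm norm_minus_commute)
      finally show "(\<Sum>k=n..<N. ((F x - y) \<bullet> v k)\<^sup>2) \<le> e / 4" using \<eta>(2) by simp
    qed auto
    finally show ?thesis by simp
  qed
  then show "\<exists>n0. \<forall>n\<ge>n0. \<forall>N. \<forall>x\<in>S. (\<Sum>k=n..<N. (F x \<bullet> v k)\<^sup>2) \<le> e" by blast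
qed

lemma norm_orthonormal_expansion_le:
  fixes v :: "nat \<Rightarrow> 'a::real_inner"
  assumes v: "orthonormal_basis v" and sums: "(\<lambda>k. c k *\<^sub>R v k) sums x" and B: "B \<ge> 0"
    and le: "\<And>N. (\<Sum>k<N. (c k)\<^sup>2) \<le> B\<^sup>2"
  shows "norm x \<le> B"
proof (rule LIMSEQ_le_const2)
  show "(\<lambda>N. norm (\<Sum>k<N. c k *\<^sub>R v k)) \<longlonglongrightarrow> norm x"
    using sums unfolding sums_def by (rule tendsto_norm)
  have "norm (\<Sum>k<N. c k *\<^sub>R v k) \<le> B" for N
    by (rule power2_le_imp_le[OF _ B]) (simp add: norm_orthonormal_sum[OF v] le)
  then show "\<exists>N. \<forall>n\<ge>N. norm (\<Sum>k<n. c k *\<^sub>R v k) \<le> B" by blast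
qed

section \<open>The Stieltjes integral and the Caputo derivative\<close>

abbreviation stieltjes_sum ::
  "(real \<Rightarrow> real) \<Rightarrow> (real \<Rightarrow> 'a::real_normed_vector) \<Rightarrow> (real \<times> real set) set \<Rightarrow> 'a" where
  "stieltjes_sum k h \<D> \<equiv> (\<Sum>(x, K)\<in>\<D>. k x *\<^sub>R (h (Sup K) - h (Inf K)))"

lemma has_stieltjes_integral_gauge:
  fixes h :: "real \<Rightarrow> 'a::real_normed_vector"
  assumes "has_stieltjes_integral k h I a b" "e > 0"
  shows "\<exists>\<gamma>. gauge \<gamma> \<and> (\<forall>\<D>. \<D> tagged_division_of {a..b} \<and> \<gamma> fine \<D> \<longrightarrow>
      norm (stieltjes_sum k h \<D> - I) < e)"
  using assms(1)[unfolded has_stieltjes_integral_def, THEN spec, THEN mp, OF assms(2)] .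

lemma stieltjes_linear:
  fixes h :: "real \<Rightarrow> 'a::real_normed_vector" and L :: "'a \<Rightarrow> 'b::real_normed_vector"
  assumes L: "bounded_linear L" and h: "has_stieltjes_integral k h I a b"
  shows "has_stieltjes_integral k (\<lambda>s. L (h s)) (L I) a b"
  unfolding has_stieltjes_integral_def
proof (intro allI impI)
  fix e :: real assume e: "e > 0"
  interpret L: bounded_linear L by fact
  obtain B where B: "B > 0" "\<And>x. norm (L x) \<le> norm x * B"
    using L.pos_bounded by auto
  have "e / B > 0" using e B by simp
  then obtain \<gamma> where \<gamma>: "gauge \<gamma>" "\<forall>\<D>. \<D> tagged_division_of {a..b} \<and> \<gamma> fine \<D> \<longrightarrow>
      norm (stieltjes_sum k h \<D> - I) < e / B"
    using has_stieltjes_integral_gauge[OF h \<open>e / B > 0\<close>] by (elim exE conjE) (rule that)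
  have "norm (stieltjes_sum k (\<lambda>s. L (h s)) \<D> - L I) < e"
    if D: "\<D> tagged_division_of {a..b}" "\<gamma> fine \<D>" for \<D>
  proof -
    have "stieltjes_sum k (\<lambda>s. L (h s)) \<D> - L I =
        L (stieltjes_sum k h \<D> - I)"
      by (simp add: L.diff L.sum L.scaleR case_prod_beta')
    then show ?thesis
      using B(2)[of "stieltjes_sum k h \<D> - I"] \<gamma>(2)[rule_format, of \<D>] D B(1)
      by (simp add: less_divide_eq)
  qed
  then show "\<exists>\<gamma>. gauge \<gamma> \<and> (\<forall>\<D>. \<D> tagged_division_of {a..b} \<and> \<gamma> fine \<D> \<longrightarrow>
      norm (stieltjes_sum k (\<lambda>s. L (h s)) \<D> - L I) < e)"
    using \<gamma>(1) by blast
qed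

lemma stieltjes_diff:
  fixes h :: "real \<Rightarrow> 'a::real_normed_vector"
  assumes h: "has_stieltjes_integral k h I a b" and h': "has_stieltjes_integral k h' I' a b"
  shows "has_stieltjes_integral k (\<lambda>s. h s - h' s) (I - I') a b"
  unfolding has_stieltjes_integral_def
proof (intro allI impI)
  fix e :: real assume e: "e > 0"
  then have e2: "e / 2 > 0" by simp
  obtain \<gamma> where \<gamma>: "gauge \<gamma>" "\<forall>\<D>. \<D> tagged_division_of {a..b} \<and> \<gamma> fine \<D> \<longrightarrow>
      norm (stieltjes_sum k h \<D> - I) < e / 2"
    using has_stieltjes_integral_gauge[OF h e2] by (elim exE conjE) (rule that)
  obtain \<gamma>' where \<gamma>': "gauge \<gamma>'" "\<forall>\<D>. \<D> tagged_division_of {a..b} \<and> \<gamma>' fine \<D> \<longrightarrow>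
      norm (stieltjes_sum k h' \<D> - I') < e / 2"
    using has_stieltjes_integral_gauge[OF h' e2] by (elim exE conjE) (rule that)
  have "norm (stieltjes_sum k (\<lambda>s. h s - h' s) \<D> - (I - I')) < e"
    if D: "\<D> tagged_division_of {a..b}" "(\<lambda>x. \<gamma> x \<inter> \<gamma>' x) fine \<D>" for \<D>
  proof -
    have "stieltjes_sum k (\<lambda>s. h s - h' s) \<D> - (I - I') =
       (stieltjes_sum k h \<D> - I) -
       (stieltjes_sum k h' \<D> - I')"
      by (simp add: case_prod_beta' sum_subtractf sum.distrib algebra_simps)
    also have "norm \<dots> < e"
      using \<gamma>(2)[rule_format, of \<D>] \<gamma>'(2)[rule_format, of \<D>] D
      by (intro le_less_trans[OF norm_triangle_ineq4]) (auto simp: fine_Int)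
    finally show ?thesis .
  qed
  then show "\<exists>\<gamma>. gauge \<gamma> \<and> (\<forall>\<D>. \<D> tagged_division_of {a..b} \<and> \<gamma> fine \<D> \<longrightarrow>
      norm (stieltjes_sum k (\<lambda>s. h s - h' s) \<D> - (I - I')) < e)"
    using gauge_Int[OF \<gamma>(1) \<gamma>'(1)] by blast
qed

lemma has_caputo_derivative_linear:
  assumes L: "bounded_linear L" and h: "has_caputo_derivative \<rho> h d t"
  shows "has_caputo_derivative \<rho> (\<lambda>s. L (h s)) (L d) t"
proof -
  obtain I where I: "has_stieltjes_integral (\<lambda>s. (t - s) powr (- \<rho>)) h I 0 t"
      "d = (1 / Gamma (1 - \<rho>)) *\<^sub>R I"
    using h unfolding has_caputo_derivative_def by (elim exE conjE) (rule that)
  show ?thesis unfolding has_caputo_derivative_def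
    using stieltjes_linear[OF L I(1)] linear_cmul[OF bounded_linear.linear[OF L]]
    by (intro exI[of _ "L I"] conjI) (simp_all only: I(2))
qed

lemma has_caputo_derivative_diff:
  assumes "has_caputo_derivative \<rho> h d t" "has_caputo_derivative \<rho> h' d' t"
  shows "has_caputo_derivative \<rho> (\<lambda>s. h s - h' s) (d - d') t"
proof -
  obtain I I' where I: "has_stieltjes_integral (\<lambda>s. (t - s) powr (- \<rho>)) h I 0 t"
      "d = (1 / Gamma (1 - \<rho>)) *\<^sub>R I"
    and I': "has_stieltjes_integral (\<lambda>s. (t - s) powr (- \<rho>)) h' I' 0 t"
      "d' = (1 / Gamma (1 - \<rho>)) *\<^sub>R I'"
    using assms unfolding has_caputo_derivative_def by (elim exE conjE) (rule that)
  show ?thesis unfolding has_caputo_derivative_def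
    using stieltjes_diff[OF I(1) I'(1)]
    by (intro exI[of _ "I - I'"] conjI) (simp_all only: I(2) I'(2) scaleR_diff_right)
qed

text \<open>The increments of \<open>H\<close> over short intervals around \<open>x\<close> agree with \<open>k x *\<^sub>R dh\<close> up to a small multiple of
  the length. This is the local information from which Riemann--Stieltjes sums over \<open>[0, c]\<close>, \<open>c < t\<close>,
  telescope to \<open>H c - H 0\<close>. The point \<open>t\<close> is left out: there the Caputo kernel blows up.\<close>

definition stieltjes_primitive ::
  "(real \<Rightarrow> real) \<Rightarrow> (real \<Rightarrow> 'a::real_normed_vector) \<Rightarrow> (real \<Rightarrow> 'a) \<Rightarrow> real \<Rightarrow> bool" where
  "stieltjes_primitive k h H t \<longleftrightarrow> (\<forall>x\<in>{0..<t}. \<forall>e>0. \<exists>\<delta>>0. \<forall>a b. 0 \<le> a \<and> a \<le> x \<and> x \<le> b \<and> b < t \<and>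
      x - a < \<delta> \<and> b - x < \<delta> \<longrightarrow> norm (k x *\<^sub>R (h b - h a) - (H b - H a)) \<le> e * (b - a))"

text \<open>The gauge keeps \<open>t\<close> out of every interval whose tag is smaller than \<open>t\<close>, so that \<open>t\<close> has to be the tag
  of the last interval, where the kernel has the value \<open>0\<close>.\<close>

lemma stieltjes_primitive_gauge:
  assumes P: "stieltjes_primitive k h H t" and e: "e > 0"
  shows "\<exists>\<gamma>. gauge \<gamma> \<and> (\<forall>x<t. t \<notin> \<gamma> x) \<and>
    (\<forall>c x K \<D>. \<D> tagged_division_of {0..c} \<and> \<gamma> fine \<D> \<and> c \<le> t \<and> (x, K) \<in> \<D> \<and> x < t \<longrightarrow>
      norm (k x *\<^sub>R (h (Sup K) - h (Inf K)) - (H (Sup K) - H (Inf K))) \<le> e * measure lborel K)"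
proof -
  have "\<exists>\<delta>>0. 0 \<le> x \<and> x < t \<longrightarrow> (\<forall>a b. 0 \<le> a \<and> a \<le> x \<and> x \<le> b \<and> b < t \<and>
      x - a < \<delta> \<and> b - x < \<delta> \<longrightarrow> norm (k x *\<^sub>R (h b - h a) - (H b - H a)) \<le> e * (b - a))" for x
  proof (cases "0 \<le> x \<and> x < t")
    case True
    then have "x \<in> {0..<t}" by simp
    from P[unfolded stieltjes_primitive_def, THEN bspec, OF this, THEN spec, THEN mp, OF e]
    obtain \<delta> where "\<delta> > 0" "\<forall>a b. 0 \<le> a \<and> a \<le> x \<and> x \<le> b \<and> b < t \<and>
      x - a < \<delta> \<and> b - x < \<delta> \<longrightarrow> norm (k x *\<^sub>R (h b - h a) - (H b - H a)) \<le> e * (b - a)"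
      by (elim exE conjE) (rule that)
    then show ?thesis by (intro exI[of _ \<delta>] conjI impI)
  qed (auto intro: exI[of _ 1])
  then have "\<exists>\<delta>. \<forall>x. \<delta> x > 0 \<and> (0 \<le> x \<and> x < t \<longrightarrow> (\<forall>a b. 0 \<le> a \<and> a \<le> x \<and> x \<le> b \<and> b < t \<and>
      x - a < \<delta> x \<and> b - x < \<delta> x \<longrightarrow> norm (k x *\<^sub>R (h b - h a) - (H b - H a)) \<le> e * (b - a)))"
    by (intro choice allI)
  then obtain \<delta> where \<delta>0: "\<forall>x. \<delta> x > 0 \<and> (0 \<le> x \<and> x < t \<longrightarrow> (\<forall>a b. 0 \<le> a \<and> a \<le> x \<and> x \<le> b \<and> b < t \<and>
      x - a < \<delta> x \<and> b - x < \<delta> x \<longrightarrow> norm (k x *\<^sub>R (h b - h a) - (H b - H a)) \<le> e * (b - a)))"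
    by (elim exE)
  have \<delta>: "\<delta> x > 0" "\<lbrakk>0 \<le> a; a \<le> x; x \<le> b; b < t; x - a < \<delta> x; b - x < \<delta> x\<rbrakk> \<Longrightarrow>
       norm (k x *\<^sub>R (h b - h a) - (H b - H a)) \<le> e * (b - a)" for x a b
    using \<delta>0[THEN spec, of x] by auto
  define r where "r x = (if x < t then min (\<delta> x) (t - x) else 1)" for x
  define \<gamma> where "\<gamma> x = ball x (r x)" for x
  have r: "r x > 0" for x using \<delta>(1) by (simp add: r_def)
  show ?thesis
  proof (intro exI[of _ \<gamma>] conjI allI impI; (elim conjE)?)
    show "gauge \<gamma>" unfolding gauge_def \<gamma>_def using r by simp
    show "t \<notin> \<gamma> x" if "x < t" for x using that by (auto simp: \<gamma>_def r_def dist_real_def)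
    fix c x K \<D> assume D: "\<D> tagged_division_of {0..c}" "\<gamma> fine \<D>" and c: "c \<le> t"
      and xK: "(x, K) \<in> \<D>" "x < t"
    obtain a b where ab: "K = {a..b}" using tagged_division_ofD(4)[OF D(1) xK(1)] by auto
    have sub: "x \<in> K" "K \<subseteq> {0..c}" using tagged_division_ofD(2,3)[OF D(1) xK(1)] by auto
    have axb: "a \<le> x" "x \<le> b" "0 \<le> a" "b \<le> c" using sub ab by auto
    have "K \<subseteq> ball x (r x)" using D(2) xK by (auto simp: fine_def \<gamma>_def)
    moreover have "a \<in> K" "b \<in> K" using ab axb by auto
    ultimately have "x - a < r x" "b - x < r x"
      by (auto simp: dist_real_def subset_iff)
    then have "x - a < \<delta> x" "b - x < \<delta> x" "b < t" using xK(2) by (auto simp: r_def)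
    then have "norm (k x *\<^sub>R (h b - h a) - (H b - H a)) \<le> e * (b - a)"
      using \<delta>(2) axb by auto
    then show "norm (k x *\<^sub>R (h (Sup K) - h (Inf K)) - (H (Sup K) - H (Inf K))) \<le> e * measure lborel K"
      using ab axb by simp
  qed
qed

lemma stieltjes_primitive_sum:
  fixes h :: "real \<Rightarrow> 'a::real_normed_vector"
  assumes D: "\<D> tagged_division_of {0..c}" and c: "0 \<le> c"
    and bd: "\<And>x K. (x, K) \<in> \<D> \<Longrightarrow>
      norm (k x *\<^sub>R (h (Sup K) - h (Inf K)) - (H (Sup K) - H (Inf K))) \<le> e * measure lborel K"
  shows "norm (stieltjes_sum k h \<D> - (H c - H 0)) \<le> e * c"
proof -
  have "stieltjes_sum k h \<D> - (H c - H 0) =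
     (\<Sum>(x, K)\<in>\<D>. k x *\<^sub>R (h (Sup K) - h (Inf K)) - (H (Sup K) - H (Inf K)))"
    using additive_tagged_division_1[OF c D, of H] by (simp add: case_prod_beta' sum_subtractf)
  also have "norm \<dots> \<le> (\<Sum>(x, K)\<in>\<D>. e * measure lborel K)"
    by (rule sum_norm_le) (use bd in auto)
  also have "\<dots> = e * (\<Sum>(x, K)\<in>\<D>. measure lborel K)" by (simp add: sum_distrib_left case_prod_beta')
  also have "(\<Sum>(x, K)\<in>\<D>. measure lborel K) = c"
    using additive_content_tagged_division[of \<D> 0 c] D c by simp
  finally show ?thesis .
qed

text \<open>Together with \<open>stieltjes_of_limit\<close> this is Hake's theorem: since the kernel vanishes at \<open>t\<close>, an interval
  \<open>[c, t]\<close> with tag \<open>t\<close> contributes nothing, and appending it to a fine division of \<open>[0, c]\<close> shows that the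
  Stieltjes integral over \<open>[0, t]\<close> is the limit of the integrals over \<open>[0, c]\<close>. In this way a pointwise
  Caputo derivative becomes an improper integral, which can be computed.\<close>

lemma stieltjes_limit:
  fixes h :: "real \<Rightarrow> 'a::real_normed_vector"
  assumes t: "0 < t" and kt: "k t = 0" and P: "stieltjes_primitive k h H t"
    and I: "has_stieltjes_integral k h I 0 t"
  shows "((\<lambda>c. H c - H 0) \<longlongrightarrow> I) (at_left t)"
proof (rule tendstoI)
  fix e :: real assume e: "e > 0"
  then have e2: "e / 2 > 0" "e / (4 * t) > 0" using t by auto
  obtain \<gamma>1 where 1: "gauge \<gamma>1" "\<forall>\<D>. \<D> tagged_division_of {0..t} \<and> \<gamma>1 fine \<D> \<longrightarrow>
      norm (stieltjes_sum k h \<D> - I) < e / 2"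
    using has_stieltjes_integral_gauge[OF I e2(1)] by (elim exE conjE) (rule that)
  obtain \<gamma>2 where 2: "gauge \<gamma>2" "\<forall>x<t. t \<notin> \<gamma>2 x"
    "\<forall>c x K \<D>. \<D> tagged_division_of {0..c} \<and> \<gamma>2 fine \<D> \<and> c \<le> t \<and> (x, K) \<in> \<D> \<and> x < t \<longrightarrow>
      norm (k x *\<^sub>R (h (Sup K) - h (Inf K)) - (H (Sup K) - H (Inf K))) \<le> e / (4 * t) * measure lborel K"
    using stieltjes_primitive_gauge[OF P e2(2)] by (elim exE conjE) (rule that)
  obtain r where r: "r > 0" "ball t r \<subseteq> \<gamma>1 t"
    using 1(1) unfolding gauge_def by (metis open_contains_ball)
  have "dist (H c - H 0) I < e" if c: "max 0 (t - r) < c" "c < t" for c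
  proof -
    obtain \<D> where D: "\<D> tagged_division_of {0..c}" "(\<lambda>x. \<gamma>1 x \<inter> \<gamma>2 x) fine \<D>"
      using fine_division_exists_real[OF gauge_Int[OF 1(1) 2(1)]] by blast
    have fin: "finite \<D>" using D by blast
    have tags: "x \<le> c" if "(x, K) \<in> \<D>" for x K
      using tagged_division_ofD(2,3)[OF D(1) that] by auto
    have notin: "(t, {c..t}) \<notin> \<D>" using tags c by force
    have T: "insert (t, {c..t}) \<D> tagged_division_of {0..t}"
    proof -
      have "{(t, {c..t})} tagged_division_of {c..t}"
        using tagged_division_of_self_real[of t c t] c by simp
      then have "\<D> \<union> {(t, {c..t})} tagged_division_of ({0..c} \<union> {c..t})"
        using D(1) c by (intro tagged_division_Un) auto
      moreover have "{0..c} \<union> {c..t} = {0..t}" using c by auto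
      ultimately show ?thesis by simp
    qed
    have "\<gamma>1 fine insert (t, {c..t}) \<D>"
      using D(2) r c by (auto simp: fine_def dist_real_def subset_iff)
    with 1(2)[rule_format, of "insert (t, {c..t}) \<D>"] T
    have A: "norm (stieltjes_sum k h \<D> - I) < e / 2"
      using fin notin kt by simp
    have "norm (stieltjes_sum k h \<D> - (H c - H 0)) \<le> e / (4 * t) * c"
    proof (rule stieltjes_primitive_sum[OF D(1)])
      fix x K assume xK: "(x, K) \<in> \<D>"
      show "norm (k x *\<^sub>R (h (Sup K) - h (Inf K)) - (H (Sup K) - H (Inf K))) \<le> e / (4 * t) * measure lborel K"
        using 2(3)[rule_format, of \<D> c x K] D xK c tags[OF xK] by (auto simp: fine_Int)
    qed (use c in auto)
    also have "\<dots> \<le> e / (4 * t) * t" using c e t by (intro mult_left_mono) auto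
    also have "\<dots> < e / 2" using e t by simp
    finally have B: "norm (stieltjes_sum k h \<D> - (H c - H 0)) < e / 2" .
    have "H c - H 0 - I = (stieltjes_sum k h \<D> - I) -
       (stieltjes_sum k h \<D> - (H c - H 0))" by simp
    also have "norm \<dots> \<le> norm (stieltjes_sum k h \<D> - I) +
      norm (stieltjes_sum k h \<D> - (H c - H 0))"
      by (rule norm_triangle_ineq4)
    finally show ?thesis using A B by (simp add: dist_norm)
  qed
  then show "\<forall>\<^sub>F c in at_left t. dist (H c - H 0) I < e"
    unfolding eventually_at_left_field using t r(1) by (intro exI[of _ "max 0 (t - r)"]) auto
qed

text \<open>At most one interval of positive length in a division of \<open>[0, t]\<close> contains \<open>t\<close>.\<close>

lemma stieltjes_endpoint_sum_right:
  fixes h :: "real \<Rightarrow> 'a::real_normed_vector"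
  assumes D: "\<D> tagged_division_of {0..t}" and c: "0 \<le> c"
    and small: "\<And>K. (t, K) \<in> \<D> \<Longrightarrow> norm (h (Sup K) - h (Inf K)) \<le> c"
  shows "(\<Sum>(x, K)\<in>\<D>. if x = t then norm (h (Sup K) - h (Inf K)) else 0) \<le> c"
proof -
  let ?g = "\<lambda>(x::real, K). if x = t then norm (h (Sup K) - h (Inf K)) else (0::real)"
  have fin: "finite \<D>" using D by blast
  define P where "P = {p \<in> \<D>. ?g p \<noteq> 0}"
  have shape: "\<exists>v<t. K = {v..t}" if "(x, K) \<in> P" for x K
  proof -
    have xK: "(x, K) \<in> \<D>" "x = t" "h (Sup K) \<noteq> h (Inf K)"
      using that by (auto simp: P_def split: if_splits)
    obtain a b where ab: "K = cbox a b" using tagged_division_ofD(4)[OF D xK(1)] by blast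
    have "t \<in> K" "K \<subseteq> {0..t}" using tagged_division_ofD(2,3)[OF D xK(1)] xK(2) by auto
    with ab have "a \<le> t" "t \<le> b" "b \<le> t" by auto
    with ab xK(3) have "b = t" "a < t" by (auto simp: order_less_le)
    with ab show ?thesis by auto
  qed
  have uniq: "p = p'" if p: "p \<in> P" and p': "p' \<in> P" for p p'
  proof (rule ccontr)
    assume ne: "p \<noteq> p'"
    obtain x K x' K' where eq: "p = (x, K)" "p' = (x', K')" by fastforce
    obtain v v' where v: "v < t" "K = {v..t}" "v' < t" "K' = {v'..t}"
      using shape p p' eq by blast
    have "interior K \<inter> interior K' = {}"
      using tagged_division_ofD(5)[OF D, of x K x' K'] p p' eq ne by (auto simp: P_def)
    moreover have "(max v v' + t) / 2 \<in> interior K \<inter> interior K'" using v by (auto simp: max_def)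
    ultimately show False by blast
  qed
  have "sum ?g \<D> = sum ?g P"
    by (rule sum.mono_neutral_right) (use fin in \<open>auto simp: P_def\<close>)
  also have "\<dots> \<le> c"
  proof (cases "P = {}")
    case False
    then obtain p where "P = {p}" using uniq by blast
    then show ?thesis using small c by (cases p) (auto simp: P_def)
  qed (use c in simp)
  finally show ?thesis .
qed

text \<open>Extending \<open>H\<close> to \<open>t\<close> by its limit makes the telescoping sum run up to \<open>t\<close>. The interval with tag \<open>t\<close>
  contributes \<open>0\<close> to the Stieltjes sum and, as \<open>H\<close> has a limit, little to the telescoping one.\<close>

lemma stieltjes_of_limit:
  fixes h :: "real \<Rightarrow> 'a::real_normed_vector"
  assumes t: "0 < t" and kt: "k t = 0" and P: "stieltjes_primitive k h H t"
    and lim: "((\<lambda>c. H c - H 0) \<longlongrightarrow> I) (at_left t)"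
  shows "has_stieltjes_integral k h I 0 t"
  unfolding has_stieltjes_integral_def
proof (intro allI impI)
  fix e :: real assume e: "e > 0"
  then have e2: "e / (4 * t) > 0" using t by auto
  obtain \<gamma> where \<gamma>: "gauge \<gamma>" "\<forall>x<t. t \<notin> \<gamma> x"
    "\<forall>c x K \<D>. \<D> tagged_division_of {0..c} \<and> \<gamma> fine \<D> \<and> c \<le> t \<and> (x, K) \<in> \<D> \<and> x < t \<longrightarrow>
      norm (k x *\<^sub>R (h (Sup K) - h (Inf K)) - (H (Sup K) - H (Inf K))) \<le> e / (4 * t) * measure lborel K"
    using stieltjes_primitive_gauge[OF P e2] by (elim exE conjE) (rule that)
  define H' where "H' c = (if c < t then H c else I + H 0)" for c
  have "\<forall>\<^sub>F c in at_left t. dist (H c - H 0) I < e / 4" using tendstoD[OF lim, of "e / 4"] e by simp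
  then obtain r where r: "r < t" "\<And>c. \<lbrakk>r < c; c < t\<rbrakk> \<Longrightarrow> dist (H c - H 0) I < e / 4"
    unfolding eventually_at_left_field by blast
  have near: "norm (H' t - H' c) \<le> e / 4" if "r < c" "c \<le> t" for c
    using r(2)[of c] that e by (auto simp: H'_def dist_norm norm_minus_commute algebra_simps)
  define \<gamma>' where "\<gamma>' x = \<gamma> x \<inter> (if x = t then {r<..} else UNIV)" for x
  have "norm (stieltjes_sum k h \<D> - I) < e"
    if D: "\<D> tagged_division_of {0..t}" and fine: "\<gamma>' fine \<D>" for \<D>
  proof -
    have fine1: "\<gamma> fine \<D>" using fine by (auto simp: fine_def \<gamma>'_def)
    define z where "z = (\<lambda>(x::real, K). if x = t then norm (H' (Sup K) - H' (Inf K)) else (0::real))"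
    have small: "norm (H' (Sup K) - H' (Inf K)) \<le> e / 4" if tK: "(t, K) \<in> \<D>" for K
    proof -
      obtain a b where ab: "K = {a..b}" using tagged_division_ofD(4)[OF D tK] by auto
      have sub: "t \<in> K" "K \<subseteq> {0..t}" using tagged_division_ofD(2,3)[OF D tK] by auto
      have "a \<le> t" "b = t" using sub ab by auto
      moreover have "K \<subseteq> \<gamma>' t" using fine tK by (auto simp: fine_def)
      then have "K \<subseteq> {r<..}" by (simp add: \<gamma>'_def)
      ultimately show ?thesis using near[of a] ab by auto
    qed
    have bd: "norm (k x *\<^sub>R (h (Sup K) - h (Inf K)) - (H' (Sup K) - H' (Inf K))) \<le>
        e / (4 * t) * measure lborel K + z (x, K)" if xK: "(x, K) \<in> \<D>" for x K
    proof -
      obtain a b where ab: "K = {a..b}" using tagged_division_ofD(4)[OF D xK] by auto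
      have sub: "x \<in> K" "K \<subseteq> {0..t}" using tagged_division_ofD(2,3)[OF D xK] by auto
      have axb: "a \<le> x" "x \<le> b" "0 \<le> a" "b \<le> t" using sub ab by auto
      show ?thesis
      proof (cases "x < t")
        case True
        have "K \<subseteq> \<gamma> x" using fine1 xK by (auto simp: fine_def)
        then have "t \<notin> K" using \<gamma>(2) True by auto
        then have "b < t" "a < t" using ab axb True by auto
        then show ?thesis
          using \<gamma>(3)[rule_format, of \<D> t x K] D fine1 xK True ab axb by (simp add: z_def H'_def)
      next
        case False
        then have "x = t" using axb by simp
        then show ?thesis using kt e t by (simp add: z_def norm_minus_commute)
      qed
    qed
    have "stieltjes_sum k h \<D> - (H' t - H' 0) =
       (\<Sum>(x, K)\<in>\<D>. k x *\<^sub>R (h (Sup K) - h (Inf K)) - (H' (Sup K) - H' (Inf K)))"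
      using additive_tagged_division_1[OF less_imp_le[OF t] D, of H']
      by (simp add: case_prod_beta' sum_subtractf)
    also have "norm \<dots> \<le> (\<Sum>(x, K)\<in>\<D>. e / (4 * t) * measure lborel K + z (x, K))"
      by (rule sum_norm_le) (use bd in auto)
    also have "\<dots> = e / (4 * t) * (\<Sum>(x, K)\<in>\<D>. measure lborel K) + sum z \<D>"
      by (simp add: sum_distrib_left case_prod_beta' sum.distrib)
    also have "(\<Sum>(x, K)\<in>\<D>. measure lborel K) = t"
      using additive_content_tagged_division[of \<D> 0 t] D t by simp
    also have "sum z \<D> \<le> e / 4"
      unfolding z_def by (rule stieltjes_endpoint_sum_right[OF D]) (use small e in auto)
    finally show ?thesis using e t by (simp add: H'_def)
  qed
  moreover have "gauge \<gamma>'"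
    using \<gamma>(1) r(1) unfolding gauge_def \<gamma>'_def by (auto intro: open_Int)
  ultimately show "\<exists>\<gamma>. gauge \<gamma> \<and> (\<forall>\<D>. \<D> tagged_division_of {0..t} \<and> \<gamma> fine \<D> \<longrightarrow>
      norm (stieltjes_sum k h \<D> - I) < e)"
    by blast
qed


text \<open>Integration by parts: \<open>k dh = d(k h) - h dk\<close>. The error vanishes for constant \<open>h\<close>, so \<open>h\<close> may be replaced by
  \<open>h - h x\<close>, which is small near \<open>x\<close> while \<open>k'\<close> is bounded there.\<close>

lemma stieltjes_primitive_by_parts:
  fixes h :: "real \<Rightarrow> 'a::banach" and k k' :: "real \<Rightarrow> real"
  assumes der: "\<And>s. \<lbrakk>0 \<le> s; s < t\<rbrakk> \<Longrightarrow> (k has_real_derivative k' s) (at s)"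
    and k': "continuous_on {0..<t} k'" and h: "continuous_on {0..t} h"
  shows "stieltjes_primitive k h (\<lambda>c. k c *\<^sub>R h c - integral {0..c} (\<lambda>s. k' s *\<^sub>R h s)) t"
  unfolding stieltjes_primitive_def
proof (intro ballI allI impI)
  fix x e :: real assume x: "x \<in> {0..<t}" and e: "e > 0"
  have "compact (k' ` {0..(x + t) / 2})"
    using x by (intro compact_continuous_image continuous_on_subset[OF k']) auto
  then have "bounded (k' ` {0..(x + t) / 2})" by (rule compact_imp_bounded)
  then obtain B where B: "B > 0" "\<And>s. s \<in> {0..(x + t) / 2} \<Longrightarrow> \<bar>k' s\<bar> \<le> B"
    unfolding bounded_pos by auto
  define \<eta> where "\<eta> = e / (2 * B)"
  have \<eta>: "\<eta> > 0" "2 * B * \<eta> = e" using e B by (auto simp: \<eta>_def)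
  obtain d where d: "d > 0" "\<And>s. \<lbrakk>s \<in> {0..t}; \<bar>s - x\<bar> < d\<rbrakk> \<Longrightarrow> norm (h s - h x) < \<eta>"
  proof -
    have "x \<in> {0..t}" using x by auto
    with h \<eta>(1) show ?thesis
      using that unfolding continuous_on_iff dist_norm real_norm_def by blast
  qed
  show "\<exists>\<delta>>0. \<forall>a b. 0 \<le> a \<and> a \<le> x \<and> x \<le> b \<and> b < t \<and> x - a < \<delta> \<and> b - x < \<delta> \<longrightarrow>
      norm (k x *\<^sub>R (h b - h a) - ((k b *\<^sub>R h b - integral {0..b} (\<lambda>s. k' s *\<^sub>R h s)) -
        (k a *\<^sub>R h a - integral {0..a} (\<lambda>s. k' s *\<^sub>R h s)))) \<le> e * (b - a)"
  proof (intro exI[of _ "min d ((t - x) / 2)"] conjI allI impI; (elim conjE)?)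
    show "0 < min d ((t - x) / 2)" using d(1) x by auto
    fix a b assume a: "0 \<le> a" "a \<le> x" and b: "x \<le> b" "b < t"
      and da: "x - a < min d ((t - x) / 2)" and db: "b - x < min d ((t - x) / 2)"
    have b2: "b \<le> (x + t) / 2" using db by (auto simp: field_simps)
    have sub: "{a..b} \<subseteq> {0..<t}" using a b by auto
    have FTC: "(k' has_integral (k v - k u)) {u..v}" if "0 \<le> u" "u \<le> v" "v < t" for u v
      using that der
      by (intro fundamental_theorem_of_calculus)
        (auto simp: has_real_derivative_iff_has_vector_derivative[symmetric] intro: has_field_derivative_at_within)
    have diff: "\<bar>k v - k u\<bar> \<le> B * (v - u)" if "0 \<le> u" "u \<le> v" "v \<le> b" for u v
    proof -
      have "norm (k v - k u) \<le> B * measure lborel (cbox u v)"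
        by (rule has_integral_bound[of B k']) (use FTC[of u v] B that b b2 in auto)
      then show ?thesis using that by simp
    qed
    have cont: "continuous_on {0..b} (\<lambda>s. k' s *\<^sub>R h s)"
      by (intro continuous_intros continuous_on_subset[OF k'] continuous_on_subset[OF h]) (use b in auto)
    then have "(\<lambda>s. k' s *\<^sub>R h s) integrable_on {0..b}" by (rule integrable_continuous_real)
    then have comb: "integral {0..b} (\<lambda>s. k' s *\<^sub>R h s) =
        integral {0..a} (\<lambda>s. k' s *\<^sub>R h s) + integral {a..b} (\<lambda>s. k' s *\<^sub>R h s)"
      using a b by (intro Henstock_Kurzweil_Integration.integral_combine[symmetric]) auto
    have cont2: "continuous_on {a..b} (\<lambda>s. k' s *\<^sub>R h s)"
      by (rule continuous_on_subset[OF cont]) (use a in auto)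
    have "((\<lambda>s. k' s *\<^sub>R h s - k' s *\<^sub>R h x) has_integral
        (integral {a..b} (\<lambda>s. k' s *\<^sub>R h s) - (k b - k a) *\<^sub>R h x)) {a..b}"
      using FTC[of a b] a b
      by (intro has_integral_diff integrable_integral integrable_continuous_real cont2 has_integral_scaleR_left) auto
    moreover have "norm (k' s *\<^sub>R h s - k' s *\<^sub>R h x) \<le> B * \<eta>" if s: "s \<in> {a..b}" for s
    proof -
      have "norm (k' s *\<^sub>R (h s - h x)) \<le> B * \<eta>"
        unfolding norm_scaleR using s a b b2 da db
        using B(1) by (intro mult_mono B(2) less_imp_le[OF d(2)]) auto
      then show ?thesis by (simp add: scaleR_diff_right)
    qed
    ultimately have "norm (integral {a..b} (\<lambda>s. k' s *\<^sub>R h s) - (k b - k a) *\<^sub>R h x) \<le>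
        B * \<eta> * measure lborel {a..b}"
      using B(1) \<eta>(1)
        has_integral_bound[of "B * \<eta>" "\<lambda>s. k' s *\<^sub>R h s - k' s *\<^sub>R h x" _ a b] by simp
    then have 1: "norm (integral {a..b} (\<lambda>s. k' s *\<^sub>R h s) - (k b - k a) *\<^sub>R h x) \<le> B * \<eta> * (b - a)"
      using a b by simp
    have 2: "norm ((k b - k x) *\<^sub>R (h b - h x)) \<le> B * (b - x) * \<eta>"
      unfolding norm_scaleR using diff[of x b] d(2)[of b] a b db B
      by (intro mult_mono) auto
    have 3: "norm ((k x - k a) *\<^sub>R (h a - h x)) \<le> B * (x - a) * \<eta>"
      unfolding norm_scaleR using diff[of a x] d(2)[of a] a b da B
      by (intro mult_mono) auto
    have "k x *\<^sub>R (h b - h a) - ((k b *\<^sub>R h b - integral {0..b} (\<lambda>s. k' s *\<^sub>R h s)) -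
        (k a *\<^sub>R h a - integral {0..a} (\<lambda>s. k' s *\<^sub>R h s))) =
      (integral {a..b} (\<lambda>s. k' s *\<^sub>R h s) - (k b - k a) *\<^sub>R h x)
        - (k b - k x) *\<^sub>R (h b - h x) - (k x - k a) *\<^sub>R (h a - h x)"
      by (simp add: comb algebra_simps)
    also have "norm \<dots> \<le> B * \<eta> * (b - a) + B * (b - x) * \<eta> + B * (x - a) * \<eta>"
      by (rule order_trans[OF norm_triangle_ineq4 add_mono[OF order_trans[OF norm_triangle_ineq4 add_mono]]])
        (fact 1 2 3)+
    also have "\<dots> = (2 * B * \<eta>) * (b - a)" by (simp add: algebra_simps)
    finally show "norm (k x *\<^sub>R (h b - h a) - ((k b *\<^sub>R h b - integral {0..b} (\<lambda>s. k' s *\<^sub>R h s)) -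
        (k a *\<^sub>R h a - integral {0..a} (\<lambda>s. k' s *\<^sub>R h s)))) \<le> e * (b - a)"
      using \<eta>(2) by simp
  qed
qed

lemma caputo_kernel_primitive:
  fixes h :: "real \<Rightarrow> 'a::banach"
  assumes h: "continuous_on {0..t} h"
  shows "stieltjes_primitive (\<lambda>s. (t - s) powr (- \<rho>)) h
    (\<lambda>c. (t - c) powr (- \<rho>) *\<^sub>R h c - integral {0..c} (\<lambda>s. (\<rho> * (t - s) powr (- \<rho> - 1)) *\<^sub>R h s)) t"
  by (rule stieltjes_primitive_by_parts[OF _ _ h])
    (auto intro!: derivative_eq_intros continuous_intros)

text \<open>With \<open>g = h t - h \<ge> 0\<close>, integration by parts turns the truncated integral of \<open>k dh\<close> over \<open>[0, c]\<close> into
  \<open>k 0 * g 0 + \<integral>\<^sub>0\<^sup>c k' g - k c * g c\<close>. The only harmful term is the last one, which need not tend to \<open>0\<close> for a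
  function that is merely continuous. It suffices, however, to look at points \<open>c\<close> where \<open>g\<close> is minimal
  on \<open>[c1, c]\<close>, for a fixed \<open>c1\<close> near \<open>t\<close>: there \<open>\<integral> k' g \<ge> g c * (k c - k c1)\<close> nearly compensates it.\<close>

lemma caputo_at_maximum:
  fixes h :: "real \<Rightarrow> real"
  assumes t: "0 < t" and \<rho>: "0 < \<rho>" "\<rho> < 1" and h: "continuous_on {0..t} h"
    and d: "has_caputo_derivative \<rho> h d t" and max: "\<And>s. s \<in> {0..t} \<Longrightarrow> h s \<le> h t"
  shows "t powr (- \<rho>) * (h t - h 0) / Gamma (1 - \<rho>) \<le> d"
proof -
  define k where "k s = (t - s) powr (- \<rho>)" for s
  define k' where "k' s = \<rho> * (t - s) powr (- \<rho> - 1)" for s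
  define H where "H c = k c *\<^sub>R h c - integral {0..c} (\<lambda>s. k' s *\<^sub>R h s)" for c
  define g where "g s = h t - h s" for s
  define \<Phi> where "\<Phi> c = integral {0..c} (\<lambda>s. k' s * g s)" for c
  obtain I where I: "has_stieltjes_integral k h I 0 t" "d = I / Gamma (1 - \<rho>)"
    using d unfolding has_caputo_derivative_def k_def by auto
  have lim: "((\<lambda>c. H c - H 0) \<longlongrightarrow> I) (at_left t)"
  proof (rule stieltjes_limit[where H = H, OF t _ _ I(1)])
    show "stieltjes_primitive k h H t"
      using caputo_kernel_primitive[OF h, of \<rho>] unfolding H_def k_def k'_def .
  qed (simp add: k_def)
  have k'0: "0 \<le> k' s" for s using \<rho> by (simp add: k'_def)
  have k0: "0 \<le> k s" for s by (simp add: k_def)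
  have g0: "0 \<le> g s" if "s \<in> {0..t}" for s using max[OF that] by (simp add: g_def)
  have contk': "continuous_on {0..<t} k'"
    unfolding k'_def by (intro continuous_intros) auto
  have contg: "continuous_on {0..t} g" unfolding g_def by (intro continuous_intros h)
  have FTC: "(k' has_integral (k v - k u)) {u..v}" if "0 \<le> u" "u \<le> v" "v < t" for u v
    by (rule fundamental_theorem_of_calculus)
      (use that in \<open>auto simp: has_real_derivative_iff_has_vector_derivative[symmetric] k_def k'_def
        intro!: derivative_eq_intros\<close>)
  have cont: "continuous_on {u..v} (\<lambda>s. k' s * h s)" "continuous_on {u..v} (\<lambda>s. k' s * g s)"
    if "0 \<le> u" "v < t" for u v
    by (intro continuous_intros continuous_on_subset[OF contk'] continuous_on_subset[OF h]
        continuous_on_subset[OF contg]; use that in auto)+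
  have HH: "H c - H 0 = k 0 * g 0 + (\<Phi> c - k c * g c)" if c: "0 \<le> c" "c < t" for c
  proof -
    have "((\<lambda>s. k' s * h t - k' s * h s) has_integral ((k c - k 0) * h t - integral {0..c} (\<lambda>s. k' s * h s))) {0..c}"
      by (intro has_integral_diff integrable_integral integrable_continuous_real cont has_integral_mult_left FTC)
        (use c in auto)
    then have "\<Phi> c = (k c - k 0) * h t - integral {0..c} (\<lambda>s. k' s * h s)"
      unfolding \<Phi>_def g_def right_diff_distrib by (rule integral_unique)
    then show ?thesis by (simp add: H_def g_def algebra_simps)
  qed
  have "I \<ge> k 0 * g 0"
  proof (rule ccontr)
    assume "\<not> I \<ge> k 0 * g 0"
    then obtain \<eta> where \<eta>: "\<eta> > 0" "I < k 0 * g 0 - \<eta>"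
      by (metis add_diff_cancel_left' dense diff_gt_0_iff_gt diff_diff_eq2 linorder_not_le)
    have "\<forall>\<^sub>F c in at_left t. H c - H 0 < k 0 * g 0 - \<eta>" by (rule order_tendstoD(2)[OF lim \<eta>(2)])
    then obtain c0 where c0: "c0 < t" "\<And>c. \<lbrakk>c0 < c; c < t\<rbrakk> \<Longrightarrow> H c - H 0 < k 0 * g 0 - \<eta>"
      unfolding eventually_at_left_field by blast
    define c1 where "c1 = (max 0 c0 + t) / 2"
    have c1: "0 < c1" "c0 < c1" "c1 < t" using c0(1) t by (auto simp: c1_def)
    have big: "\<Phi> c + \<eta> < k c * g c" if "c1 \<le> c" "c < t" for c
      using c0(2)[of c] HH[of c] c1 that by auto
    have "(g \<longlongrightarrow> g t) (at t within {0..t})"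
      using contg t by (auto simp: continuous_on_def)
    then have "(g \<longlongrightarrow> 0) (at_left t)"
      using t by (simp add: at_within_Icc_at_left g_def)
    then have "((\<lambda>s. k c1 * g s) \<longlongrightarrow> k c1 * 0) (at_left t)" by (intro tendsto_intros)
    then have "\<forall>\<^sub>F s in at_left t. k c1 * g s < \<eta>" using \<eta>(1) by (intro order_tendstoD) auto
    then obtain c2 where c2: "c2 < t" "\<And>c. \<lbrakk>c2 < c; c < t\<rbrakk> \<Longrightarrow> k c1 * g c < \<eta>"
      unfolding eventually_at_left_field by blast
    define c' where "c' = (max c1 c2 + t) / 2"
    have c': "c1 < c'" "c2 < c'" "c' < t" using c1 c2(1) by (auto simp: c'_def)
    \<comment> \<open>minimising \<open>g\<close> up to a point \<open>c'\<close> near \<open>t\<close> makes \<open>k c1 * g c\<close> smaller than the gap \<open>\<eta>\<close>\<close>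
    have "\<exists>c\<in>{c1..c'}. \<forall>s\<in>{c1..c'}. g c \<le> g s"
      by (rule continuous_attains_inf) (use c1 c' in \<open>auto intro: continuous_on_subset[OF contg]\<close>)
    then obtain c where c: "c1 \<le> c" "c \<le> c'" "\<And>s. s \<in> {c1..c'} \<Longrightarrow> g c \<le> g s" by auto
    have "g c * (k c - k c1) = integral {c1..c} (\<lambda>s. k' s * g c)"
      using FTC[of c1 c] c1 c c' by (intro integral_unique[symmetric]) (auto simp: mult.commute[of _ "g c"] intro: has_integral_mult_right)
    also have "\<dots> \<le> integral {c1..c} (\<lambda>s. k' s * g s)"
    proof (rule integral_le)
      show "(\<lambda>s. k' s * g c) integrable_on {c1..c}"
        using FTC[of c1 c] c1 c c' by (intro integrable_on_mult_left) auto
      show "(\<lambda>s. k' s * g s) integrable_on {c1..c}"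
        by (intro integrable_continuous_real cont) (use c1 c c' in auto)
      show "k' s * g c \<le> k' s * g s" if "s \<in> {c1..c}" for s
        using that c k'0 by (intro mult_left_mono) auto
    qed
    also have "\<dots> \<le> integral {0..c} (\<lambda>s. k' s * g s)"
    proof (rule integral_subset_le)
      show "{c1..c} \<subseteq> {0..c}" using c1 by auto
      show "(\<lambda>s. k' s * g s) integrable_on {c1..c}" "(\<lambda>s. k' s * g s) integrable_on {0..c}"
        by (intro integrable_continuous_real cont; use c1 c c' in auto)+
      show "\<forall>s\<in>{0..c}. 0 \<le> k' s * g s" using k'0 g0 c c' by auto
    qed
    finally have "k c * g c \<le> \<Phi> c + k c1 * g c" by (simp add: \<Phi>_def algebra_simps)
    also have "k c1 * g c \<le> k c1 * g c'" using c c' k0 by (intro mult_left_mono) auto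
    also have "\<dots> < \<eta>" using c2(2)[of c'] c' by auto
    finally show False using big[of c] c c' by auto
  qed
  then have "k 0 * g 0 / Gamma (1 - \<rho>) \<le> I / Gamma (1 - \<rho>)"
    using \<rho> by (intro divide_right_mono) (auto intro: Gamma_real_nonneg)
  then show ?thesis by (simp add: I(2) k_def g_def)
qed

text \<open>At a negative minimum over \<open>[0, t]\<close> every Caputo derivative is negative by
  \<open>caputo_at_maximum\<close>, because \<open>y 0 \<ge> 0\<close>. The derivative at \<open>r\<close> sees only \<open>[0, r]\<close>, so it does not matter
  whether the minimum sits at the right end of the interval. The lemma gives both uniqueness and the
  positivity of the fundamental solution.\<close>

lemma caputo_comparison:
  fixes y :: "real \<Rightarrow> real"
  assumes y: "continuous_on {0..T} y" and y0: "y 0 \<ge> 0" and lam: "lam \<ge> 0" and M: "M \<ge> (1::nat)"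
    and \<rho>: "\<And>j. j \<in> {1..M} \<Longrightarrow> 0 < \<rho> j \<and> \<rho> j < 1" and q: "\<And>j. j \<in> {1..M} \<Longrightarrow> q j > 0"
    and eq: "\<And>t. \<lbrakk>0 < t; t < T\<rbrakk> \<Longrightarrow> \<exists>d. (\<forall>j\<in>{1..M}. has_caputo_derivative (\<rho> j) y (d j) t) \<and>
        0 \<le> (\<Sum>j=1..M. q j * d j) + lam * y t"
    and t: "0 \<le> t" "t < T"
  shows "0 \<le> y t"
proof (rule ccontr)
  assume neg: "\<not> 0 \<le> y t"
  have "\<exists>r\<in>{0..t}. \<forall>s\<in>{0..t}. y r \<le> y s"
    by (rule continuous_attains_inf) (use t in \<open>auto intro: continuous_on_subset[OF y]\<close>)
  then obtain r where r: "r \<in> {0..t}" "\<And>s. s \<in> {0..t} \<Longrightarrow> y r \<le> y s" by auto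
  have yr: "y r < 0" using r(2)[of t] t neg by auto
  with y0 have r0: "r \<noteq> 0" by auto
  then have rT: "0 < r" "r < T" using r(1) t by auto
  from eq[OF rT] obtain d where d: "\<forall>j\<in>{1..M}. has_caputo_derivative (\<rho> j) y (d j) r"
    "0 \<le> (\<Sum>j=1..M. q j * d j) + lam * y r" by blast
  have dneg: "d j < 0" if j: "j \<in> {1..M}" for j
  proof -
    have "has_caputo_derivative (\<rho> j) (\<lambda>s. - y s) (- d j) r"
      by (rule has_caputo_derivative_linear[OF bounded_linear_minus[OF bounded_linear_ident] d(1)[rule_format, OF j]])
    then have "r powr (- \<rho> j) * ((- y r) - (- y 0)) / Gamma (1 - \<rho> j) \<le> - d j"
      by (rule caputo_at_maximum[rotated 4])
        (use rT \<rho>[OF j] r t in \<open>auto intro!: continuous_intros intro: continuous_on_subset[OF y]\<close>)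
    moreover have "r powr (- \<rho> j) * ((- y r) - (- y 0)) / Gamma (1 - \<rho> j) > 0"
      using rT yr y0 \<rho>[OF j] by (intro divide_pos_pos mult_pos_pos Gamma_real_pos) auto
    ultimately show ?thesis by linarith
  qed
  have "(\<Sum>j=1..M. q j * d j) < 0"
  proof -
    have "(\<Sum>j=1..M. q j * d j) < (\<Sum>j=1..M. 0)"
      using M by (intro sum_strict_mono) (auto intro!: mult_pos_neg q dneg)
    then show ?thesis by simp
  qed
  moreover have "lam * y r \<le> 0" using lam yr by (simp add: mult_nonneg_nonpos)
  ultimately show False using d(2) by linarith
qed

section \<open>Weakly singular functions and their convolution\<close>

text \<open>The open interval keeps out the singularities of the two factors.\<close>

definition conv :: "(real \<Rightarrow> real) \<Rightarrow> (real \<Rightarrow> 'a::{banach, second_countable_topology}) \<Rightarrow> real \<Rightarrow> 'a"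
  where "conv K w t = (LBINT s:{0<..<t}. K (t - s) *\<^sub>R w s)"

text \<open>The exponent \<open>a - 1\<close> is normalised so that the orders of convolution factors add up, as they do for
  the fractional kernels \<open>t powr (a - 1) / Gamma a\<close>; order \<open>1\<close> means bounded.\<close>

definition wsing :: "real \<Rightarrow> real \<Rightarrow> (real \<Rightarrow> 'a::real_normed_vector) \<Rightarrow> bool" where
  "wsing T a w \<longleftrightarrow> continuous_on {0<..T} w \<and>
     (\<exists>C. \<forall>t\<in>{0<..T}. norm (w t) \<le> C * t powr (a - 1))"

text \<open>The class on which convolution is an associative and commutative product.\<close>

definition weakly_singular :: "real \<Rightarrow> (real \<Rightarrow> 'a::real_normed_vector) \<Rightarrow> bool" where
  "weakly_singular T w \<longleftrightarrow> (\<exists>a>0. wsing T a w)"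

lemma wsingI:
  assumes "continuous_on {0<..T} w" "\<And>t. \<lbrakk>0 < t; t \<le> T\<rbrakk> \<Longrightarrow> norm (w t) \<le> C * t powr (a - 1)"
  shows "wsing T a w"
  unfolding wsing_def using assms by (intro conjI exI[of _ C]) auto

lemma wsingE:
  assumes "wsing T a w"
  obtains C where "C \<ge> 0" "\<And>t. \<lbrakk>0 < t; t \<le> T\<rbrakk> \<Longrightarrow> norm (w t) \<le> C * t powr (a - 1)"
proof -
  obtain C where "\<forall>t\<in>{0<..T}. norm (w t) \<le> C * t powr (a - 1)"
    using assms unfolding wsing_def by blast
  then have C: "\<And>t. \<lbrakk>0 < t; t \<le> T\<rbrakk> \<Longrightarrow> norm (w t) \<le> C * t powr (a - 1)" by simp
  have "norm (w t) \<le> \<bar>C\<bar> * t powr (a - 1)" if "0 < t" "t \<le> T" for t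
    using C[OF that] abs_ge_self[of C] by (meson mult_right_mono order_trans powr_ge_zero)
  then show ?thesis using that[of "\<bar>C\<bar>"] by auto
qed

lemma wsing_continuous: "wsing T a w \<Longrightarrow> continuous_on {0<..T} w"
  unfolding wsing_def by auto

lemma powr_le_of_exponent_le:
  fixes t :: real
  assumes "0 < t" "t \<le> T" "b \<le> a"
  shows "t powr (a - 1) \<le> T powr (a - b) * t powr (b - 1)"
proof -
  have "t powr (a - 1) = t powr (a - b) * t powr (b - 1)"
    by (simp add: powr_add[symmetric])
  also have "\<dots> \<le> T powr (a - b) * t powr (b - 1)"
    using assms by (intro mult_right_mono powr_mono2) auto
  finally show ?thesis .
qed

lemma wsing_mono:
  assumes "wsing T a w" "b \<le> a"
  shows "wsing T b w"
proof -
  obtain C where C: "C \<ge> 0" "\<And>t. \<lbrakk>0 < t; t \<le> T\<rbrakk> \<Longrightarrow> norm (w t) \<le> C * t powr (a - 1)"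
    using wsingE[OF assms(1)] by metis
  show ?thesis
  proof (rule wsingI[where C = "C * T powr (a - b)"])
    fix t assume t: "0 < t" "t \<le> T"
    show "norm (w t) \<le> C * T powr (a - b) * t powr (b - 1)"
      using C(2)[OF t] mult_left_mono[OF powr_le_of_exponent_le[OF t assms(2)] C(1)]
      by (simp add: mult.assoc)
  qed (use wsing_continuous assms in auto)
qed

lemma wsing_add:
  assumes "wsing T a w" "wsing T a z"
  shows "wsing T a (\<lambda>t. w t + z t)"
proof -
  obtain C C' where C: "\<And>t. \<lbrakk>0 < t; t \<le> T\<rbrakk> \<Longrightarrow> norm (w t) \<le> C * t powr (a - 1)"
     "\<And>t. \<lbrakk>0 < t; t \<le> T\<rbrakk> \<Longrightarrow> norm (z t) \<le> C' * t powr (a - 1)"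
    using wsingE[OF assms(1)] wsingE[OF assms(2)] by metis
  show ?thesis
  proof (rule wsingI[where C = "C + C'"])
    show "norm (w t + z t) \<le> (C + C') * t powr (a - 1)" if "0 < t" "t \<le> T" for t
      using C[OF that] norm_triangle_ineq[of "w t" "z t"] by (simp add: distrib_right)
  qed (intro continuous_intros wsing_continuous[OF assms(1)] wsing_continuous[OF assms(2)])
qed

lemma wsing_scaleR:
  assumes "wsing T a w"
  shows "wsing T a (\<lambda>t. c *\<^sub>R w t)"
proof -
  obtain C where C: "\<And>t. \<lbrakk>0 < t; t \<le> T\<rbrakk> \<Longrightarrow> norm (w t) \<le> C * t powr (a - 1)"
    using wsingE[OF assms(1)] by metis
  show ?thesis
  proof (rule wsingI[where C = "\<bar>c\<bar> * C"])
    show "norm (c *\<^sub>R w t) \<le> \<bar>c\<bar> * C * t powr (a - 1)" if "0 < t" "t \<le> T" for t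
      using C[OF that] by (simp add: mult.assoc mult_left_mono)
  qed (intro continuous_intros wsing_continuous[OF assms])
qed

lemma weakly_singular_add:
  assumes "weakly_singular T w" "weakly_singular T z"
  shows "weakly_singular T (\<lambda>t. w t + z t)"
proof -
  obtain a b where "a > 0" "wsing T a w" "b > 0" "wsing T b z"
    using assms unfolding weakly_singular_def by auto
  then have "wsing T (min a b) w" "wsing T (min a b) z" "min a b > 0"
    by (auto intro: wsing_mono[of T a w "min a b"] wsing_mono[of T b z "min a b"])
  then show ?thesis unfolding weakly_singular_def using wsing_add by blast
qed

lemma weakly_singular_scaleR:
  "weakly_singular T w \<Longrightarrow> weakly_singular T (\<lambda>t. c *\<^sub>R w t)"
  unfolding weakly_singular_def using wsing_scaleR by blast

lemma weakly_singular_diff: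
  assumes "weakly_singular T w" "weakly_singular T z"
  shows "weakly_singular T (\<lambda>t. w t - z t)"
  using weakly_singular_add[OF assms(1) weakly_singular_scaleR[OF assms(2), of "-1"]] by simp

lemma wsing_of_bounded:
  assumes "continuous_on {0<..T} w" "\<And>t. \<lbrakk>0 < t; t \<le> T\<rbrakk> \<Longrightarrow> norm (w t) \<le> C"
  shows "wsing T 1 w"
  by (rule wsingI[where C = C]) (use assms in auto)

lemma wsing_of_continuous:
  assumes "continuous_on {0..T} w"
  shows "wsing T 1 w"
proof -
  have "compact (w ` {0..T})" using assms by (intro compact_continuous_image) auto
  then have "bounded (w ` {0..T})" by (rule compact_imp_bounded)
  then obtain C where "\<And>x. x \<in> w ` {0..T} \<Longrightarrow> norm x \<le> C"
    unfolding bounded_iff by auto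
  then show ?thesis
    by (intro wsing_of_bounded[where C = C] continuous_on_subset[OF assms]) auto
qed

lemma weakly_singular_of_continuous: "continuous_on {0..T} w \<Longrightarrow> weakly_singular T w"
  unfolding weakly_singular_def by (intro exI[of _ 1] conjI wsing_of_continuous) auto

lemma weakly_singular_sum:
  assumes "\<And>j. j \<in> J \<Longrightarrow> weakly_singular T (w j)"
  shows "weakly_singular T (\<lambda>t. \<Sum>j\<in>J. w j t)"
proof -
  have "weakly_singular T (\<lambda>t. 0::'b)"
    by (intro weakly_singular_of_continuous continuous_on_const)
  with assms show ?thesis
    by (induction J rule: infinite_finite_induct) (auto intro: weakly_singular_add)
qed

text \<open>After rescaling to the unit interval the domain of integration is independent of \<open>t\<close>. Bounds become Beta
  integrals, and continuity in \<open>t\<close> is a matter of dominated convergence.\<close>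

lemma conv_scale:
  assumes "0 < t"
  shows "conv K w t = t *\<^sub>R (LBINT x:{0<..<1}. K (t * (1 - x)) *\<^sub>R w (t * x))"
    and "set_integrable lborel {0<..<t} (\<lambda>s. K (t - s) *\<^sub>R w s) \<longleftrightarrow>
         set_integrable lborel {0<..<1} (\<lambda>x. K (t * (1 - x)) *\<^sub>R w (t * x))"
proof -
  let ?f = "\<lambda>s. indicator {0<..<t} s *\<^sub>R (K (t - s) *\<^sub>R w s)"
  have eq: "?f (0 + t * x) = indicator {0<..<1} x *\<^sub>R (K (t * (1 - x)) *\<^sub>R w (t * x))" for x
  proof -
    have "0 < t * x \<and> t * x < t \<longleftrightarrow> 0 < x \<and> x < 1" using assms by (simp add: zero_less_mult_iff)
    then show ?thesis by (simp add: indicator_def right_diff_distrib)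
  qed
  show "conv K w t = t *\<^sub>R (LBINT x:{0<..<1}. K (t * (1 - x)) *\<^sub>R w (t * x))"
    using lborel_integral_real_affine[of t ?f 0] assms
    unfolding eq conv_def set_lebesgue_integral_def by simp
  show "set_integrable lborel {0<..<t} (\<lambda>s. K (t - s) *\<^sub>R w s) \<longleftrightarrow>
         set_integrable lborel {0<..<1} (\<lambda>x. K (t * (1 - x)) *\<^sub>R w (t * x))"
    using lborel_integrable_real_affine_iff[of t ?f 0] assms
    unfolding eq set_integrable_def by simp
qed

lemma beta_integral:
  fixes a b :: real
  assumes "a > 0" "b > 0"
  shows "set_integrable lborel {0<..<1} (\<lambda>x. (1 - x) powr (a - 1) * x powr (b - 1))"
    and "(LBINT x:{0<..<1}. (1 - x) powr (a - 1) * x powr (b - 1)) = Beta a b"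
proof -
  show 1: "set_integrable lborel {0<..<1} (\<lambda>x. (1 - x) powr (a - 1) * x powr (b - 1))"
    by (rule set_integrable_subset[where A = "{0..1}"])
      (use integrable_Beta[OF assms(2,1)] in \<open>auto simp: mult.commute\<close>)
  have "((\<lambda>x. (1 - x) powr (a - 1) * x powr (b - 1)) has_integral Beta a b) {0<..<1}"
    using has_integral_Beta_real[OF assms(2,1)]
    by (simp add: has_integral_Icc_iff_Ioo mult.commute Beta_commute)
  then show "(LBINT x:{0<..<1}. (1 - x) powr (a - 1) * x powr (b - 1)) = Beta a b"
    using set_borel_integral_eq_integral(2)[OF 1] integral_unique by metis
qed

lemma scaled_argument_bounds:
  fixes t x T :: real
  assumes "0 < t" "t \<le> T" "0 < x" "x < 1"
  shows "0 < t * (1 - x)" "t * (1 - x) \<le> T" "0 < t * x" "t * x \<le> T"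
proof -
  show "0 < t * (1 - x)" "0 < t * x" using assms by auto
  have "t * (1 - x) \<le> t * 1" "t * x \<le> t * 1" using assms by (auto intro!: mult_left_mono)
  then show "t * (1 - x) \<le> T" "t * x \<le> T" using assms by linarith+
qed

lemma conv_integrand_bound:
  assumes K: "\<And>t. \<lbrakk>0 < t; t \<le> T\<rbrakk> \<Longrightarrow> \<bar>K t\<bar> \<le> C * t powr (a - 1)"
    and w: "\<And>t. \<lbrakk>0 < t; t \<le> T\<rbrakk> \<Longrightarrow> norm (w t) \<le> C' * t powr (b - 1)"
    and t: "0 < t" "t \<le> T" and x: "0 < x" "x < (1::real)"
  shows "norm (K (t * (1 - x)) *\<^sub>R w (t * x)) \<le>
    (C * C' * t powr (a + b - 2)) * ((1 - x) powr (a - 1) * x powr (b - 1))"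
proof -
  note tx = scaled_argument_bounds[OF t x]
  have "norm (K (t * (1 - x)) *\<^sub>R w (t * x)) = \<bar>K (t * (1 - x))\<bar> * norm (w (t * x))" by simp
  also have "\<dots> \<le> (C * (t * (1 - x)) powr (a - 1)) * (C' * (t * x) powr (b - 1))"
    using K[OF tx(1,2)] w[OF tx(3,4)]
    by (intro mult_mono) (auto intro: order_trans[OF abs_ge_zero])
  also have "\<dots> = (C * C' * (t powr (a - 1) * t powr (b - 1))) * ((1 - x) powr (a - 1) * x powr (b - 1))"
    using t x by (simp add: powr_mult mult_ac)
  also have "t powr (a - 1) * t powr (b - 1) = t powr (a + b - 2)"
    by (simp add: powr_add[symmetric])
  finally show ?thesis .
qed

lemma conv_scaled_integrable:
  fixes w :: "real \<Rightarrow> 'a::{banach, second_countable_topology}"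
  assumes K: "weakly_singular T K" and w: "weakly_singular T w" and t: "0 < t" "t \<le> T"
  shows "set_integrable lborel {0<..<1} (\<lambda>x. K (t * (1 - x)) *\<^sub>R w (t * x))"
proof -
  obtain a b where a: "a > 0" "wsing T a K" and b: "b > 0" "wsing T b w"
    using assms unfolding weakly_singular_def by auto
  obtain C C' where C: "\<And>t. \<lbrakk>0 < t; t \<le> T\<rbrakk> \<Longrightarrow> norm (K t) \<le> C * t powr (a - 1)"
     "\<And>t. \<lbrakk>0 < t; t \<le> T\<rbrakk> \<Longrightarrow> norm (w t) \<le> C' * t powr (b - 1)"
    using wsingE[OF a(2)] wsingE[OF b(2)] by metis
  note tx = scaled_argument_bounds[OF t]
  have "continuous_on {0<..<1} (\<lambda>x. K (t * (1 - x)) *\<^sub>R w (t * x))"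
    by (intro continuous_intros continuous_on_compose2[OF wsing_continuous[OF a(2)]]
        continuous_on_compose2[OF wsing_continuous[OF b(2)]]) (use tx in auto)
  then have meas: "set_borel_measurable lborel {0<..<1} (\<lambda>x. K (t * (1 - x)) *\<^sub>R w (t * x))"
    unfolding set_borel_measurable_def
    using borel_measurable_continuous_on_indicator[of "{0<..<1::real}"] by (simp del: scaleR_scaleR)
  show ?thesis
  proof (rule set_integrable_bound[OF _ meas])
    show "set_integrable lborel {0<..<1} (\<lambda>x. (C * C' * t powr (a + b - 2)) * ((1 - x) powr (a - 1) * x powr (b - 1)))"
      using beta_integral(1)[OF a(1) b(1)] by simp
    show "AE x in lborel. x \<in> {0<..<1} \<longrightarrow> norm (K (t * (1 - x)) *\<^sub>R w (t * x)) \<le>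
       norm ((C * C' * t powr (a + b - 2)) * ((1 - x) powr (a - 1) * x powr (b - 1)))"
      using conv_integrand_bound[of T K C a w C' b t] C t
      by (intro AE_I2) (auto intro: order_trans[OF _ abs_ge_self])
  qed
qed

lemma conv_integrable:
  fixes w :: "real \<Rightarrow> 'a::{banach, second_countable_topology}"
  assumes "weakly_singular T K" "weakly_singular T w" "0 < t" "t \<le> T"
  shows "set_integrable lborel {0<..<t} (\<lambda>s. K (t - s) *\<^sub>R w s)"
  using conv_scale(2)[OF assms(3)] conv_scaled_integrable[OF assms] by blast

lemma norm_conv_le:
  fixes w :: "real \<Rightarrow> 'a::{banach, second_countable_topology}"
  assumes "a > 0" "b > 0"
    and K: "\<And>t. \<lbrakk>0 < t; t \<le> T\<rbrakk> \<Longrightarrow> \<bar>K t\<bar> \<le> C * t powr (a - 1)"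
    and w: "\<And>t. \<lbrakk>0 < t; t \<le> T\<rbrakk> \<Longrightarrow> norm (w t) \<le> C' * t powr (b - 1)"
    and t: "0 < t" "t \<le> T"
  shows "norm (conv K w t) \<le> C * C' * Beta a b * t powr (a + b - 1)"
proof -
  have "0 \<le> C * t powr (a - 1)" "0 \<le> C' * t powr (b - 1)"
    using K[OF t] w[OF t] order_trans[OF abs_ge_zero] order_trans[OF norm_ge_zero] by blast+
  moreover have "t powr (a - 1) > 0" "t powr (b - 1) > 0" using t by auto
  ultimately have CC: "C \<ge> 0" "C' \<ge> 0" by (simp_all add: zero_le_mult_iff)
  let ?h = "\<lambda>x. (C * C' * t powr (a + b - 2)) * ((1 - x) powr (a - 1) * x powr (b - 1))"
  have "norm (LBINT x:{0<..<1}. K (t * (1 - x)) *\<^sub>R w (t * x)) \<le> (LBINT x:{0<..<1}. ?h x)"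
    unfolding set_lebesgue_integral_def
  proof (rule order_trans[OF integral_norm_bound integral_mono_AE'])
    show "integrable lborel (\<lambda>x. indicator {0<..<1} x *\<^sub>R ?h x)"
      using set_integrable_mult_right[OF beta_integral(1)[OF assms(1,2)], of "C * C' * t powr (a + b - 2)"]
      unfolding set_integrable_def by simp
    show "AE x in lborel. norm (indicator {0<..<1} x *\<^sub>R K (t * (1 - x)) *\<^sub>R w (t * x))
        \<le> indicator {0<..<1} x *\<^sub>R ?h x"
      using conv_integrand_bound[of T K C a w C' b t] K w t
      by (intro AE_I2) (auto simp: indicator_def)
    show "AE x in lborel. 0 \<le> indicator {0<..<1} x *\<^sub>R ?h x"
      using CC by (intro AE_I2) (auto simp: indicator_def)
  qed
  also have "\<dots> = C * C' * t powr (a + b - 2) * Beta a b"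
    using beta_integral(2)[OF assms(1,2)] by simp
  finally have "t * norm (LBINT x:{0<..<1}. K (t * (1 - x)) *\<^sub>R w (t * x)) \<le>
      t * (C * C' * t powr (a + b - 2) * Beta a b)"
    using t by (intro mult_left_mono) auto
  also have "\<dots> = C * C' * Beta a b * (t powr 1 * t powr (a + b - 2))" using t by simp
  also have "t powr 1 * t powr (a + b - 2) = t powr (a + b - 1)"
    unfolding powr_add[symmetric] by simp
  finally show ?thesis using conv_scale(1)[OF t(1), of K w] t by simp
qed


lemma continuous_on_Ioc_of_Icc:
  fixes f :: "real \<Rightarrow> 'a::topological_space"
  assumes "\<And>d. 0 < d \<Longrightarrow> continuous_on {d..T} f"
  shows "continuous_on {0<..T} f"
  unfolding continuous_on_eq_continuous_within
proof
  fix t assume t: "t \<in> {0<..T}"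
  then have "continuous (at t within {t / 2..T}) f"
    using assms[of "t / 2"] by (auto simp: continuous_on_eq_continuous_within)
  moreover have "at t within {t / 2..T} = at t within {0<..T}"
    by (rule at_within_nhd[of _ "{t / 2<..}"]) (use t in auto)
  ultimately show "continuous (at t within {0<..T}) f" by simp
qed

lemma powr_le_endpoint_sum:
  fixes t :: real
  assumes "0 < d" "d \<le> t" "t \<le> T"
  shows "t powr c \<le> d powr c + T powr c"
proof (cases "c \<ge> 0")
  case True
  then have "t powr c \<le> T powr c" using assms by (intro powr_mono2) auto
  then show ?thesis by (simp add: add_increasing)
next
  case False
  then have "t powr c \<le> d powr c" using assms by (intro powr_mono2') auto
  then show ?thesis by (simp add: add_increasing2)
qed

text \<open>On \<open>[d, T]\<close> the rescaled integrands are dominated by a multiple of the Beta integrand.\<close>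

lemma conv_continuous:
  fixes w :: "real \<Rightarrow> 'a::{banach, second_countable_topology}"
  assumes K: "weakly_singular T K" and w: "weakly_singular T w"
  shows "continuous_on {0<..T} (conv K w)"
proof (rule continuous_on_Ioc_of_Icc)
  fix d :: real assume d: "0 < d"
  obtain a b where a: "a > 0" "wsing T a K" and b: "b > 0" "wsing T b w"
    using assms unfolding weakly_singular_def by auto
  obtain C C' where C: "C \<ge> 0" "\<And>t. \<lbrakk>0 < t; t \<le> T\<rbrakk> \<Longrightarrow> norm (K t) \<le> C * t powr (a - 1)"
    "C' \<ge> 0" "\<And>t. \<lbrakk>0 < t; t \<le> T\<rbrakk> \<Longrightarrow> norm (w t) \<le> C' * t powr (b - 1)"
    using wsingE[OF a(2)] wsingE[OF b(2)] by metis
  define P where "P = d powr (a + b - 2) + T powr (a + b - 2)"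
  let ?B = "\<lambda>x::real. (1 - x) powr (a - 1) * x powr (b - 1)"
  let ?f = "\<lambda>t x. indicator {0<..<1} x *\<^sub>R (K (t * (1 - x)) *\<^sub>R w (t * x))"
  have P: "t powr (a + b - 2) \<le> P" if "d \<le> t" "t \<le> T" for t
    unfolding P_def using d that by (rule powr_le_endpoint_sum)
  have "continuous_on {d..T} (\<lambda>t. LBINT x. ?f t x)"
    unfolding continuous_on_sequentially
  proof (intro allI ballI impI, elim conjE)
    fix x t assume t: "t \<in> {d..T}" and x: "\<forall>n. x n \<in> {d..T}" "x \<longlonglongrightarrow> t"
    have "(\<lambda>n. LBINT y. ?f (x n) y) \<longlonglongrightarrow> (LBINT y. ?f t y)"
    proof (rule integral_dominated_convergence[where w = "\<lambda>y. indicator {0<..<1} y *\<^sub>R ((C * C' * P) * ?B y)"])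
      show "integrable lborel (\<lambda>y. indicator {0<..<1} y *\<^sub>R ((C * C' * P) * ?B y))"
        using set_integrable_mult_right[OF beta_integral(1)[OF a(1) b(1)], of "C * C' * P"]
        unfolding set_integrable_def by simp
      show "?f t \<in> borel_measurable lborel"
        using conv_scaled_integrable[OF K w, of t] t d unfolding set_integrable_def by auto
      show "?f (x n) \<in> borel_measurable lborel" for n
        using conv_scaled_integrable[OF K w, of "x n"] x(1)[rule_format, of n] d
        unfolding set_integrable_def by auto
      show "AE y in lborel. norm (?f (x n) y) \<le> indicator {0<..<1} y *\<^sub>R ((C * C' * P) * ?B y)" for n
      proof (intro AE_I2)
        fix y :: real
        show "norm (?f (x n) y) \<le> indicator {0<..<1} y *\<^sub>R ((C * C' * P) * ?B y)"
        proof (cases "0 < y \<and> y < 1")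
          case True
          have xn: "d \<le> x n" "x n \<le> T" using x(1) by auto
          have "norm (?f (x n) y) \<le> (C * C' * x n powr (a + b - 2)) * ?B y"
            using conv_integrand_bound[of T K C a w C' b "x n" y] C xn d True by auto
          also have "\<dots> \<le> (C * C' * P) * ?B y"
            using P[OF xn] C(1,3) by (intro mult_right_mono mult_left_mono) auto
          finally show ?thesis using True by simp
        qed simp
      qed
      show "AE y in lborel. (\<lambda>n. ?f (x n) y) \<longlonglongrightarrow> ?f t y"
      proof (intro AE_I2)
        fix y :: real
        show "(\<lambda>n. ?f (x n) y) \<longlonglongrightarrow> ?f t y"
        proof (cases "0 < y \<and> y < 1")
          case True
          have t': "0 < t" "t \<le> T" using t d by auto
          have x': "0 < x n" "x n \<le> T" for n using x(1)[rule_format, of n] d by auto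
          note b1 = scaled_argument_bounds[OF t', of y] and b2 = scaled_argument_bounds[OF x', of y]
          have "(\<lambda>n. K (x n * (1 - y))) \<longlonglongrightarrow> K (t * (1 - y))"
            by (rule continuous_on_tendsto_compose[OF wsing_continuous[OF a(2)]])
              (use x(2) b1 b2 True in \<open>auto intro!: tendsto_intros\<close>)
          moreover have "(\<lambda>n. w (x n * y)) \<longlonglongrightarrow> w (t * y)"
            by (rule continuous_on_tendsto_compose[OF wsing_continuous[OF b(2)]])
              (use x(2) b1 b2 True in \<open>auto intro!: tendsto_intros\<close>)
          ultimately show ?thesis by (intro tendsto_intros)
        qed simp
      qed
    qed
    then show "((\<lambda>t. LBINT y. ?f t y) \<circ> x) \<longlonglongrightarrow> (LBINT y. ?f t y)" by (simp add: o_def)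
  qed
  then have "continuous_on {d..T} (\<lambda>t. t *\<^sub>R (LBINT x. ?f t x))" by (intro continuous_intros)
  then show "continuous_on {d..T} (conv K w)"
    by (rule continuous_on_eq) (use d in \<open>auto simp: conv_scale(1) set_lebesgue_integral_def\<close>)
qed

lemma wsing_conv:
  fixes w :: "real \<Rightarrow> 'a::{banach, second_countable_topology}"
  assumes "a > 0" "b > 0" "wsing T a K" "wsing T b w"
  shows "wsing T (a + b) (conv K w)"
proof -
  obtain C C' where C: "\<And>t. \<lbrakk>0 < t; t \<le> T\<rbrakk> \<Longrightarrow> norm (K t) \<le> C * t powr (a - 1)"
    "\<And>t. \<lbrakk>0 < t; t \<le> T\<rbrakk> \<Longrightarrow> norm (w t) \<le> C' * t powr (b - 1)"
    using wsingE[OF assms(3)] wsingE[OF assms(4)] by metis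
  show ?thesis
    by (rule wsingI[OF conv_continuous norm_conv_le[OF assms(1,2)]])
      (use assms C in \<open>auto simp: weakly_singular_def\<close>)
qed

lemma weakly_singular_conv:
  fixes w :: "real \<Rightarrow> 'a::{banach, second_countable_topology}"
  assumes "weakly_singular T K" "weakly_singular T w"
  shows "weakly_singular T (conv K w)"
proof -
  obtain a b where "a > 0" "wsing T a K" "b > 0" "wsing T b w"
    using assms unfolding weakly_singular_def by auto
  then show ?thesis unfolding weakly_singular_def
    using wsing_conv by (intro exI[of _ "a + b"]) auto
qed

lemma conv_0 [simp]: "conv K w 0 = 0"
  by (simp add: conv_def set_lebesgue_integral_def)

lemma conv_continuous_0:
  fixes w :: "real \<Rightarrow> 'a::{banach, second_countable_topology}"
  assumes "a > 0" "b > 0" "wsing T a K" "wsing T b w" "a + b > 1"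
  shows "continuous_on {0..T} (conv K w)"
proof -
  have ws: "wsing T (a + b) (conv K w)" by (rule wsing_conv) fact+
  obtain C where C: "\<And>t. \<lbrakk>0 < t; t \<le> T\<rbrakk> \<Longrightarrow> norm (conv K w t) \<le> C * t powr (a + b - 1)"
    using wsingE[OF ws] by metis
  have "continuous (at t within {0..T}) (conv K w)" if t: "t \<in> {0..T}" for t
  proof (cases "t = 0")
    case True
    have "((\<lambda>t. C * t powr (a + b - 1)) \<longlongrightarrow> C * 0) (at_right 0)"
    proof (intro tendsto_mult tendsto_const)
      have "((\<lambda>t::real. t powr (a + b - 1)) \<longlongrightarrow> 0 powr (a + b - 1)) (at_right 0)"
        by (rule tendsto_powr2) (use assms(5) in \<open>auto intro!: tendsto_intros simp: eventually_at_right_less eventually_at_filter\<close>)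
      then show "((\<lambda>t::real. t powr (a + b - 1)) \<longlongrightarrow> 0) (at_right 0)" by simp
    qed
    then have "((\<lambda>t. C * t powr (a + b - 1)) \<longlongrightarrow> 0) (at 0 within {0<..T})"
      by (intro tendsto_within_subset[of _ _ 0 "{0<..}" "{0<..T}"]) auto
    moreover have "at 0 within {0<..T} = at 0 within {0..T}"
      by (auto simp: at_within_eq intro!: arg_cong[where f = "Inf"])
    ultimately have lim: "((\<lambda>t. C * t powr (a + b - 1)) \<longlongrightarrow> 0) (at 0 within {0..T})" by simp
    have "(conv K w \<longlongrightarrow> 0) (at 0 within {0..T})"
      by (rule Lim_null_comparison[OF _ lim]) (use C in \<open>auto simp: eventually_at_filter\<close>)
    then show ?thesis using True by (simp add: continuous_within)
  next
    case False
    then have "continuous (at t within {0<..T}) (conv K w)"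
      using wsing_continuous[OF ws] t by (auto simp: continuous_on_eq_continuous_within)
    moreover have "at t within {0<..T} = at t within {0..T}"
      by (rule at_within_nhd[of _ "{0<..}"]) (use t False in auto)
    ultimately show ?thesis by simp
  qed
  then show ?thesis by (simp add: continuous_on_eq_continuous_within)
qed


lemma conv_cong:
  assumes "\<And>s. \<lbrakk>0 < s; s < t\<rbrakk> \<Longrightarrow> K s = K' s" "\<And>s. \<lbrakk>0 < s; s < t\<rbrakk> \<Longrightarrow> w s = w' s"
  shows "conv K w t = conv K' w' t"
  unfolding conv_def by (rule set_lebesgue_integral_cong) (use assms in auto)

lemma conv_commute:
  fixes K w :: "real \<Rightarrow> real"
  shows "conv K w t = conv w K t"
proof -
  let ?f = "\<lambda>s. indicator {0<..<t} s *\<^sub>R (K (t - s) *\<^sub>R w s)"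
  have eq: "?f (t + (-1) * x) = indicator {0<..<t} x *\<^sub>R (w (t - x) *\<^sub>R K x)" for x
    by (auto simp: indicator_def)
  show ?thesis
    using lborel_integral_real_affine[of "-1" ?f t]
    unfolding eq conv_def set_lebesgue_integral_def by simp
qed

lemma conv_add_right:
  fixes w :: "real \<Rightarrow> 'a::{banach, second_countable_topology}"
  assumes "weakly_singular T K" "weakly_singular T w" "weakly_singular T z" "0 < t" "t \<le> T"
  shows "conv K (\<lambda>s. w s + z s) t = conv K w t + conv K z t"
  unfolding conv_def scaleR_add_right
  by (intro set_integral_add conv_integrable[of T] assms)

lemma conv_diff_right:
  fixes w :: "real \<Rightarrow> 'a::{banach, second_countable_topology}"
  assumes "weakly_singular T K" "weakly_singular T w" "weakly_singular T z" "0 < t" "t \<le> T"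
  shows "conv K (\<lambda>s. w s - z s) t = conv K w t - conv K z t"
  unfolding conv_def scaleR_diff_right
  by (intro set_integral_diff conv_integrable[of T] assms)

lemma conv_scaleR_right:
  "conv K (\<lambda>s. c *\<^sub>R w s) t = c *\<^sub>R conv K w t"
  unfolding conv_def set_lebesgue_integral_def
  by (subst integral_scaleR_right[symmetric]) (simp add: mult_ac)

lemma conv_add_left:
  fixes w :: "real \<Rightarrow> 'a::{banach, second_countable_topology}"
  assumes "weakly_singular T K" "weakly_singular T K'" "weakly_singular T w" "0 < t" "t \<le> T"
  shows "conv (\<lambda>s. K s + K' s) w t = conv K w t + conv K' w t"
  unfolding conv_def scaleR_add_left
  by (intro set_integral_add conv_integrable[of T] assms)

lemma conv_scaleR_left:
  "conv (\<lambda>s. c * K s) w t = c *\<^sub>R conv K w t"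
  unfolding conv_def set_lebesgue_integral_def
  by (subst integral_scaleR_right[symmetric]) (simp add: mult_ac)

lemma conv_sum_left:
  fixes w :: "real \<Rightarrow> 'a::{banach, second_countable_topology}"
  assumes "\<And>j. j \<in> J \<Longrightarrow> weakly_singular T (K j)" "weakly_singular T w" "0 < t" "t \<le> T"
  shows "conv (\<lambda>s. \<Sum>j\<in>J. K j s) w t = (\<Sum>j\<in>J. conv (K j) w t)"
  using assms(1)
proof (induction J rule: infinite_finite_induct)
  case (insert j J)
  then have "conv (\<lambda>s. K j s + (\<Sum>j\<in>J. K j s)) w t = conv (K j) w t + conv (\<lambda>s. \<Sum>j\<in>J. K j s) w t"
    by (intro conv_add_left[of T] weakly_singular_sum assms(2-4)) auto
  with insert show ?case by simp
qed (simp_all add: conv_def set_lebesgue_integral_def)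

lemma conv_nonneg:
  assumes "\<And>s. \<lbrakk>0 < s; s < t\<rbrakk> \<Longrightarrow> 0 \<le> K s" "\<And>s. \<lbrakk>0 < s; s < t\<rbrakk> \<Longrightarrow> (0::real) \<le> w s"
  shows "0 \<le> conv K w t"
  unfolding conv_def set_lebesgue_integral_def
  by (rule Bochner_Integration.integral_nonneg) (use assms in \<open>auto simp: indicator_def\<close>)

lemma conv_mono:
  fixes K w z :: "real \<Rightarrow> real"
  assumes "weakly_singular T K" "weakly_singular T w" "weakly_singular T z" "0 < t" "t \<le> T"
    and "\<And>s. \<lbrakk>0 < s; s < t\<rbrakk> \<Longrightarrow> 0 \<le> K s" "\<And>s. \<lbrakk>0 < s; s < t\<rbrakk> \<Longrightarrow> w s \<le> z s"
  shows "conv K w t \<le> conv K z t"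
  using conv_diff_right[of T K z w t] conv_nonneg[of t K "\<lambda>s. z s - w s"] assms by simp

lemma weakly_singular_norm:
  assumes "weakly_singular T w"
  shows "weakly_singular T (\<lambda>t. norm (w t))"
proof -
  obtain a where a: "a > 0" "wsing T a w" using assms unfolding weakly_singular_def by auto
  obtain C where C: "\<And>t. \<lbrakk>0 < t; t \<le> T\<rbrakk> \<Longrightarrow> norm (w t) \<le> C * t powr (a - 1)"
    using wsingE[OF a(2)] by metis
  have "wsing T a (\<lambda>t. norm (w t))"
    by (rule wsingI[where C = C]) (use C wsing_continuous[OF a(2)] in \<open>auto intro: continuous_intros\<close>)
  then show ?thesis using a(1) unfolding weakly_singular_def by auto
qed

lemma conv_norm_le:
  fixes w :: "real \<Rightarrow> 'a::{banach, second_countable_topology}"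
  shows "norm (conv K w t) \<le> conv (\<lambda>s. \<bar>K s\<bar>) (\<lambda>s. norm (w s)) t"
  unfolding conv_def set_lebesgue_integral_def
  by (rule order_trans[OF integral_norm_bound]) (simp add: mult_ac abs_mult)

text \<open>Fubini on the triangle \<open>0 < r < s < t\<close>. The integrand is integrable there because absolute values and
  convolutions of weakly singular functions are again weakly singular.\<close>

lemma conv_assoc:
  fixes w :: "real \<Rightarrow> 'a::{banach, second_countable_topology}"
  assumes a: "weakly_singular T a" and b: "weakly_singular T b" and w: "weakly_singular T w"
    and t: "0 < t" "t \<le> T"
  shows "conv a (conv b w) t = conv (conv a b) w t"
proof -
  define S where "S = {p::real \<times> real. 0 < snd p \<and> snd p < fst p \<and> fst p < t}"
  define f where "f = (\<lambda>s r. indicator S (s, r) *\<^sub>R (a (t - s) *\<^sub>R b (s - r) *\<^sub>R w r))"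
  have cont: "continuous_on {0<..T} a" "continuous_on {0<..T} b" "continuous_on {0<..T} w"
    using a b w unfolding weakly_singular_def by (auto intro: wsing_continuous)
  have "open S" unfolding S_def by (intro open_Collect_conj open_Collect_less continuous_intros)
  then have "S \<in> sets borel" by auto
  moreover have "continuous_on S (\<lambda>p. a (t - fst p) *\<^sub>R b (fst p - snd p) *\<^sub>R w (snd p))"
    by (intro continuous_intros continuous_on_compose2[OF cont(1)]
        continuous_on_compose2[OF cont(2)] continuous_on_compose2[OF cont(3)])
      (use t in \<open>auto simp: S_def\<close>)
  ultimately have "(\<lambda>p. indicator S p *\<^sub>R (a (t - fst p) *\<^sub>R b (fst p - snd p) *\<^sub>R w (snd p)))
      \<in> borel_measurable borel"
    by (rule borel_measurable_continuous_on_indicator)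
  then have meas: "case_prod f \<in> borel_measurable (lborel \<Otimes>\<^sub>M lborel)"
    unfolding f_def lborel_prod by (simp add: case_prod_beta' del: scaleR_scaleR)
  have f1: "f s r = indicator {0<..<t} s *\<^sub>R a (t - s) *\<^sub>R (indicator {0<..<s} r *\<^sub>R (b (s - r) *\<^sub>R w r))" for s r
    unfolding f_def S_def by (auto simp: indicator_def)
  have int1: "integrable lborel (f s)" for s
  proof (cases "0 < s \<and> s < t")
    case True
    then have "set_integrable lborel {0<..<s} (\<lambda>r. b (s - r) *\<^sub>R w r)"
      using conv_integrable[OF b w, of s] t by auto
    then show ?thesis
      unfolding f1[abs_def] set_integrable_def by (intro integrable_scaleR_right)
  qed (simp add: f1[abs_def])
  have "(\<integral>r. norm (f s r) \<partial>lborel)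
      = indicator {0<..<t} s *\<^sub>R (\<bar>a (t - s)\<bar> *\<^sub>R conv (\<lambda>s. \<bar>b s\<bar>) (\<lambda>s. norm (w s)) s)" for s
  proof -
    have "norm (f s r) = (indicator {0<..<t} s * \<bar>a (t - s)\<bar>) *
        (indicator {0<..<s} r * (\<bar>b (s - r)\<bar> * norm (w r)))" for r
      by (simp add: f1 abs_mult mult_ac)
    then show ?thesis by (simp add: conv_def set_lebesgue_integral_def)
  qed
  moreover have "set_integrable lborel {0<..<t} (\<lambda>s. \<bar>a (t - s)\<bar> *\<^sub>R conv (\<lambda>s. \<bar>b s\<bar>) (\<lambda>s. norm (w s)) s)"
    using conv_integrable[of T "\<lambda>s. \<bar>a s\<bar>" "conv (\<lambda>s. \<bar>b s\<bar>) (\<lambda>s. norm (w s))" t] t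
      weakly_singular_conv weakly_singular_norm[OF a] weakly_singular_norm[OF b] weakly_singular_norm[OF w]
    by auto
  ultimately have "integrable lborel (\<lambda>s. \<integral>r. norm (f s r) \<partial>lborel)"
    unfolding set_integrable_def by simp
  then have int: "integrable (lborel \<Otimes>\<^sub>M lborel) (case_prod f)"
    by (intro lborel_pair.Fubini_integrable meas) (auto simp: int1)
  have "conv a (conv b w) t = (\<integral>s. (\<integral>r. f s r \<partial>lborel) \<partial>lborel)"
    unfolding f1 by (simp add: conv_def set_lebesgue_integral_def del: scaleR_scaleR)
  also have "\<dots> = (\<integral>r. (\<integral>s. f s r \<partial>lborel) \<partial>lborel)"
    using lborel_pair.Fubini_integral[OF int] by simp
  also have "(\<lambda>r. \<integral>s. f s r \<partial>lborel) = (\<lambda>r. indicator {0<..<t} r *\<^sub>R (conv a b (t - r) *\<^sub>R w r))"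
  proof
    fix r
    have "f (r + 1 * x) r = (indicator {0<..<t} r * (indicator {0<..<t - r} x * (a (t - r - x) * b x))) *\<^sub>R w r" for x
      unfolding f_def S_def by (auto simp: indicator_def algebra_simps)
    then have "(\<integral>s. f s r \<partial>lborel) =
        (\<integral>x. (indicator {0<..<t} r * (indicator {0<..<t - r} x * (a (t - r - x) * b x))) *\<^sub>R w r \<partial>lborel)"
      using lborel_integral_real_affine[of 1 "\<lambda>s. f s r" r] by simp
    also have "\<dots> = (indicator {0<..<t} r * conv a b (t - r)) *\<^sub>R w r"
    proof (cases "0 < r \<and> r < t")
      case True
      then have "integrable lborel (\<lambda>x. indicator {0<..<t - r} x * (a (t - r - x) * b x))"
        using conv_integrable[OF a b, of "t - r"] t unfolding set_integrable_def by simp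
      then show ?thesis by (simp add: conv_def set_lebesgue_integral_def)
    qed simp
    finally show "(\<integral>s. f s r \<partial>lborel) = indicator {0<..<t} r *\<^sub>R (conv a b (t - r) *\<^sub>R w r)" by simp
  qed
  finally show ?thesis by (simp add: conv_def set_lebesgue_integral_def)
qed

subsection \<open>Fractional kernels\<close>

definition frac_kernel :: "real \<Rightarrow> real \<Rightarrow> real" where
  "frac_kernel a t = t powr (a - 1) / Gamma a"

lemma frac_kernel_nonneg: "a > 0 \<Longrightarrow> 0 \<le> frac_kernel a t"
  by (simp add: frac_kernel_def Gamma_real_nonneg)

lemma wsing_frac_kernel: "a > 0 \<Longrightarrow> wsing T a (frac_kernel a)"
  by (rule wsingI[where C = "1 / Gamma a"])
    (auto simp: frac_kernel_def[abs_def] Gamma_real_nonneg intro!: continuous_intros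
      dest: Gamma_real_pos)

lemma weakly_singular_frac_kernel: "a > 0 \<Longrightarrow> weakly_singular T (frac_kernel a)"
  unfolding weakly_singular_def using wsing_frac_kernel by auto

text \<open>The semigroup law of fractional integration, that is, the Beta integral.\<close>

lemma frac_kernel_conv:
  assumes "a > 0" "b > 0" "t > 0"
  shows "conv (frac_kernel a) (frac_kernel b) t = frac_kernel (a + b) t"
proof -
  have "conv (frac_kernel a) (frac_kernel b) t =
      t * (LBINT x:{0<..<1}. frac_kernel a (t * (1 - x)) * frac_kernel b (t * x))"
    using conv_scale(1)[OF assms(3), of "frac_kernel a" "frac_kernel b"] by simp
  also have "(LBINT x:{0<..<1}. frac_kernel a (t * (1 - x)) * frac_kernel b (t * x)) =
      (LBINT x:{0<..<1}. (t powr (a - 1) * t powr (b - 1) / (Gamma a * Gamma b)) *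
         ((1 - x) powr (a - 1) * x powr (b - 1)))"
    by (rule set_lebesgue_integral_cong)
      (use assms in \<open>auto simp: frac_kernel_def powr_mult simp del: right_diff_distrib\<close>)
  also have "\<dots> = t powr (a - 1) * t powr (b - 1) / (Gamma a * Gamma b) * Beta a b"
    using beta_integral(2)[OF assms(1,2)] by simp
  also have "\<dots> = t powr (a - 1) * t powr (b - 1) / Gamma (a + b)"
    using assms by (simp add: Beta_def Gamma_real_pos less_imp_neq[symmetric])
  also have "t * \<dots> = t powr 1 * t powr (a - 1) * t powr (b - 1) / Gamma (a + b)"
    using assms by simp
  also have "t powr 1 * t powr (a - 1) * t powr (b - 1) = t powr (a + b - 1)"
    unfolding powr_add[symmetric] by (simp add: algebra_simps)
  finally show ?thesis by (simp add: frac_kernel_def[of "a + b"])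
qed

section \<open>Volterra equations of the second kind\<close>

text \<open>Multiplication by an exponential is an automorphism of convolution.\<close>

lemma conv_exp_weight:
  "conv (\<lambda>s. exp (- (\<sigma> * s)) * K s) (\<lambda>s. exp (- (\<sigma> * s)) *\<^sub>R w s) t = exp (- (\<sigma> * t)) *\<^sub>R conv K w t"
proof -
  have "exp (- (\<sigma> * (t - s))) * exp (- (\<sigma> * s)) = exp (- (\<sigma> * t))" for s
    by (simp add: exp_add[symmetric] algebra_simps)
  then have "exp (- (\<sigma> * (t - s))) * K (t - s) * exp (- (\<sigma> * s)) = exp (- (\<sigma> * t)) * K (t - s)" for s
    by (metis mult.assoc mult.commute)
  then have "(exp (- (\<sigma> * (t - s))) * K (t - s)) *\<^sub>R (exp (- (\<sigma> * s)) *\<^sub>R w s) =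
     exp (- (\<sigma> * t)) *\<^sub>R (K (t - s) *\<^sub>R w s)" for s by simp
  then show ?thesis unfolding conv_def
    by (simp only: set_integral_scaleR_right)
qed

lemma powr_exp_le:
  fixes x :: real
  assumes "0 < x" "0 < b" "b \<le> 1"
  shows "x powr b * exp (- x) \<le> 1"
proof -
  have "x powr b \<le> exp x"
  proof (cases "x \<le> 1")
    case True
    have "x powr b \<le> 1 powr b" using assms True by (intro powr_mono2) auto
    then show ?thesis using assms by (simp add: order_trans[of _ 1])
  next
    case False
    have "x powr b \<le> x powr 1" using assms False by (intro powr_mono) auto
    also have "\<dots> \<le> exp x" using exp_ge_add_one_self[of x] assms by (simp del: exp_ge_add_one_self)
    finally show ?thesis .
  qed
  then show ?thesis by (simp add: exp_minus field_simps)
qed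

text \<open>An exponential weight makes any weakly singular kernel small: half of the order of the kernel is
  spent on \<open>s powr (b / 2) * exp (- (\<sigma> * s)) \<le> \<sigma> powr (- (b / 2))\<close>, the other half keeps it integrable. Hence
  the weighted Volterra operator is a contraction for every prescribed singularity at \<open>0\<close>.\<close>

lemma small_weighted_kernel:
  assumes K: "weakly_singular T K" and T: "T > 0" and a: "a > 0"
  shows "\<exists>\<sigma>>0. \<forall>(w :: real \<Rightarrow> 'a::{banach, second_countable_topology}) N.
     (\<forall>t\<in>{0<..T}. norm (w t) \<le> N * t powr (a - 1)) \<longrightarrow>
     (\<forall>t\<in>{0<..T}. norm (conv (\<lambda>s. exp (- (\<sigma> * s)) * K s) w t) \<le> (N / 2) * t powr (a - 1))"
proof -
  obtain b0 where b0: "b0 > 0" "wsing T b0 K" using K unfolding weakly_singular_def by auto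
  define b where "b = min b0 1"
  have b: "b > 0" "b \<le> 1" "wsing T b K" using b0 wsing_mono[of T b0 K b] by (auto simp: b_def)
  obtain C where C: "C \<ge> 0" "\<And>t. \<lbrakk>0 < t; t \<le> T\<rbrakk> \<Longrightarrow> norm (K t) \<le> C * t powr (b - 1)"
    using wsingE[OF b(3)] by metis
  define D where "D = C * Beta (b / 2) a * T powr (b / 2)"
  have "Beta (b / 2) a \<ge> 0" using a b by (simp add: Beta_def Gamma_real_nonneg)
  then have D: "D \<ge> 0" using C(1) by (simp add: D_def)
  \<comment> \<open>chosen such that \<open>\<sigma> powr (- (b / 2)) * D \<le> 1 / 2\<close>\<close>
  define \<sigma> where "\<sigma> = (2 * D + 1) powr (2 / b)"
  have \<sigma>: "\<sigma> > 0" using D by (simp add: \<sigma>_def)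
  have "\<sigma> powr (b / 2) = 2 * D + 1" using D b by (simp add: \<sigma>_def powr_powr)
  then have small: "\<sigma> powr (- (b / 2)) * D \<le> 1 / 2"
    using D by (simp add: powr_minus field_simps)
  have Kb: "\<bar>exp (- (\<sigma> * t)) * K t\<bar> \<le> (C * \<sigma> powr (- (b / 2))) * t powr (b / 2 - 1)"
    if t: "0 < t" "t \<le> T" for t
  proof -
    have "\<bar>exp (- (\<sigma> * t)) * K t\<bar> \<le> exp (- (\<sigma> * t)) * (C * t powr (b - 1))"
      using C(2)[OF t] by (simp add: abs_mult mult_left_mono)
    also have "t powr (b - 1) = t powr (b / 2) * t powr (b / 2 - 1)"
      by (simp add: powr_add[symmetric])
    also have "t powr (b / 2) = \<sigma> powr (- (b / 2)) * (\<sigma> * t) powr (b / 2)"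
      using \<sigma> t by (simp add: powr_mult powr_minus)
    also have "exp (- (\<sigma> * t)) * (C * (\<sigma> powr (- (b / 2)) * (\<sigma> * t) powr (b / 2) * t powr (b / 2 - 1))) =
       (C * \<sigma> powr (- (b / 2)) * t powr (b / 2 - 1)) * ((\<sigma> * t) powr (b / 2) * exp (- (\<sigma> * t)))"
      by (simp add: mult_ac)
    also have "\<dots> \<le> (C * \<sigma> powr (- (b / 2)) * t powr (b / 2 - 1)) * 1"
      using C(1) \<sigma> t b by (intro mult_left_mono powr_exp_le) auto
    finally show ?thesis by simp
  qed
  show ?thesis
  proof (intro exI[of _ \<sigma>] conjI \<sigma> allI impI ballI)
    fix w :: "real \<Rightarrow> 'a" and N t
    assume w': "\<forall>t\<in>{0<..T}. norm (w t) \<le> N * t powr (a - 1)" and t': "t \<in> {0<..T}"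
    have w: "\<And>t. \<lbrakk>0 < t; t \<le> T\<rbrakk> \<Longrightarrow> norm (w t) \<le> N * t powr (a - 1)" and t: "0 < t" "t \<le> T"
      using w' t' by auto
    have "0 \<le> N * t powr (a - 1)" using w[OF t] norm_ge_zero order_trans by blast
    then have N: "N \<ge> 0" using t by (simp add: zero_le_mult_iff)
    have "norm (conv (\<lambda>s. exp (- (\<sigma> * s)) * K s) w t) \<le>
       (C * \<sigma> powr (- (b / 2))) * N * Beta (b / 2) a * t powr (b / 2 + a - 1)"
      by (rule norm_conv_le[OF _ a Kb w t]) (use b in auto)
    also have "t powr (b / 2 + a - 1) = t powr (b / 2) * t powr (a - 1)"
      by (simp add: powr_add[symmetric] add_diff_eq)
    also have "(C * \<sigma> powr (- (b / 2))) * N * Beta (b / 2) a * (t powr (b / 2) * t powr (a - 1)) \<le>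
        (C * \<sigma> powr (- (b / 2))) * N * Beta (b / 2) a * (T powr (b / 2) * t powr (a - 1))"
      using t b C(1) N \<open>Beta (b / 2) a \<ge> 0\<close>
      by (intro mult_left_mono mult_right_mono powr_mono2 mult_nonneg_nonneg) auto
    also have "\<dots> = (\<sigma> powr (- (b / 2)) * D) * (N * t powr (a - 1))" by (simp add: D_def mult_ac)
    also have "\<dots> \<le> 1 / 2 * (N * t powr (a - 1))" using small N by (intro mult_right_mono) auto
    finally show "norm (conv (\<lambda>s. exp (- (\<sigma> * s)) * K s) w t) \<le> N / 2 * t powr (a - 1)" by simp
  qed
qed

lemma wsing_exp_weight:
  fixes w :: "real \<Rightarrow> 'a::real_normed_vector"
  assumes "wsing T a w"
  shows "wsing T a (\<lambda>s. exp (\<sigma> * s) *\<^sub>R w s)"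
proof -
  obtain C where C: "C \<ge> 0" "\<And>t. \<lbrakk>0 < t; t \<le> T\<rbrakk> \<Longrightarrow> norm (w t) \<le> C * t powr (a - 1)"
    using wsingE[OF assms] by metis
  show ?thesis
  proof (rule wsingI[where C = "exp (\<bar>\<sigma>\<bar> * T) * C"])
    show "continuous_on {0<..T} (\<lambda>s. exp (\<sigma> * s) *\<^sub>R w s)"
      by (intro continuous_intros wsing_continuous[OF assms])
    fix t assume t: "0 < t" "t \<le> T"
    have "\<sigma> * t \<le> \<bar>\<sigma>\<bar> * t" using t by (intro mult_right_mono) auto
    also have "\<dots> \<le> \<bar>\<sigma>\<bar> * T" using t by (intro mult_left_mono) auto
    finally have "exp (\<sigma> * t) \<le> exp (\<bar>\<sigma>\<bar> * T)" by simp
    then have "exp (\<sigma> * t) * norm (w t) \<le> exp (\<bar>\<sigma>\<bar> * T) * (C * t powr (a - 1))"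
      using C(2)[OF t] by (intro mult_mono) auto
    then show "norm (exp (\<sigma> * t) *\<^sub>R w t) \<le> exp (\<bar>\<sigma>\<bar> * T) * C * t powr (a - 1)"
      by (simp add: mult.assoc)
  qed
qed

lemma weakly_singular_exp_kernel:
  fixes K :: "real \<Rightarrow> real"
  assumes "weakly_singular T K"
  shows "weakly_singular T (\<lambda>s. exp (- (\<sigma> * s)) * K s)"
  using assms wsing_exp_weight[of T _ K "- \<sigma>"] unfolding weakly_singular_def by auto

text \<open>Weighted by the exponential, a solution is up to sign a fixed point of a map that halves the norm.\<close>

lemma volterra_unique:
  fixes w :: "real \<Rightarrow> 'a::{banach, second_countable_topology}"
  assumes K: "weakly_singular T K" and w: "weakly_singular T w"
    and eq: "\<And>t. \<lbrakk>0 < t; t \<le> T\<rbrakk> \<Longrightarrow> w t + conv K w t = 0" and t: "0 < t" "t \<le> T"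
  shows "w t = 0"
proof -
  obtain a where a: "a > 0" "wsing T a w" using w unfolding weakly_singular_def by auto
  have T: "T > 0" using t by linarith
  obtain \<sigma> where "\<sigma> > 0" and \<sigma>0: "\<forall>(w :: real \<Rightarrow> 'a) N.
     (\<forall>t\<in>{0<..T}. norm (w t) \<le> N * t powr (a - 1)) \<longrightarrow>
     (\<forall>t\<in>{0<..T}. norm (conv (\<lambda>s. exp (- (\<sigma> * s)) * K s) w t) \<le> (N / 2) * t powr (a - 1))"
    using small_weighted_kernel[OF K T a(1), where 'a = 'a] by (elim exE conjE) (rule that)
  have \<sigma>: "norm (conv (\<lambda>s. exp (- (\<sigma> * s)) * K s) w t) \<le> (N / 2) * t powr (a - 1)"
    if "\<And>t. \<lbrakk>0 < t; t \<le> T\<rbrakk> \<Longrightarrow> norm (w t) \<le> N * t powr (a - 1)" "0 < t" "t \<le> T"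
    for w :: "real \<Rightarrow> 'a" and N t
    using \<sigma>0[THEN spec, THEN spec, THEN mp, of w N] that by auto
  define z where "z s = exp (- (\<sigma> * s)) *\<^sub>R w s" for s
  have "wsing T a z"
    using wsing_exp_weight[OF a(2), of "- \<sigma>"] by (simp add: z_def[abs_def])
  then obtain N where N: "N \<ge> 0" "\<And>t. \<lbrakk>0 < t; t \<le> T\<rbrakk> \<Longrightarrow> norm (z t) \<le> N * t powr (a - 1)"
    using wsingE by metis
  have fixp: "z t = - conv (\<lambda>s. exp (- (\<sigma> * s)) * K s) z t" if "0 < t" "t \<le> T" for t
    using eq[OF that] conv_exp_weight[of \<sigma> K w t] unfolding z_def
    by (metis add_eq_0_iff minus_minus scaleR_minus_right)
  have it: "norm (z t) \<le> (N / 2 ^ n) * t powr (a - 1)" if "0 < t" "t \<le> T" for t n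
    using that
  proof (induction n arbitrary: t)
    case (Suc n)
    then show ?case using \<sigma>[of z "N / 2 ^ n" t] fixp[of t] by (simp add: mult_ac)
  qed (use N in simp)
  have "(\<lambda>n. (N * (1 / 2) ^ n) * t powr (a - 1)) \<longlonglongrightarrow> (N * 0) * t powr (a - 1)"
    by (intro tendsto_intros) auto
  then have "norm (z t) \<le> (N * 0) * t powr (a - 1)"
    by (rule LIMSEQ_le_const) (use it[OF t] in \<open>auto simp: power_divide\<close>)
  then have "z t = 0" by simp
  then show ?thesis by (simp add: z_def)
qed

text \<open>The Neumann series of the weighted equation. It converges uniformly on \<open>[d, T]\<close> for all \<open>d > 0\<close>, and the
  singularity of the right-hand side at \<open>0\<close> is inherited by the solution with the same exponent.\<close>

lemma volterra_exists:
  fixes r :: "real \<Rightarrow> 'a::{banach, second_countable_topology}"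
  assumes K: "weakly_singular T K" and r: "wsing T a r" and a: "a > 0" and T: "T > 0"
  shows "\<exists>w. wsing T a w \<and> (\<forall>t\<in>{0<..T}. w t + conv K w t = r t)"
proof -
  obtain \<sigma> where "\<sigma> > 0" and \<sigma>0: "\<forall>(w :: real \<Rightarrow> 'a) N.
     (\<forall>t\<in>{0<..T}. norm (w t) \<le> N * t powr (a - 1)) \<longrightarrow>
     (\<forall>t\<in>{0<..T}. norm (conv (\<lambda>s. exp (- (\<sigma> * s)) * K s) w t) \<le> (N / 2) * t powr (a - 1))"
    using small_weighted_kernel[OF K T a, where 'a = 'a] by (elim exE conjE) (rule that)
  have \<sigma>: "norm (conv (\<lambda>s. exp (- (\<sigma> * s)) * K s) w t) \<le> (N / 2) * t powr (a - 1)"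
    if "\<And>t. \<lbrakk>0 < t; t \<le> T\<rbrakk> \<Longrightarrow> norm (w t) \<le> N * t powr (a - 1)" "0 < t" "t \<le> T"
    for w :: "real \<Rightarrow> 'a" and N t
    using \<sigma>0[THEN spec, THEN spec, THEN mp, of w N] that by auto
  define L where "L = (\<lambda>s. exp (- (\<sigma> * s)) * K s)"
  have L: "weakly_singular T L" unfolding L_def by (rule weakly_singular_exp_kernel[OF K])
  define z where "z n = ((\<lambda>w t. - conv L w t) ^^ n) (\<lambda>s. exp (- (\<sigma> * s)) *\<^sub>R r s)" for n
  have z0: "z 0 = (\<lambda>s. exp (- (\<sigma> * s)) *\<^sub>R r s)" and zS: "z (Suc n) t = - conv L (z n) t" for n t
    by (simp_all add: z_def)
  have "wsing T a (z 0)" using wsing_exp_weight[OF r, of "- \<sigma>"] by (simp add: z0)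
  then obtain N where N: "N \<ge> 0" "\<And>t. \<lbrakk>0 < t; t \<le> T\<rbrakk> \<Longrightarrow> norm (z 0 t) \<le> N * t powr (a - 1)"
    using wsingE by metis
  have zb: "norm (z n t) \<le> (N / 2 ^ n) * t powr (a - 1)" if "0 < t" "t \<le> T" for t n
    using that
  proof (induction n arbitrary: t)
    case (Suc n)
    then show ?case using \<sigma>[of "z n" "N / 2 ^ n" t] by (simp add: mult_ac zS L_def)
  qed (use N in simp)
  have zw: "wsing T a (z n)" for n
  proof (rule wsingI[OF _ zb])
    show "continuous_on {0<..T} (z n)"
    proof (induction n)
      case 0
      then show ?case using wsing_continuous[OF \<open>wsing T a (z 0)\<close>] .
    next
      case (Suc n)
      then have "wsing T a (z n)" using zb by (intro wsingI[of _ _ "N / 2 ^ n"])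
      then have "continuous_on {0<..T} (conv L (z n))"
        using a by (intro conv_continuous[OF L]) (auto simp: weakly_singular_def)
      then show ?case by (simp add: zS[abs_def] continuous_on_minus)
    qed
  qed
  define S where "S n t = (\<Sum>i<n. z i t)" for n t
  define Z where "Z t = (\<Sum>i. z i t)" for t
  have sb: "(\<lambda>i. (N / 2 ^ i) * c) sums (2 * N * c)" for c :: real
    using sums_mult[OF sums_mult2[OF geometric_sums[of "1/2::real"]], of N c] by (simp add: power_divide mult_ac)
  have summ: "summable (\<lambda>i. z i t)" if "0 < t" "t \<le> T" for t
    by (rule summable_comparison_test'[OF sums_summable[OF sb] zb[OF that]])
  have tail: "norm (Z t - S n t) \<le> (2 * N / 2 ^ n) * t powr (a - 1)" if t: "0 < t" "t \<le> T" for t n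
  proof -
    have "Z t - S n t = (\<Sum>i. z (i + n) t)"
      unfolding Z_def S_def using suminf_minus_initial_segment[OF summ[OF t]] by simp
    also have "norm \<dots> \<le> (\<Sum>i. (N / 2 ^ i) * (t powr (a - 1) / 2 ^ n))"
    proof (rule norm_suminf_le[OF _ sums_summable[OF sb]])
      show "norm (z (i + n) t) \<le> (N / 2 ^ i) * (t powr (a - 1) / 2 ^ n)" for i
        using zb[OF t, of "i + n"] by (simp add: power_add)
    qed
    finally show ?thesis using sb[of "t powr (a - 1) / 2 ^ n"] by (simp add: sums_iff)
  qed
  have Sw: "wsing T a (S n)" for n
  proof (induction n)
    case 0
    show ?case by (rule wsingI[where C = 0]) (auto simp: S_def[abs_def])
  next
    case (Suc n)
    then show ?case using wsing_add[OF Suc zw[of n]] by (simp add: S_def[abs_def])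
  qed
  have Sfix: "S (Suc n) t + conv L (S n) t = z 0 t" if t: "0 < t" "t \<le> T" for n t
  proof (induction n)
    case 0
    have "S 0 = (\<lambda>t. 0)" by (simp add: S_def[abs_def])
    moreover have "conv L (\<lambda>t. 0) t = (0::'a)" by (simp add: conv_def set_lebesgue_integral_def)
    ultimately show ?case by (simp add: S_def)
  next
    case (Suc n)
    have "conv L (S (Suc n)) t = conv L (S n) t + conv L (z n) t"
      using conv_add_right[OF L, of "S n" "z n" t] Sw[of n] zw[of n] a t
      by (auto simp: weakly_singular_def S_def[abs_def])
    moreover have "S (Suc (Suc n)) t = S (Suc n) t + z (Suc n) t" by (simp add: S_def)
    ultimately show ?case using Suc zS[of n t] by simp
  qed
  have Zw: "wsing T a Z"
  proof (rule wsingI)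
    show "norm (Z t) \<le> (2 * N) * t powr (a - 1)" if "0 < t" "t \<le> T" for t
      using tail[OF that, of 0] by (simp add: S_def)
    show "continuous_on {0<..T} Z"
    proof (rule continuous_on_Ioc_of_Icc)
      fix d :: real assume d: "d > 0"
      define P where "P = d powr (a - 1) + T powr (a - 1)"
      have P: "t powr (a - 1) \<le> P" if "d \<le> t" "t \<le> T" for t
        unfolding P_def using d that by (rule powr_le_endpoint_sum)
      have "uniform_limit {d..T} S Z sequentially"
      proof (rule uniform_limitI)
        fix e :: real assume e: "e > 0"
        have "(\<lambda>n. (2 * N * (1 / 2) ^ n) * P) \<longlonglongrightarrow> (2 * N * 0) * P"
          by (intro tendsto_intros) auto
        then have "\<forall>\<^sub>F n in sequentially. (2 * N * (1 / 2) ^ n) * P < e"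
          using e by (intro order_tendstoD(2)) auto
        then show "\<forall>\<^sub>F n in sequentially. \<forall>t\<in>{d..T}. dist (S n t) (Z t) < e"
        proof (eventually_elim, intro ballI)
          fix n t assume n: "(2 * N * (1 / 2) ^ n) * P < e" and t: "t \<in> {d..T}"
          have "norm (Z t - S n t) \<le> (2 * N / 2 ^ n) * t powr (a - 1)" using tail t d by auto
          also have "\<dots> \<le> (2 * N / 2 ^ n) * P" using N(1) P t by (intro mult_left_mono) auto
          finally show "dist (S n t) (Z t) < e"
            using n by (simp add: dist_norm norm_minus_commute power_divide)
        qed
      qed
      then show "continuous_on {d..T} Z"
        by (rule uniform_limit_theorem[rotated])
          (use d Sw in \<open>auto intro!: always_eventually continuous_on_subset[OF wsing_continuous[OF Sw]]\<close>)
    qed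
  qed
  have Zfix: "Z t + conv L Z t = z 0 t" if t: "0 < t" "t \<le> T" for t
  proof -
    have "norm (Z t + conv L Z t - z 0 t) \<le> (2 * N * (1 / 2) ^ n) * t powr (a - 1)" for n
    proof -
      have "conv L (\<lambda>s. Z s - S n s) t = conv L Z t - conv L (S n) t"
        by (rule conv_diff_right[OF L]) (use Zw Sw a t in \<open>auto simp: weakly_singular_def\<close>)
      moreover have "Z t + conv L Z t - (S (Suc n) t + conv L (S n) t) =
          (Z t - S (Suc n) t) + (conv L Z t - conv L (S n) t)" by simp
      ultimately have "Z t + conv L Z t - z 0 t = (Z t - S (Suc n) t) + conv L (\<lambda>s. Z s - S n s) t"
        using Sfix[OF t, of n] by simp
      also have "norm \<dots> \<le> (2 * N / 2 ^ Suc n) * t powr (a - 1) + (2 * N / 2 ^ n / 2) * t powr (a - 1)"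
        unfolding L_def
        by (intro order_trans[OF norm_triangle_ineq] add_mono tail t \<sigma>)
      finally show ?thesis by (simp add: power_divide field_simps)
    qed
    moreover have "(\<lambda>n. (2 * N * (1 / 2) ^ n) * t powr (a - 1)) \<longlonglongrightarrow> (2 * N * 0) * t powr (a - 1)"
      by (intro tendsto_intros) auto
    ultimately have "norm (Z t + conv L Z t - z 0 t) \<le> (2 * N * 0) * t powr (a - 1)"
      by (intro LIMSEQ_le_const) auto
    then show ?thesis by simp
  qed
  define w where "w s = exp (\<sigma> * s) *\<^sub>R Z s" for s
  have wZ: "exp (- (\<sigma> * s)) *\<^sub>R w s = Z s" for s
    by (simp add: w_def exp_minus)
  have "w t + conv K w t = r t" if t: "0 < t" "t \<le> T" for t
  proof -
    have "exp (- (\<sigma> * t)) *\<^sub>R (w t + conv K w t) = exp (- (\<sigma> * t)) *\<^sub>R r t"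
      using Zfix[OF t] conv_exp_weight[of \<sigma> K w t] by (simp add: wZ L_def z0 scaleR_add_right)
    then show ?thesis by simp
  qed
  moreover have "wsing T a w" unfolding w_def by (rule wsing_exp_weight[OF Zw])
  ultimately show ?thesis by auto
qed

section \<open>Caputo derivatives of fractional integrals\<close>

lemma conv_has_integral:
  fixes K w :: "real \<Rightarrow> real"
  assumes "weakly_singular T K" "weakly_singular T w" "0 < t" "t \<le> T"
  shows "((\<lambda>s. K (t - s) * w s) has_integral conv K w t) {0..t}"
proof -
  note I = set_borel_integral_eq_integral[OF conv_integrable[OF assms]]
  have "((\<lambda>s. K (t - s) * w s) has_integral conv K w t) {0<..<t}"
    using integrable_integral[OF I(1)] I(2) by (simp add: conv_def)
  then show ?thesis by (simp add: has_integral_Icc_iff_Ioo)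
qed

text \<open>In infinite dimensions the two integrals are compared after pairing with a vector.\<close>

lemma integral_eq_lborel:
  fixes f :: "real \<Rightarrow> 'a::{real_inner, banach, second_countable_topology}"
  assumes "continuous_on {0..c} f"
  shows "integral {0..c} f = (LBINT s:{0<..<c}. f s)"
proof -
  have int: "set_integrable lborel {0<..<c} f"
    by (rule set_integrable_subset[OF borel_integrable_compact[unfolded set_integrable_def[symmetric], of "{0..c}" f]])
      (use assms in auto)
  have "x \<bullet> integral {0..c} f = x \<bullet> (LBINT s:{0<..<c}. f s)" for x
  proof -
    have "x \<bullet> integral {0..c} f = integral {0..c} (\<lambda>s. x \<bullet> f s)"
      using integral_linear[OF integrable_continuous_real[OF assms] bounded_linear_inner_right[of x]]
      by (simp add: o_def)
    also have "\<dots> = integral {0<..<c} (\<lambda>s. x \<bullet> f s)"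
      by (simp add: integral_def integrable_on_def has_integral_Icc_iff_Ioo)
    also have "\<dots> = (LBINT s:{0<..<c}. x \<bullet> f s)"
      using set_borel_integral_eq_integral(2)[of "{0<..<c}" "\<lambda>s. x \<bullet> f s"]
        integrable_inner_right[of x, OF int[unfolded set_integrable_def]]
      by (simp add: set_integrable_def)
    also have "\<dots> = x \<bullet> (LBINT s:{0<..<c}. f s)"
      using integral_inner_right[of x, OF int[unfolded set_integrable_def]]
      by (simp add: set_lebesgue_integral_def)
    finally show ?thesis .
  qed
  then show ?thesis using vector_eq_ldot by blast
qed

lemma frac_kernel_1: "t > 0 \<Longrightarrow> frac_kernel 1 t = 1"
  by (simp add: frac_kernel_def)

text \<open>The integral of \<open>(t - s) powr (- a) dy(s)\<close> over \<open>[0, t - \<delta>]\<close>, where \<open>y\<close> is the fractional integral of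
  order \<open>a\<close> of \<open>w\<close>, is the convolution of this kernel with \<open>w\<close> at \<open>t - \<delta>\<close>. The kernel is positive, its mass
  tends to \<open>Gamma (1 - a)\<close>, and it concentrates at \<open>t\<close> as \<open>\<delta>\<close> tends to \<open>0\<close>.\<close>

definition truncated_kernel :: "real \<Rightarrow> real \<Rightarrow> real \<Rightarrow> real" where
  "truncated_kernel a \<delta> x = \<delta> powr (1 - a) / (\<delta> + x) * frac_kernel a x"

lemma weakly_singular_mult_continuous:
  assumes "weakly_singular T w" "continuous_on {0..T} (g :: real \<Rightarrow> real)"
  shows "weakly_singular T (\<lambda>s. g s *\<^sub>R w s)"
proof -
  obtain a where a: "a > 0" "wsing T a w" using assms(1) unfolding weakly_singular_def by auto
  obtain C where C: "C \<ge> 0" "\<And>t. \<lbrakk>0 < t; t \<le> T\<rbrakk> \<Longrightarrow> norm (w t) \<le> C * t powr (a - 1)"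
    using wsingE[OF a(2)] by metis
  have "bounded (g ` {0..T})"
    by (intro compact_imp_bounded compact_continuous_image assms(2)) auto
  then obtain B where B: "B > 0" "\<And>t. \<lbrakk>0 \<le> t; t \<le> T\<rbrakk> \<Longrightarrow> \<bar>g t\<bar> \<le> B"
    unfolding bounded_pos by auto
  have "wsing T a (\<lambda>s. g s *\<^sub>R w s)"
  proof (rule wsingI[where C = "B * C"])
    show "continuous_on {0<..T} (\<lambda>s. g s *\<^sub>R w s)"
      by (intro continuous_intros wsing_continuous[OF a(2)] continuous_on_subset[OF assms(2)]) auto
    show "norm (g t *\<^sub>R w t) \<le> B * C * t powr (a - 1)" if "0 < t" "t \<le> T" for t
      using mult_mono[OF B(2)[of t] C(2)[OF that]] that B(1) by (simp add: mult.assoc)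
  qed
  then show ?thesis using a(1) unfolding weakly_singular_def by auto
qed

lemma weakly_singular_truncated_kernel:
  assumes "0 < a" "0 < \<delta>"
  shows "weakly_singular T (truncated_kernel a \<delta>)"
proof -
  have "continuous_on {0..T} (\<lambda>x. \<delta> powr (1 - a) / (\<delta> + x))"
    using assms by (intro continuous_intros) auto
  from weakly_singular_mult_continuous[OF weakly_singular_frac_kernel[OF assms(1)] this]
  show ?thesis by (simp add: truncated_kernel_def[abs_def])
qed

text \<open>The convolution has the elementary primitive
  \<open>s powr a * (\<delta> + x - s) powr (- a) / ((\<delta> + x) * Gamma a)\<close>.\<close>

lemma truncated_kernel_eq:
  assumes a: "0 < a" "a < 1" and \<delta>: "0 < \<delta>" and x: "0 < x"
  shows "\<delta> powr (- a) * frac_kernel a x - conv (\<lambda>r. a * (\<delta> + r) powr (- a - 1)) (frac_kernel a) x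
    = truncated_kernel a \<delta> x"
proof -
  let ?L = "\<delta> + x"
  define C where "C = 1 / (?L * Gamma a)"
  define F where "F s = (s powr a * (?L - s) powr (- a)) * C" for s
  have G: "Gamma a > 0" using a by (simp add: Gamma_real_pos)
  have "((\<lambda>s. a * (\<delta> + (x - s)) powr (- a - 1) * frac_kernel a s) has_integral (F x - F 0)) {0..x}"
  proof (rule fundamental_theorem_of_calculus_interior)
    show "continuous_on {0..x} F"
      unfolding F_def
    proof (intro continuous_on_mult continuous_on_const)
      show "continuous_on {0..x} (\<lambda>s. s powr a)"
        by (rule continuous_on_powr') (use a in auto)
      show "continuous_on {0..x} (\<lambda>s. (?L - s) powr (- a))"
        by (intro continuous_intros) (use \<delta> in auto)
    qed
    fix s assume s: "s \<in> {0<..<x}"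
    have Ls: "?L - s > 0" "s > 0" using s \<delta> by auto
    have "(F has_real_derivative
        ((a * s powr (a - 1)) * (?L - s) powr (- a) + s powr a * ((- a) * (?L - s) powr (- a - 1) * (-1)))
          * C) (at s)"
      unfolding F_def using Ls by (auto intro!: derivative_eq_intros simp: algebra_simps)
    also have "(?L - s) powr (- a) = (?L - s) * (?L - s) powr (- a - 1)"
      using Ls powr_add[of "?L - s" 1 "- a - 1"] by simp
    also have "s powr a = s * s powr (a - 1)" using Ls powr_add[of s 1 "a - 1"] by simp
    also have "((a * s powr (a - 1)) * ((?L - s) * (?L - s) powr (- a - 1)) +
         s * s powr (a - 1) * ((- a) * (?L - s) powr (- a - 1) * (-1))) * C =
      a * (?L - s) powr (- a - 1) * s powr (a - 1) * (?L * C)"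
      by (simp add: algebra_simps)
    also have "?L * C = 1 / Gamma a" using \<delta> x by (simp add: C_def)
    also have "a * (?L - s) powr (- a - 1) * s powr (a - 1) * (1 / Gamma a) =
      a * (\<delta> + (x - s)) powr (- a - 1) * frac_kernel a s"
      by (simp add: frac_kernel_def add_diff_eq)
    finally show "(F has_vector_derivative a * (\<delta> + (x - s)) powr (- a - 1) * frac_kernel a s) (at s)"
      by (simp add: has_real_derivative_iff_has_vector_derivative)
  qed (use x in auto)
  moreover have "((\<lambda>s. a * (\<delta> + (x - s)) powr (- a - 1) * frac_kernel a s) has_integral
      conv (\<lambda>r. a * (\<delta> + r) powr (- a - 1)) (frac_kernel a) x) {0..x}"
  proof (rule conv_has_integral[of x])
    show "weakly_singular x (\<lambda>r. a * (\<delta> + r) powr (- a - 1))"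
      using \<delta> by (intro weakly_singular_of_continuous continuous_intros) auto
  qed (use x a weakly_singular_frac_kernel in auto)
  ultimately have "conv (\<lambda>r. a * (\<delta> + r) powr (- a - 1)) (frac_kernel a) x = F x - F 0"
    using has_integral_unique by blast
  also have "\<dots> = x powr a * \<delta> powr (- a) / (?L * Gamma a)" using a by (simp add: F_def C_def)
  also have "x powr a = x * x powr (a - 1)" using x powr_add[of x 1 "a - 1"] by simp
  finally have 1: "conv (\<lambda>r. a * (\<delta> + r) powr (- a - 1)) (frac_kernel a) x =
     x * x powr (a - 1) * \<delta> powr (- a) / (?L * Gamma a)" .
  have "\<delta> powr (1 - a) = \<delta> * \<delta> powr (- a)" using \<delta> powr_add[of \<delta> 1 "- a"] by simp
  moreover have "\<delta> powr (- a) * frac_kernel a x - x * x powr (a - 1) * \<delta> powr (- a) / (?L * Gamma a) =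
     \<delta> powr (- a) * frac_kernel a x * (1 - x / ?L)"
    by (simp add: frac_kernel_def right_diff_distrib diff_divide_distrib mult_ac)
  moreover have "1 - x / ?L = \<delta> / ?L" using \<delta> x by (simp add: field_simps)
  ultimately show ?thesis unfolding 1 truncated_kernel_def by (simp add: mult_ac)
qed

lemma caputo_truncated:
  fixes w :: "real \<Rightarrow> 'a::{real_inner, banach, second_countable_topology}"
  assumes a: "0 < a" "a < 1" and w: "weakly_singular T w" and c: "0 < c" "c < t" "t \<le> T"
    and y: "continuous_on {0..t} y" and yw: "\<And>s. \<lbrakk>0 \<le> s; s \<le> t\<rbrakk> \<Longrightarrow> y s = y0 + conv (frac_kernel a) w s"
  shows "((t - c) powr (- a) *\<^sub>R y c - integral {0..c} (\<lambda>s. (a * (t - s) powr (- a - 1)) *\<^sub>R y s))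
      - ((t - 0) powr (- a) *\<^sub>R y 0 - integral {0..0} (\<lambda>s. (a * (t - s) powr (- a - 1)) *\<^sub>R y s))
    = conv (truncated_kernel a (t - c)) w c"
proof -
  define \<delta> where "\<delta> = t - c"
  define K where "K r = a * (\<delta> + r) powr (- a - 1)" for r
  define z where "z = conv (frac_kernel a) w"
  have \<delta>: "\<delta> > 0" using c by (simp add: \<delta>_def)
  have K: "weakly_singular T K"
    unfolding K_def using \<delta> by (intro weakly_singular_of_continuous continuous_intros) auto
  have g: "weakly_singular T (frac_kernel a)" using a by (intro weakly_singular_frac_kernel)
  have Kc: "K (c - s) = a * (t - s) powr (- a - 1)" for s by (simp add: K_def \<delta>_def)
  have contK: "continuous_on {0..c} (\<lambda>s. K (c - s))"
    unfolding Kc using c by (intro continuous_intros) auto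
  have z: "continuous_on {0..c} z"
  proof (rule continuous_on_eq)
    show "continuous_on {0..c} (\<lambda>s. y s - y0)"
      by (intro continuous_intros continuous_on_subset[OF y]) (use c in auto)
  qed (use yw c in \<open>auto simp: z_def\<close>)
  have "((\<lambda>s. K (c - s)) has_integral ((t - c) powr (- a) - (t - 0) powr (- a))) {0..c}"
    by (rule fundamental_theorem_of_calculus)
      (use c in \<open>auto simp: Kc has_real_derivative_iff_has_vector_derivative[symmetric]
        intro!: derivative_eq_intros\<close>)
  then have 1: "((\<lambda>s. K (c - s) *\<^sub>R y0) has_integral ((t - c) powr (- a) - (t - 0) powr (- a)) *\<^sub>R y0) {0..c}"
    by (rule has_integral_scaleR_left)
  have contKz: "continuous_on {0..c} (\<lambda>s. K (c - s) *\<^sub>R z s)"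
    by (intro continuous_intros contK z)
  have "integral {0..c} (\<lambda>s. K (c - s) *\<^sub>R z s) = conv K z c"
    unfolding conv_def by (rule integral_eq_lborel[OF contKz])
  then have 2: "((\<lambda>s. K (c - s) *\<^sub>R z s) has_integral conv K z c) {0..c}"
    using integrable_integral[OF integrable_continuous_real[OF contKz]] by simp
  have "((\<lambda>s. K (c - s) *\<^sub>R y s) has_integral ((t - c) powr (- a) - (t - 0) powr (- a)) *\<^sub>R y0 + conv K z c) {0..c}"
    by (rule has_integral_eq[OF _ has_integral_add[OF 1 2]])
      (use yw c in \<open>auto simp: z_def scaleR_add_right\<close>)
  then have 3: "integral {0..c} (\<lambda>s. (a * (t - s) powr (- a - 1)) *\<^sub>R y s) =
      ((t - c) powr (- a) - (t - 0) powr (- a)) *\<^sub>R y0 + conv K z c"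
    unfolding Kc by (rule integral_unique)
  have "conv K z c = conv (conv K (frac_kernel a)) w c"
    unfolding z_def by (rule conv_assoc[OF K g w]) (use c in auto)
  then have "\<delta> powr (- a) *\<^sub>R z c - conv K z c =
      conv (\<lambda>x. \<delta> powr (- a) *\<^sub>R frac_kernel a x) w c - conv (conv K (frac_kernel a)) w c"
    by (simp add: z_def conv_scaleR_left)
  also have "\<dots> = conv (\<lambda>x. \<delta> powr (- a) *\<^sub>R frac_kernel a x + (-1) * conv K (frac_kernel a) x) w c"
    using c by (subst conv_add_left[of T])
      (use weakly_singular_scaleR[OF g] weakly_singular_scaleR[OF weakly_singular_conv[OF K g], of "-1"] w
        in \<open>auto simp: conv_scaleR_left[of "-1", simplified]\<close>)
  also have "\<dots> = conv (truncated_kernel a \<delta>) w c"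
    by (rule conv_cong) (use truncated_kernel_eq[OF a \<delta>] in \<open>auto simp: K_def[abs_def]\<close>)
  finally have "\<delta> powr (- a) *\<^sub>R z c - conv K z c = conv (truncated_kernel a \<delta>) w c" .
  moreover have "y c = y0 + z c" "y 0 = y0" using yw[of c] yw[of 0] c by (auto simp: z_def)
  ultimately show ?thesis unfolding 3 by (simp add: \<delta>_def algebra_simps)
qed

text \<open>The mass is the truncated integral for \<open>w = 1\<close>, where \<open>y = frac_kernel (1 + a)\<close> is differentiable. Its
  limit is therefore an ordinary Beta integral.\<close>

lemma truncated_kernel_mass:
  assumes a: "0 < a" "a < 1" and t: "0 < t"
  shows "((\<lambda>c. conv (truncated_kernel a (t - c)) (\<lambda>_. 1) c) \<longlongrightarrow> Gamma (1 - a)) (at_left t)"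
proof -
  define y where "y = frac_kernel (1 + a)"
  have G: "Gamma a > 0" using a by (simp add: Gamma_real_pos)
  have G1: "Gamma (1 + a) = a * Gamma a" using Gamma_plus1[of a] a nonpos_Ints_nonpos[of a] by (force simp: add.commute)
  define C where "C = 1 / Gamma (1 + a)"
  have yC: "y s = s powr a * C" for s by (simp add: y_def frac_kernel_def C_def)
  have aC: "a * C = 1 / Gamma a" using a by (simp add: C_def G1)
  have g: "weakly_singular t (frac_kernel b)" if "b > 0" for b
    using that by (rule weakly_singular_frac_kernel)
  have one: "weakly_singular t (\<lambda>_. 1 :: real)"
    by (intro weakly_singular_of_continuous continuous_on_const)
  have cy: "continuous_on {0..t} y"
    unfolding y_def frac_kernel_def[abs_def] divide_inverse
    by (intro continuous_on_mult continuous_on_const continuous_on_powr') (use a in auto)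
  have yw: "y s = 0 + conv (frac_kernel a) (\<lambda>_. 1) s" if "0 \<le> s" "s \<le> t" for s
  proof (cases "s = 0")
    case True
    then show ?thesis using a by (simp add: y_def frac_kernel_def)
  next
    case False
    have "conv (frac_kernel a) (\<lambda>_. 1) s = conv (frac_kernel a) (frac_kernel 1) s"
      by (rule conv_cong) (auto simp: frac_kernel_1)
    also have "\<dots> = frac_kernel (a + 1) s" using a that False by (intro frac_kernel_conv) auto
    finally show ?thesis by (simp add: y_def add.commute)
  qed
  define F where "F s = (t - s) powr (- a) * frac_kernel a s" for s
  have eq: "conv (truncated_kernel a (t - c)) (\<lambda>_. 1) c = integral {0..c} F" if c: "0 < c" "c < t" for c
  proof -
    define D where "D s = (t - s) powr (- a) * y s" for s
    have "((\<lambda>s. a * (t - s) powr (- a - 1) * y s + F s) has_integral (D c - D 0)) {0..c}"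
    proof (rule fundamental_theorem_of_calculus_interior)
      show "continuous_on {0..c} D"
        unfolding D_def by (intro continuous_intros continuous_on_subset[OF cy]) (use c in auto)
      fix s assume s: "s \<in> {0<..<c}"
      have "(D has_real_derivative ((- a) * (t - s) powr (- a - 1) * (-1)) * y s +
          (t - s) powr (- a) * (s powr (a - 1) * (a * C))) (at s)"
        unfolding D_def yC using s c a
        by (auto intro!: derivative_eq_intros simp: algebra_simps)
      also have "((- a) * (t - s) powr (- a - 1) * (-1)) * y s +
          (t - s) powr (- a) * (s powr (a - 1) * (a * C)) = a * (t - s) powr (- a - 1) * y s + F s"
        unfolding aC by (simp add: F_def frac_kernel_def)
      finally show "(D has_vector_derivative a * (t - s) powr (- a - 1) * y s + F s) (at s)"
        by (simp add: has_real_derivative_iff_has_vector_derivative)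
    qed (use c in auto)
    moreover have "(\<lambda>s. a * (t - s) powr (- a - 1) * y s) integrable_on {0..c}"
      by (intro integrable_continuous_real continuous_intros continuous_on_subset[OF cy]) (use c in auto)
    ultimately have "((\<lambda>s. (a * (t - s) powr (- a - 1) * y s + F s) - a * (t - s) powr (- a - 1) * y s)
        has_integral (D c - D 0 - integral {0..c} (\<lambda>s. a * (t - s) powr (- a - 1) * y s))) {0..c}"
      by (intro has_integral_diff integrable_integral)
    then have "integral {0..c} F = D c - D 0 - integral {0..c} (\<lambda>s. a * (t - s) powr (- a - 1) * y s)"
      by (intro integral_unique) simp
    then show ?thesis
      using caputo_truncated[OF a one c order_refl cy yw] by (simp add: D_def)
  qed
  have "((\<lambda>s. frac_kernel (1 - a) (t - s) * frac_kernel a s) has_integral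
      conv (frac_kernel (1 - a)) (frac_kernel a) t) {0..t}"
    by (rule conv_has_integral[of t]) (use a t g in auto)
  also have "conv (frac_kernel (1 - a)) (frac_kernel a) t = 1"
    using a t by (subst frac_kernel_conv) (auto simp: frac_kernel_1)
  finally have "((\<lambda>s. Gamma (1 - a) * (frac_kernel (1 - a) (t - s) * frac_kernel a s)) has_integral
      Gamma (1 - a) * 1) {0..t}" by (rule has_integral_mult_right)
  moreover have "Gamma (1 - a) * (frac_kernel (1 - a) (t - s) * frac_kernel a s) = F s" for s
    using a less_imp_neq[OF Gamma_real_pos[of "1 - a"]] by (simp add: F_def frac_kernel_def)
  ultimately have F: "(F has_integral Gamma (1 - a)) {0..t}" by simp
  have "continuous_on {0..t} (\<lambda>c. integral {0..c} F)"
    by (rule indefinite_integral_continuous_1) (use F in auto)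
  then have "((\<lambda>c. integral {0..c} F) \<longlongrightarrow> integral {0..t} F) (at t within {0..t})"
    using t by (auto simp: continuous_on_def)
  then have "((\<lambda>c. integral {0..c} F) \<longlongrightarrow> Gamma (1 - a)) (at_left t)"
    using t F by (simp add: at_within_Icc_at_left integral_unique)
  moreover have "\<forall>\<^sub>F c in at_left t. integral {0..c} F = conv (truncated_kernel a (t - c)) (\<lambda>_. 1) c"
    unfolding eventually_at_left_field using eq t by (intro exI[of _ 0]) auto
  ultimately show ?thesis by (rule Lim_transform_eventually)
qed


text \<open>The Caputo derivative inverts the fractional integral at every point where the integrand is
  continuous, although the fractional integral may have no derivative there. By the preceding lemmas
  the truncated integrals are, up to the factor \<open>Gamma (1 - a)\<close>, convolutions of \<open>w\<close> with an approximate
  identity at \<open>t\<close>.\<close>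

lemma caputo_frac_integral:
  fixes w :: "real \<Rightarrow> 'a::{real_inner, banach, second_countable_topology}"
  assumes a: "0 < a" "a < 1" and w: "weakly_singular T w" and t: "0 < t" "t < T"
    and y: "continuous_on {0..t} y" and yw: "\<And>s. \<lbrakk>0 \<le> s; s \<le> t\<rbrakk> \<Longrightarrow> y s = y0 + conv (frac_kernel a) w s"
  shows "has_caputo_derivative a y (w t) t"
proof -
  define m where "m c = conv (truncated_kernel a (t - c)) (\<lambda>_. 1 :: real) c" for c
  define v where "v s = w s - w t" for s
  define P where "P c = conv (frac_kernel a) (\<lambda>s. norm (v s)) c" for c
  define H where "H c = (t - c) powr (- a) *\<^sub>R y c - integral {0..c} (\<lambda>s. (a * (t - s) powr (- a - 1)) *\<^sub>R y s)" for c
  have const: "weakly_singular T (\<lambda>_. b)" for b :: "'b::real_normed_vector"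
    by (intro weakly_singular_of_continuous continuous_on_const)
  have ker: "weakly_singular T (truncated_kernel a (t - c))" if "c < t" for c
    using that a by (intro weakly_singular_truncated_kernel) auto
  have ker0: "0 \<le> truncated_kernel a (t - c) s" if "c < t" "0 < s" for c s
    using that a frac_kernel_nonneg[of a s] by (simp add: truncated_kernel_def)
  have v: "weakly_singular T v" unfolding v_def by (intro weakly_singular_diff w const)
  have Hm: "H c - H 0 = m c *\<^sub>R w t + conv (truncated_kernel a (t - c)) v c" if c: "0 < c" "c < t" for c
  proof -
    have "H c - H 0 = conv (truncated_kernel a (t - c)) w c"
      unfolding H_def by (rule caputo_truncated[OF a w c _ y yw]) (use t in auto)
    moreover have "conv (truncated_kernel a (t - c)) v c = conv (truncated_kernel a (t - c)) w c -
        conv (truncated_kernel a (t - c)) (\<lambda>_. w t) c"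
      unfolding v_def by (rule conv_diff_right[of T]) (use ker w const c t in auto)
    moreover have "conv (truncated_kernel a (t - c)) (\<lambda>_. w t) c = m c *\<^sub>R w t"
    proof -
      have "integrable lborel (\<lambda>s. indicator {0<..<c} s *\<^sub>R truncated_kernel a (t - c) (c - s))"
        using conv_integrable[OF ker[OF c(2)] const[of "1::real"], of c] c t
        by (simp add: set_integrable_def)
      then have "(\<integral>s. (indicator {0<..<c} s *\<^sub>R truncated_kernel a (t - c) (c - s)) *\<^sub>R w t \<partial>lborel) =
          (\<integral>s. indicator {0<..<c} s *\<^sub>R truncated_kernel a (t - c) (c - s) \<partial>lborel) *\<^sub>R w t"
        by (intro integral_scaleR_left)
      then show ?thesis
        unfolding m_def conv_def set_lebesgue_integral_def by simp
    qed
    ultimately show ?thesis by simp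
  qed
  have lim_m: "(m \<longlongrightarrow> Gamma (1 - a)) (at_left t)"
    using truncated_kernel_mass[OF a t(1)] by (simp add: m_def[abs_def])
  have contw: "continuous_on {0<..T} w"
    using w unfolding weakly_singular_def by (auto intro: wsing_continuous)
  have "continuous_on {0<..T} P" unfolding P_def
    by (intro conv_continuous weakly_singular_norm v weakly_singular_frac_kernel a)
  then have "(P \<longlongrightarrow> P t) (at t within {0<..T})" using t by (auto simp: continuous_on_def)
  then have "(P \<longlongrightarrow> P t) (at t within {0<..<t})"
    by (rule tendsto_within_subset) (use t in auto)
  moreover have "at t within {0<..<t} = at_left t"
    by (rule at_within_nhd[of _ "{0<..}"]) (use t in auto)
  ultimately have lim_P: "(P \<longlongrightarrow> P t) (at_left t)" by simp
  have bound: "norm (conv (truncated_kernel a (t - c)) v c) \<le> e * m c + (t - c) powr (1 - a) / \<eta> * P c"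
    if e: "0 < e" and \<eta>: "0 < \<eta>" "\<And>s. \<lbrakk>0 < s; t - \<eta> < s; s < t\<rbrakk> \<Longrightarrow> norm (v s) \<le> e" and c: "0 < c" "c < t"
    for e \<eta> c
  proof -
    let ?k = "truncated_kernel a (t - c)"
    have k0: "0 \<le> ?k s" if "0 < s" for s using ker0[OF c(2) that] .
    have wv: "weakly_singular T (\<lambda>s. norm (v s))" by (rule weakly_singular_norm[OF v])
    have wv2: "weakly_singular T (\<lambda>s. ((t - s) / \<eta>) *\<^sub>R norm (v s))"
      by (rule weakly_singular_mult_continuous[OF wv]) (intro continuous_intros, use \<eta> in auto)
    have "norm (conv ?k v c) \<le> conv (\<lambda>s. \<bar>?k s\<bar>) (\<lambda>s. norm (v s)) c" by (rule conv_norm_le)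
    also have "\<dots> = conv ?k (\<lambda>s. norm (v s)) c" by (rule conv_cong) (use k0 in auto)
    \<comment> \<open>\<open>t - s\<close> is at least \<open>\<eta>\<close> where \<open>v\<close> is not small, and it cancels the denominator of the kernel\<close>
    also have "\<dots> \<le> conv ?k (\<lambda>s. e + ((t - s) / \<eta>) *\<^sub>R norm (v s)) c"
    proof (rule conv_mono[OF ker[OF c(2)] wv])
      show "weakly_singular T (\<lambda>s. e + ((t - s) / \<eta>) *\<^sub>R norm (v s))"
        by (intro weakly_singular_add const wv2)
      fix s assume s: "0 < s" "s < c"
      show "norm (v s) \<le> e + ((t - s) / \<eta>) *\<^sub>R norm (v s)"
      proof (cases "t - \<eta> < s")
        case True
        then have "norm (v s) \<le> e" using \<eta>(2)[of s] s c by auto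
        moreover have "0 \<le> ((t - s) / \<eta>) *\<^sub>R norm (v s)" using s c \<eta>(1) by simp
        ultimately show ?thesis by linarith
      next
        case False
        then have "1 \<le> (t - s) / \<eta>" using \<eta>(1) by (simp add: field_simps)
        then have "1 * norm (v s) \<le> (t - s) / \<eta> * norm (v s)" by (intro mult_right_mono) auto
        then show ?thesis using e by simp
      qed
    qed (use k0 c t in auto)
    also have "\<dots> = conv ?k (\<lambda>s. e *\<^sub>R 1) c + conv ?k (\<lambda>s. ((t - s) / \<eta>) *\<^sub>R norm (v s)) c"
      using conv_add_right[OF ker[OF c(2)] const wv2, of c "e *\<^sub>R 1"] c t by simp
    also have "conv ?k (\<lambda>s. e *\<^sub>R 1) c = e * m c" unfolding conv_scaleR_right by (simp add: m_def)
    also have "conv ?k (\<lambda>s. ((t - s) / \<eta>) *\<^sub>R norm (v s)) c = ((t - c) powr (1 - a) / \<eta>) *\<^sub>R P c"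
      unfolding P_def conv_scaleR_right[symmetric]
      unfolding conv_def
      by (rule set_lebesgue_integral_cong) (use c \<eta> in \<open>auto simp: truncated_kernel_def\<close>)
    finally show ?thesis by simp
  qed
  have "((\<lambda>c. conv (truncated_kernel a (t - c)) v c) \<longlongrightarrow> 0) (at_left t)"
  proof (rule tendstoI)
    fix e :: real assume e: "e > 0"
    have G: "Gamma (1 - a) > 0" using a by (intro Gamma_real_pos) auto
    define e' where "e' = e / (2 * Gamma (1 - a))"
    have e': "e' > 0" using e G by (simp add: e'_def)
    have "t \<in> {0<..T}" using t by auto
    then obtain \<eta> where \<eta>: "\<eta> > 0" "\<And>s. \<lbrakk>s \<in> {0<..T}; dist s t < \<eta>\<rbrakk> \<Longrightarrow> dist (w s) (w t) < e'"
      using contw e' unfolding continuous_on_iff by blast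
    have near: "norm (v s) \<le> e'" if "0 < s" "t - \<eta> < s" "s < t" for s
      using \<eta>(2)[of s] that t by (auto simp: dist_norm v_def dist_real_def)
    have lim_p: "((\<lambda>c. (t - c) powr (1 - a)) \<longlongrightarrow> (t - t) powr (1 - a)) (at_left t)"
    proof (rule tendsto_powr2)
      show "\<forall>\<^sub>F c in at_left t. 0 \<le> t - c"
        unfolding eventually_at_left_field using t by (intro exI[of _ 0]) auto
      show "((\<lambda>c. t - c) \<longlongrightarrow> t - t) (at_left t)" by (intro tendsto_intros)
    qed (use a in \<open>auto intro!: tendsto_intros\<close>)
    have "((\<lambda>c. e' * m c + (t - c) powr (1 - a) / \<eta> * P c) \<longlongrightarrow>
        e' * Gamma (1 - a) + (t - t) powr (1 - a) / \<eta> * P t) (at_left t)"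
      using \<eta>(1)
      by (intro tendsto_add tendsto_mult tendsto_divide tendsto_const lim_p lim_m lim_P) simp
    moreover have "e' * Gamma (1 - a) + (t - t) powr (1 - a) / \<eta> * P t < e"
      using e G by (simp add: e'_def)
    ultimately have "\<forall>\<^sub>F c in at_left t. e' * m c + (t - c) powr (1 - a) / \<eta> * P c < e"
      by (rule order_tendstoD(2))
    moreover have "\<forall>\<^sub>F c in at_left t. 0 < c \<and> c < t"
      unfolding eventually_at_left_field using t by (intro exI[of _ 0]) auto
    ultimately show "\<forall>\<^sub>F c in at_left t. dist (conv (truncated_kernel a (t - c)) v c) 0 < e"
    proof eventually_elim
      case (elim c)
      then show ?case using bound[OF e' \<eta>(1) near, of c] by auto
    qed
  qed
  then have "((\<lambda>c. m c *\<^sub>R w t + conv (truncated_kernel a (t - c)) v c) \<longlongrightarrow> Gamma (1 - a) *\<^sub>R w t + 0) (at_left t)"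
    by (intro tendsto_intros lim_m)
  moreover have "\<forall>\<^sub>F c in at_left t. m c *\<^sub>R w t + conv (truncated_kernel a (t - c)) v c = H c - H 0"
    unfolding eventually_at_left_field using t Hm by (intro exI[of _ 0]) auto
  ultimately have "((\<lambda>c. H c - H 0) \<longlongrightarrow> Gamma (1 - a) *\<^sub>R w t) (at_left t)"
    using Lim_transform_eventually by fastforce
  moreover have "stieltjes_primitive (\<lambda>s. (t - s) powr (- a)) y H t"
    using caputo_kernel_primitive[OF y, of a] unfolding H_def .
  ultimately have "has_stieltjes_integral (\<lambda>s. (t - s) powr (- a)) y (Gamma (1 - a) *\<^sub>R w t) 0 t"
    by (intro stieltjes_of_limit[where H = H] t) auto
  moreover have "Gamma (1 - a) \<noteq> 0" using a less_imp_neq[OF Gamma_real_pos[of "1 - a"]] by simp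
  ultimately show ?thesis unfolding has_caputo_derivative_def
    by (intro exI[of _ "Gamma (1 - a) *\<^sub>R w t"] conjI) auto
qed

section \<open>The fundamental solution\<close>

lemma weakly_singular_mult: "weakly_singular T w \<Longrightarrow> weakly_singular T (\<lambda>t. c * (w t :: real))"
  using weakly_singular_scaleR[of T w c] by simp

lemma conv_mult_right: "conv K (\<lambda>s. c * (w s :: real)) t = c * conv K w t"
  using conv_scaleR_right[of K c w t] by simp

lemma conv_mult_left: "conv (\<lambda>s. c * K s) (w :: real \<Rightarrow> real) t = c * conv K w t"
  using conv_scaleR_left[of c K w t] by simp

lemma conv_sum_right:
  fixes K :: "real \<Rightarrow> real" and w :: "'b \<Rightarrow> real \<Rightarrow> real"
  assumes "\<And>j. j \<in> J \<Longrightarrow> weakly_singular T (w j)" "weakly_singular T K" "0 < t" "t \<le> T"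
  shows "conv K (\<lambda>s. \<Sum>j\<in>J. w j s) t = (\<Sum>j\<in>J. conv K (w j) t)"
  using conv_sum_left[of J T w K t] assms by (simp add: conv_commute[of K])

lemma conv_frac_kernel_sum:
  assumes "\<And>j. j \<in> J \<Longrightarrow> 0 < b j" "0 < a" "0 < t"
  shows "conv (frac_kernel a) (\<lambda>s. \<Sum>j\<in>J. c j * frac_kernel (b j) s) t =
    (\<Sum>j\<in>J. c j * frac_kernel (a + b j) t)"
proof -
  have "conv (frac_kernel a) (\<lambda>s. \<Sum>j\<in>J. c j * frac_kernel (b j) s) t =
     (\<Sum>j\<in>J. conv (frac_kernel a) (\<lambda>s. c j * frac_kernel (b j) s) t)"
    by (rule conv_sum_right[of _ t])
      (use assms in \<open>auto intro!: weakly_singular_mult weakly_singular_frac_kernel\<close>)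
  also have "\<dots> = (\<Sum>j\<in>J. c j * frac_kernel (a + b j) t)"
    using assms by (intro sum.cong) (simp_all add: frac_kernel_conv conv_mult_right)
  finally show ?thesis .
qed

lemma mult_id_frac_kernel:
  assumes "a > 0" "t > 0"
  shows "t * frac_kernel a t = a * frac_kernel (1 + a) t"
proof -
  have "Gamma (1 + a) = a * Gamma a"
    using Gamma_plus1[of a] assms nonpos_Ints_nonpos[of a] by (force simp: add.commute)
  moreover have "t * t powr (a - 1) = t powr a" using assms powr_add[of t 1 "a - 1"] by simp
  ultimately show ?thesis using assms by (simp add: frac_kernel_def)
qed

text \<open>Multiplication by the variable is a derivation of convolution: \<open>t = (t - s) + s\<close>.\<close>

lemma mult_id_conv:
  fixes a b :: "real \<Rightarrow> real"
  assumes a: "weakly_singular T a" and b: "weakly_singular T b" and t: "0 < t" "t \<le> T"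
  shows "t * conv a b t = conv (\<lambda>s. s * a s) b t + conv a (\<lambda>s. s * b s) t"
proof -
  have ws: "weakly_singular T (\<lambda>s. s * w s)" if "weakly_singular T w" for w :: "real \<Rightarrow> real"
    using weakly_singular_mult_continuous[OF that, of "\<lambda>s. s"] by simp
  have "t * conv a b t = (LBINT s:{0<..<t}. t * (a (t - s) * b s))"
    by (simp add: conv_def set_lebesgue_integral_def mult_ac flip: integral_mult_right_zero)
  also have "\<dots> = (LBINT s:{0<..<t}. (t - s) * a (t - s) * b s + a (t - s) * (s * b s))"
    by (simp add: algebra_simps)
  also have "\<dots> = conv (\<lambda>s. s * a s) b t + conv a (\<lambda>s. s * b s) t"
    using conv_integrable[OF ws[OF a] b t] conv_integrable[OF a ws[OF b] t]
    by (simp add: conv_def set_integral_add(2))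
  finally show ?thesis .
qed

locale fractional_data =
  fixes M :: nat and \<rho> q :: "nat \<Rightarrow> real" and T :: real
  assumes T: "T > 0" and M: "M \<ge> 1"
    and rho: "\<And>j. j \<in> {1..M} \<Longrightarrow> 0 < \<rho> j \<and> \<rho> j < 1"
    and rho_less: "\<And>j. j \<in> {2..M} \<Longrightarrow> \<rho> j < \<rho> 1"
    and q: "\<And>j. j \<in> {1..M} \<Longrightarrow> q j > 0" and q1: "q 1 = 1"
begin

text \<open>If \<open>y\<close> is a constant plus the fractional integral of order \<open>\<rho> 1\<close> of \<open>w\<close>, then the weighted sum of the Caputo
  derivatives of \<open>y\<close> is \<open>w + lower_kernel * w\<close>.\<close>

definition lower_kernel :: "real \<Rightarrow> real" where
  "lower_kernel s = (\<Sum>j=2..M. q j * frac_kernel (\<rho> 1 - \<rho> j) s)"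

text \<open>For differentiable \<open>y\<close> the weighted sum of the Caputo derivatives is \<open>memory_kernel * y'\<close>.\<close>

definition memory_kernel :: "real \<Rightarrow> real" where
  "memory_kernel s = (\<Sum>j=1..M. q j * frac_kernel (1 - \<rho> j) s)"

definition full_kernel :: "real \<Rightarrow> real \<Rightarrow> real" where
  "full_kernel lam s = lower_kernel s + lam * frac_kernel (\<rho> 1) s"

text \<open>The function with Laplace transform \<open>1 / (\<Sum>\<^sub>j q j * z powr \<rho> j + lam)\<close>; for \<open>M = 1\<close> it is
  \<open>t powr (\<rho> 1 - 1)\<close> times a Mittag-Leffler function. Its Volterra equation determines it on \<open>(0, T]\<close>.\<close>

definition green :: "real \<Rightarrow> real \<Rightarrow> real" where
  "green lam = (SOME G. wsing T (\<rho> 1) G \<and>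
     (\<forall>t\<in>{0<..T}. G t + conv (full_kernel lam) G t = frac_kernel (\<rho> 1) t))"

lemma rho1: "0 < \<rho> 1" "\<rho> 1 < 1" using rho[of 1] M by auto

lemma sum_split_first: "(\<Sum>j=1..M. c j) = c 1 + (\<Sum>j=2..M. c j :: 'b::comm_monoid_add)"
  using sum.atLeast_Suc_atMost[of 1 M c] M by (simp add: numeral_2_eq_2)

lemma ws_frac: "a > 0 \<Longrightarrow> weakly_singular T (frac_kernel a)"
  by (rule weakly_singular_frac_kernel)

lemma ws_lower: "weakly_singular T lower_kernel"
  unfolding lower_kernel_def[abs_def]
  by (intro weakly_singular_sum weakly_singular_mult ws_frac) (use rho_less in auto)

lemma ws_memory: "weakly_singular T memory_kernel"
  unfolding memory_kernel_def[abs_def]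
  by (intro weakly_singular_sum weakly_singular_mult ws_frac) (use rho in auto)

lemma ws_full: "weakly_singular T (full_kernel lam)"
  unfolding full_kernel_def[abs_def]
  by (intro weakly_singular_add weakly_singular_mult ws_frac ws_lower rho1)

lemma ws_const: "weakly_singular T (\<lambda>_. c)"
  by (intro weakly_singular_of_continuous continuous_on_const)

lemma lower_nonneg: "0 \<le> lower_kernel s"
  unfolding lower_kernel_def using q rho_less
  by (intro sum_nonneg mult_nonneg_nonneg frac_kernel_nonneg) (auto intro: less_imp_le)

lemma memory_nonneg: "0 \<le> memory_kernel s"
  unfolding memory_kernel_def using q rho
  by (intro sum_nonneg mult_nonneg_nonneg frac_kernel_nonneg) (auto intro: less_imp_le)

lemma full_nonneg: "lam \<ge> 0 \<Longrightarrow> 0 \<le> full_kernel lam s"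
  unfolding full_kernel_def using lower_nonneg frac_kernel_nonneg rho1 by simp

lemma green: "wsing T (\<rho> 1) (green lam)"
  "\<lbrakk>0 < t; t \<le> T\<rbrakk> \<Longrightarrow> green lam t + conv (full_kernel lam) (green lam) t = frac_kernel (\<rho> 1) t"
proof -
  have "\<exists>G. wsing T (\<rho> 1) G \<and>
     (\<forall>t\<in>{0<..T}. G t + conv (full_kernel lam) G t = frac_kernel (\<rho> 1) t)"
    by (rule volterra_exists[OF ws_full wsing_frac_kernel[OF rho1(1)] rho1(1) T])
  from someI_ex[OF this] show "wsing T (\<rho> 1) (green lam)"
    "\<lbrakk>0 < t; t \<le> T\<rbrakk> \<Longrightarrow> green lam t + conv (full_kernel lam) (green lam) t = frac_kernel (\<rho> 1) t"
    unfolding green_def[symmetric] by auto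
qed

lemma ws_green: "weakly_singular T (green lam)"
  unfolding weakly_singular_def using green(1) rho1 by auto

text \<open>For \<open>j > 1\<close> the semigroup law writes \<open>y\<close> as the fractional integral of order \<open>\<rho> j\<close> of the fractional
  integral of order \<open>\<rho> 1 - \<rho> j\<close> of \<open>w\<close>.\<close>

lemma caputo_sum_of_frac_integral:
  fixes w :: "real \<Rightarrow> 'a::{real_inner, banach, second_countable_topology}"
  assumes w: "weakly_singular T w" and y: "continuous_on {0..T} y"
    and yw: "\<And>s. \<lbrakk>0 \<le> s; s \<le> T\<rbrakk> \<Longrightarrow> y s = y0 + conv (frac_kernel (\<rho> 1)) w s" and t: "0 < t" "t < T"
  shows "\<exists>d. (\<forall>j\<in>{1..M}. has_caputo_derivative (\<rho> j) y (d j) t) \<and>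
     (\<Sum>j=1..M. q j *\<^sub>R d j) = w t + conv lower_kernel w t"
proof -
  define d where "d j = (if j = 1 then w t else conv (frac_kernel (\<rho> 1 - \<rho> j)) w t)" for j
  have "has_caputo_derivative (\<rho> j) y (d j) t" if j: "j \<in> {1..M}" for j
  proof (cases "j = 1")
    case True
    have "continuous_on {0..t} y" by (rule continuous_on_subset[OF y]) (use t in auto)
    then show ?thesis
      using caputo_frac_integral[OF rho1 w t, of y y0] yw t True by (simp add: d_def)
  next
    case False
    then have j2: "j \<in> {2..M}" using j by auto
    have pos: "0 < \<rho> 1 - \<rho> j" using rho_less[OF j2] by simp
    let ?w = "conv (frac_kernel (\<rho> 1 - \<rho> j)) w"
    have ws: "weakly_singular T ?w" by (intro weakly_singular_conv ws_frac pos w)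
    have "conv (frac_kernel (\<rho> j)) ?w s = conv (frac_kernel (\<rho> 1)) w s" if s: "0 < s" "s \<le> T" for s
    proof -
      have "conv (frac_kernel (\<rho> j)) ?w s = conv (conv (frac_kernel (\<rho> j)) (frac_kernel (\<rho> 1 - \<rho> j))) w s"
        by (rule conv_assoc[OF _ _ w s]) (use rho[OF j] pos ws_frac in auto)
      also have "\<dots> = conv (frac_kernel (\<rho> 1)) w s"
        by (rule conv_cong) (use rho[OF j] pos in \<open>auto simp: frac_kernel_conv\<close>)
      finally show ?thesis .
    qed
    then have "y s = y0 + conv (frac_kernel (\<rho> j)) ?w s" if "0 \<le> s" "s \<le> t" for s
      using yw[of s] that t by (cases "s = 0") auto
    then have "has_caputo_derivative (\<rho> j) y (?w t) t"
      using rho[OF j] t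
      by (intro caputo_frac_integral[OF _ _ ws] continuous_on_subset[OF y]) auto
    then show ?thesis using False by (simp add: d_def)
  qed
  moreover have "(\<Sum>j=1..M. q j *\<^sub>R d j) = w t + conv lower_kernel w t"
  proof -
    have "(\<Sum>j=2..M. q j *\<^sub>R d j) = (\<Sum>j=2..M. conv (\<lambda>s. q j * frac_kernel (\<rho> 1 - \<rho> j) s) w t)"
      by (rule sum.cong) (auto simp: d_def conv_scaleR_left)
    also have "\<dots> = conv lower_kernel w t"
      unfolding lower_kernel_def[abs_def]
      by (rule conv_sum_left[symmetric, of _ T])
        (use rho_less w t in \<open>auto intro!: weakly_singular_mult ws_frac\<close>)
    finally show ?thesis by (simp add: sum_split_first d_def q1 del: One_nat_def)
  qed
  ultimately show ?thesis by blast
qed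

text \<open>Convolution with the fundamental solution solves the equation with zero initial value:
  \<open>G * f = G * (w + K * w) = (G + K * G) * w = frac_kernel (\<rho> 1) * w\<close>.\<close>

lemma green_conv:
  fixes f :: "real \<Rightarrow> real"
  assumes f: "wsing T 1 f"
  shows "\<exists>w. weakly_singular T w \<and>
    (\<forall>t\<in>{0<..T}. w t + conv (full_kernel lam) w t = f t) \<and>
    (\<forall>t\<in>{0..T}. conv (green lam) f t = conv (frac_kernel (\<rho> 1)) w t)"
proof -
  obtain w where w: "wsing T 1 w" "\<forall>t\<in>{0<..T}. w t + conv (full_kernel lam) w t = f t"
    using volterra_exists[OF ws_full f _ T] by auto
  have ws: "weakly_singular T w" using w(1) unfolding weakly_singular_def by (intro exI[of _ 1]) auto
  note G = ws_green[of lam] and K = ws_full[of lam]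
  have "conv (green lam) f t = conv (frac_kernel (\<rho> 1)) w t" if t: "0 < t" "t \<le> T" for t
  proof -
    have "conv (green lam) f t = conv (green lam) (\<lambda>s. w s + conv (full_kernel lam) w s) t"
      by (rule conv_cong) (use w(2) t in auto)
    also have "\<dots> = conv (green lam) w t + conv (conv (green lam) (full_kernel lam)) w t"
      using conv_add_right[OF G ws weakly_singular_conv[OF K ws] t] conv_assoc[OF G K ws t] by simp
    also have "\<dots> = conv (\<lambda>s. green lam s + conv (green lam) (full_kernel lam) s) w t"
      by (rule conv_add_left[OF G weakly_singular_conv[OF G K] ws t, symmetric])
    also have "\<dots> = conv (frac_kernel (\<rho> 1)) w t"
      by (rule conv_cong) (use green(2)[of _ lam] t in \<open>auto simp: conv_commute[of "green lam"]\<close>)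
    finally show ?thesis .
  qed
  then have "conv (green lam) f t = conv (frac_kernel (\<rho> 1)) w t" if "0 \<le> t" "t \<le> T" for t
    using that by (cases "t = 0") auto
  then show ?thesis using ws w(2) by (intro exI[of _ w]) auto
qed

lemma green_conv_continuous:
  assumes "wsing T 1 f"
  shows "continuous_on {0..T} (conv (green lam) f)"
  by (rule conv_continuous_0[OF rho1(1) _ green(1) assms]) (use rho1 in auto)

text \<open>The convolution satisfies the equation pointwise, so the comparison principle applies to it.\<close>

lemma green_conv_nonneg:
  fixes f :: "real \<Rightarrow> real"
  assumes lam: "lam \<ge> 0" and f: "continuous_on {0..T} f" and f0: "\<And>t. \<lbrakk>0 \<le> t; t \<le> T\<rbrakk> \<Longrightarrow> 0 \<le> f t"
    and t: "0 \<le> t" "t < T"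
  shows "0 \<le> conv (green lam) f t"
proof -
  let ?y = "conv (green lam) f"
  have f1: "wsing T 1 f" by (rule wsing_of_continuous[OF f])
  obtain w where w: "weakly_singular T w"
    "\<forall>t\<in>{0<..T}. w t + conv (full_kernel lam) w t = f t"
    "\<forall>t\<in>{0..T}. ?y t = conv (frac_kernel (\<rho> 1)) w t"
    using green_conv[OF f1, of lam] by (elim exE conjE)
  have cont: "continuous_on {0..T} ?y" by (rule green_conv_continuous[OF f1])
  show ?thesis
  proof (rule caputo_comparison[OF cont _ lam M rho q _ t])
    fix s assume s: "0 < s" "s < T"
    obtain d where d: "\<forall>j\<in>{1..M}. has_caputo_derivative (\<rho> j) ?y (d j) s"
      "(\<Sum>j=1..M. q j *\<^sub>R d j) = w s + conv lower_kernel w s"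
      using caputo_sum_of_frac_integral[OF w(1) cont, of 0 s] w(3) s by auto
    have "conv (full_kernel lam) w s = conv lower_kernel w s + lam * ?y s"
      using conv_add_left[OF ws_lower weakly_singular_mult[OF ws_frac[OF rho1(1)], of lam] w(1), of s] s
      by (simp add: full_kernel_def[abs_def] conv_scaleR_left w(3))
    then have "(\<Sum>j=1..M. q j * d j) + lam * ?y s = f s" using d(2) w(2)[rule_format, of s] s by simp
    then show "\<exists>d. (\<forall>j\<in>{1..M}. has_caputo_derivative (\<rho> j) ?y (d j) s) \<and>
        0 \<le> (\<Sum>j=1..M. q j * d j) + lam * ?y s"
      using d(1) f0[of s] s by (intro exI[of _ d]) auto
  qed auto
qed

text \<open>If \<open>G\<close> were negative at a point, then a nonnegative continuous \<open>f\<close> concentrated near \<open>0\<close> would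
  make \<open>G * f\<close> negative. All estimates below rest on this positivity.\<close>

lemma green_nonneg:
  assumes lam: "lam \<ge> 0" and t: "0 < t" "t \<le> T"
  shows "0 \<le> green lam t"
proof (rule ccontr)
  assume neg: "\<not> 0 \<le> green lam t"
  have cont: "continuous_on {0<..T} (green lam)" by (rule wsing_continuous[OF green(1)])
  then have "(green lam \<longlongrightarrow> green lam t) (at t within {0<..T})" using t by (auto simp: continuous_on_def)
  then have "(green lam \<longlongrightarrow> green lam t) (at t within {0<..<t})"
    by (rule tendsto_within_subset) (use t in auto)
  moreover have "at t within {0<..<t} = at_left t"
    by (rule at_within_nhd[of _ "{0<..}"]) (use t in auto)
  ultimately have "\<forall>\<^sub>F s in at_left t. green lam s < 0" using neg by (intro order_tendstoD(2)) auto
  then obtain b where b: "b < t" "\<And>s. \<lbrakk>b < s; s < t\<rbrakk> \<Longrightarrow> green lam s < 0"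
    unfolding eventually_at_left_field by blast
  \<comment> \<open>\<open>f\<close> below is supported on \<open>[0, \<eta>]\<close>, and \<open>green lam (r - s)\<close> is negative for \<open>s\<close> in this interval\<close>
  define r where "r = (max b 0 + t) / 2"
  define \<eta> where "\<eta> = (r - max b 0) / 2"
  have r: "b < r - \<eta>" "0 < r - \<eta>" "r < t" "0 < \<eta>" "0 < r" using b(1) t by (auto simp: r_def \<eta>_def max_def field_simps)
  define f where "f s = max 0 (\<eta> - s)" for s
  have "0 \<le> conv (green lam) f r"
    by (rule green_conv_nonneg[OF lam]) (use r t in \<open>auto simp: f_def intro!: continuous_intros\<close>)
  moreover have "conv (green lam) f r < 0"
  proof -
    have int: "((\<lambda>s. green lam (r - s) * f s) has_integral conv (green lam) f r) {0..r}"
      by (rule conv_has_integral[OF ws_green])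
        (use r t in \<open>auto simp: weakly_singular_def f_def intro!: exI[of _ 1] wsing_of_continuous continuous_intros\<close>)
    have nonpos: "green lam (r - s) * f s \<le> 0" if "0 \<le> s" for s
      using that b(2)[of "r - s"] r by (cases "s < \<eta>") (auto simp: f_def mult_nonpos_nonneg less_imp_le)
    have cont2: "continuous_on {0..\<eta> / 2} (\<lambda>s. green lam (r - s) * f s)"
      unfolding f_def
      by (intro continuous_intros continuous_on_compose2[OF cont]) (use r t in auto)
    have "conv (green lam) f r \<le> integral {0..\<eta> / 2} (\<lambda>s. green lam (r - s) * f s)"
    proof -
      have "integral {0..\<eta> / 2} (\<lambda>s. - (green lam (r - s) * f s)) \<le> integral {0..r} (\<lambda>s. - (green lam (r - s) * f s))"
      proof (rule integral_subset_le)
        show "(\<lambda>s. - (green lam (r - s) * f s)) integrable_on {0..\<eta> / 2}"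
          by (intro integrable_neg integrable_continuous_real cont2)
        show "(\<lambda>s. - (green lam (r - s) * f s)) integrable_on {0..r}"
          by (intro integrable_neg has_integral_integrable[OF int])
      qed (use nonpos r in auto)
      then show ?thesis using integral_unique[OF int] by simp
    qed
    also have "\<dots> < integral {0..\<eta> / 2} (\<lambda>s. 0)"
    proof (rule integral_less_real)
      show "continuous_on {0..\<eta> / 2} (\<lambda>s. green lam (r - s) * f s)" by (rule cont2)
      show "green lam (r - s) * f s < 0" if "s \<in> {0<..<\<eta> / 2}" for s
        using that b(2)[of "r - s"] r by (auto simp: f_def intro!: mult_neg_pos)
    qed (use r in auto)
    finally show ?thesis by simp
  qed
  ultimately show False by simp
qed

text \<open>The solution of the homogeneous equation with initial value \<open>1\<close>.\<close>

definition relaxation :: "real \<Rightarrow> real \<Rightarrow> real" where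
  "relaxation lam t = 1 - lam * conv (\<lambda>_. 1) (green lam) t"

text \<open>Convolve the equation of the fundamental solution with \<open>frac_kernel (1 - \<rho> 1)\<close>. The right-hand side
  shows that the relaxation function is nonnegative, which its definition does not.\<close>

lemma relaxation_eq:
  assumes t: "0 < t" "t \<le> T"
  shows "relaxation lam t = conv memory_kernel (green lam) t"
proof -
  let ?b = "frac_kernel (1 - \<rho> 1)" and ?G = "green lam" and ?K = "full_kernel lam"
  have b: "weakly_singular T ?b" using rho1 by (intro ws_frac) auto
  note G = ws_green[of lam] and K = ws_full[of lam]
  have kernel: "?b s + conv ?b ?K s = memory_kernel s + lam * 1" if s: "0 < s" "s \<le> T" for s
  proof -
    have "conv ?b ?K s = conv ?b lower_kernel s + lam * conv ?b (frac_kernel (\<rho> 1)) s"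
      unfolding full_kernel_def[abs_def]
      using conv_add_right[OF b ws_lower weakly_singular_mult[OF ws_frac[OF rho1(1)], of lam] s]
      by (simp add: conv_mult_right)
    also have "conv ?b (frac_kernel (\<rho> 1)) s = 1"
      using rho1 s by (subst frac_kernel_conv) (auto simp: frac_kernel_1)
    also have "conv ?b lower_kernel s = (\<Sum>j=2..M. q j * frac_kernel ((1 - \<rho> 1) + (\<rho> 1 - \<rho> j)) s)"
      unfolding lower_kernel_def[abs_def] by (rule conv_frac_kernel_sum) (use rho1 rho_less s in auto)
    also have "\<dots> = (\<Sum>j=2..M. q j * frac_kernel (1 - \<rho> j) s)" by simp
    finally show ?thesis by (simp add: memory_kernel_def sum_split_first q1 del: One_nat_def)
  qed
  have "1 = conv ?b (frac_kernel (\<rho> 1)) t"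
    using rho1 t by (subst frac_kernel_conv) (auto simp: frac_kernel_1)
  also have "\<dots> = conv ?b (\<lambda>s. ?G s + conv ?K ?G s) t"
    by (rule conv_cong) (use green(2) t in auto)
  also have "\<dots> = conv ?b ?G t + conv (conv ?b ?K) ?G t"
    using conv_add_right[OF b G weakly_singular_conv[OF K G] t] conv_assoc[OF b K G t] by simp
  also have "\<dots> = conv (\<lambda>s. ?b s + conv ?b ?K s) ?G t"
    by (rule conv_add_left[OF b weakly_singular_conv[OF b K] G t, symmetric])
  also have "\<dots> = conv (\<lambda>s. memory_kernel s + lam * 1) ?G t"
    by (rule conv_cong) (use kernel t in auto)
  also have "\<dots> = conv memory_kernel ?G t + lam * conv (\<lambda>_. 1) ?G t"
    using conv_add_left[OF ws_memory weakly_singular_mult[OF ws_const, of lam 1] G t]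
    by (simp only: conv_mult_left)
  finally show ?thesis by (simp add: relaxation_def)
qed

lemma relaxation_nonneg:
  assumes lam: "lam \<ge> 0" and t: "0 < t" "t \<le> T"
  shows "0 \<le> relaxation lam t"
  unfolding relaxation_eq[OF t]
  by (rule conv_nonneg) (use memory_nonneg green_nonneg[OF lam] t in auto)

lemma relaxation_le_1:
  assumes lam: "lam \<ge> 0" and t: "0 < t" "t \<le> T"
  shows "relaxation lam t \<le> 1"
  unfolding relaxation_def
  using lam conv_nonneg[of t "\<lambda>_. 1" "green lam"] green_nonneg[OF lam] t by simp

lemma relaxation_continuous: "continuous_on {0..T} (relaxation lam)"
  unfolding relaxation_def[abs_def]
  by (intro continuous_intros conv_continuous_0[of 1 "\<rho> 1" T] wsing_of_continuous green(1))
    (use rho1 in auto)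

lemma relaxation_antimono:
  assumes lam: "lam \<ge> 0" and s: "0 < s" "s \<le> t" and t: "t \<le> T"
  shows "relaxation lam t \<le> relaxation lam s"
proof -
  have int: "((\<lambda>r. green lam r) has_integral conv (\<lambda>_. 1) (green lam) r) {0..r}" if "0 < r" "r \<le> T" for r
    using conv_has_integral[OF ws_const[of "1::real"] ws_green[of lam] that] by simp
  have "integral {0<..<s} (green lam) \<le> integral {0<..<t} (green lam)"
    by (rule integral_subset_le)
      (use int[of s] int[of t] s t green_nonneg[OF lam] in \<open>auto simp: integrable_on_def has_integral_Icc_iff_Ioo\<close>)
  moreover have "integral {0<..<r} (green lam) = conv (\<lambda>_. 1) (green lam) r" if "0 < r" "r \<le> T" for r
    using int[OF that] by (auto simp: has_integral_Icc_iff_Ioo intro: integral_unique)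
  ultimately show ?thesis
    unfolding relaxation_def using lam s t by (auto intro: mult_left_mono)
qed

text \<open>Write \<open>E\<close> for the relaxation function. As \<open>E\<close> is decreasing, \<open>lam * t * E t\<close> is at most
  \<open>lam * (1 * E) t = memory_kernel * (1 - E)\<close> at \<open>t\<close>, and \<open>1 - E \<le> 1\<close>.\<close>

lemma relaxation_decay:
  assumes lam: "lam \<ge> 0" and t: "0 < t" "t \<le> T"
  shows "lam * relaxation lam t \<le> (\<Sum>j=1..M. q j / Gamma (2 - \<rho> j) * t powr (- \<rho> j))"
proof -
  let ?G = "green lam" and ?E = "relaxation lam" and ?one = "\<lambda>_::real. 1::real"
  note G = ws_green[of lam] and kap = ws_memory and one = ws_const[of "1::real"]
  have E: "weakly_singular T ?E"
    by (rule weakly_singular_of_continuous[OF relaxation_continuous])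
  have "lam * (t * ?E t) = lam * conv ?one (\<lambda>_. ?E t) t"
    using t by (simp add: conv_def set_lebesgue_integral_def)
  also have "\<dots> \<le> lam * conv ?one ?E t"
    using lam by (intro mult_left_mono conv_mono[OF one ws_const E t] relaxation_antimono) (use t in auto)
  also have "conv ?one ?E t = conv ?one (conv memory_kernel ?G) t"
    by (rule conv_cong) (use relaxation_eq t in auto)
  also have "\<dots> = conv (conv memory_kernel ?one) ?G t"
  proof -
    have "conv ?one memory_kernel = conv memory_kernel ?one" by (rule ext, rule conv_commute)
    then show ?thesis using conv_assoc[OF one kap G t] by simp
  qed
  also have "\<dots> = conv memory_kernel (conv ?one ?G) t"
    by (rule conv_assoc[OF kap one G t, symmetric])
  also have "lam * \<dots> = conv memory_kernel (\<lambda>s. 1 - ?E s) t"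
    by (simp add: relaxation_def conv_mult_right)
  also have "\<dots> \<le> conv memory_kernel (frac_kernel 1) t"
  proof (rule conv_mono[OF kap _ ws_frac t])
    show "weakly_singular T (\<lambda>s. 1 - ?E s)" by (intro weakly_singular_diff ws_const E)
    show "1 - ?E s \<le> frac_kernel 1 s" if "0 < s" "s < t" for s
      using that t relaxation_nonneg[OF lam, of s] by (simp add: frac_kernel_1)
  qed (use memory_nonneg in auto)
  also have "\<dots> = conv (frac_kernel 1) memory_kernel t" by (rule conv_commute)
  also have "\<dots> = (\<Sum>j=1..M. q j * frac_kernel (1 + (1 - \<rho> j)) t)"
    unfolding memory_kernel_def[abs_def] by (rule conv_frac_kernel_sum) (use rho t in auto)
  also have "\<dots> = (\<Sum>j=1..M. t * (q j / Gamma (2 - \<rho> j) * t powr (- \<rho> j)))"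
  proof (rule sum.cong[OF refl])
    fix j
    have "t powr (1 - \<rho> j) = t * t powr (- \<rho> j)" using t powr_add[of t 1 "- \<rho> j"] by simp
    then show "q j * frac_kernel (1 + (1 - \<rho> j)) t = t * (q j / Gamma (2 - \<rho> j) * t powr (- \<rho> j))"
      by (simp add: frac_kernel_def)
  qed
  also have "\<dots> = t * (\<Sum>j=1..M. q j / Gamma (2 - \<rho> j) * t powr (- \<rho> j))"
    by (simp add: sum_distrib_left)
  finally have "t * (lam * ?E t) \<le> t * (\<Sum>j=1..M. q j / Gamma (2 - \<rho> j) * t powr (- \<rho> j))"
    by (simp add: mult_ac)
  then show ?thesis using t by simp
qed

lemma green_le:
  assumes lam: "lam \<ge> 0" and t: "0 < t" "t \<le> T"
  shows "green lam t \<le> frac_kernel (\<rho> 1) t"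
  using green(2)[OF t, of lam] conv_nonneg[of t "full_kernel lam" "green lam"]
    full_nonneg[OF lam] green_nonneg[OF lam] t by auto

text \<open>The function with Laplace transform \<open>\<Sum>\<^sub>j q j * \<rho> j * z powr (\<rho> j - 1)\<close>, the derivative of the symbol of
  the equation.\<close>

definition weighted_memory :: "real \<Rightarrow> real" where
  "weighted_memory s = (\<Sum>j=1..M. q j * \<rho> j * frac_kernel (1 - \<rho> j) s)"

lemma ws_weighted_memory: "weakly_singular T weighted_memory"
  unfolding weighted_memory_def[abs_def]
  by (intro weakly_singular_sum weakly_singular_mult ws_frac) (use rho in auto)

lemma weighted_memory_le: "weighted_memory s \<le> memory_kernel s"
  unfolding weighted_memory_def memory_kernel_def
proof (rule sum_mono)
  fix j assume j: "j \<in> {1..M}"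
  have "q j * \<rho> j \<le> q j * 1" using q[OF j] rho[OF j] by (intro mult_left_mono) auto
  then show "q j * \<rho> j * frac_kernel (1 - \<rho> j) s \<le> q j * frac_kernel (1 - \<rho> j) s"
    using rho[OF j] by (intro mult_right_mono frac_kernel_nonneg) auto
qed

text \<open>The counterpart of \<open>- (1 / P)' = P' * (1 / P)\<^sup>2\<close> for Laplace transforms. Both sides solve the same Volterra
  equation: the left-hand side because multiplication by \<open>t\<close> is a derivation of convolution, the
  right-hand side by the equation of the fundamental solution.\<close>

lemma mult_id_green:
  assumes t: "0 < t" "t \<le> T"
  shows "t * green lam t = conv (green lam) (conv weighted_memory (green lam)) t"
proof -
  let ?G = "green lam" and ?K = "full_kernel lam" and ?N = weighted_memory and ?g = "frac_kernel (\<rho> 1)"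
  define X where "X s = s * ?G s" for s
  define Y where "Y = conv ?G (conv ?N ?G)"
  note G = ws_green[of lam] and K = ws_full[of lam] and N = ws_weighted_memory
  have g: "weakly_singular T ?g" using rho1 by (intro ws_frac)
  have one: "weakly_singular T (frac_kernel 1)" by (intro ws_frac) simp
  have idws: "weakly_singular T (\<lambda>s. s * w s)" if "weakly_singular T w" for w :: "real \<Rightarrow> real"
    using weakly_singular_mult_continuous[OF that, of "\<lambda>s. s"] by simp
  have X: "weakly_singular T X" unfolding X_def by (rule idws[OF G])
  have NG: "weakly_singular T (conv ?N ?G)" by (rule weakly_singular_conv[OF N G])
  have Y: "weakly_singular T Y" unfolding Y_def by (rule weakly_singular_conv[OF G NG])
  have Yeq: "Y s + conv ?K Y s = conv (conv ?g ?N) ?G s" if s: "0 < s" "s \<le> T" for s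
  proof -
    have "Y s + conv ?K Y s = conv ?G (conv ?N ?G) s + conv (conv ?K ?G) (conv ?N ?G) s"
      unfolding Y_def using conv_assoc[OF K G NG s] by simp
    also have "\<dots> = conv (\<lambda>s. ?G s + conv ?K ?G s) (conv ?N ?G) s"
      by (rule conv_add_left[OF G weakly_singular_conv[OF K G] NG s, symmetric])
    also have "\<dots> = conv ?g (conv ?N ?G) s" by (rule conv_cong) (use green(2) s in auto)
    also have "\<dots> = conv (conv ?g ?N) ?G s" by (rule conv_assoc[OF g N G s])
    finally show ?thesis .
  qed
  have kernel: "\<rho> 1 * frac_kernel 1 s + (\<rho> 1 * conv (frac_kernel 1) ?K s - s * ?K s) = conv ?g ?N s"
    if s: "0 < s" "s \<le> T" for s
  proof -
    have "conv (frac_kernel 1) ?K s = conv (frac_kernel 1) lower_kernel s + lam * conv (frac_kernel 1) ?g s"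
      unfolding full_kernel_def[abs_def]
      using conv_add_right[OF one ws_lower weakly_singular_mult[OF g, of lam] s]
      by (simp add: conv_mult_right)
    also have "conv (frac_kernel 1) ?g s = frac_kernel (1 + \<rho> 1) s"
      using rho1 s by (intro frac_kernel_conv) auto
    also have "conv (frac_kernel 1) lower_kernel s = (\<Sum>j=2..M. q j * frac_kernel (1 + (\<rho> 1 - \<rho> j)) s)"
      unfolding lower_kernel_def[abs_def] by (rule conv_frac_kernel_sum) (use rho_less s in auto)
    finally have 1: "conv (frac_kernel 1) ?K s =
      (\<Sum>j=2..M. q j * frac_kernel (1 + (\<rho> 1 - \<rho> j)) s) + lam * frac_kernel (1 + \<rho> 1) s" .
    have "s * lower_kernel s = (\<Sum>j=2..M. q j * ((\<rho> 1 - \<rho> j) * frac_kernel (1 + (\<rho> 1 - \<rho> j)) s))"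
      unfolding lower_kernel_def sum_distrib_left
    proof (rule sum.cong[OF refl])
      fix j assume j: "j \<in> {2..M}"
      then show "s * (q j * frac_kernel (\<rho> 1 - \<rho> j) s) = q j * ((\<rho> 1 - \<rho> j) * frac_kernel (1 + (\<rho> 1 - \<rho> j)) s)"
        using mult_id_frac_kernel[of "\<rho> 1 - \<rho> j" s] rho_less[OF j] s by (simp add: mult.left_commute[of s])
    qed
    moreover have "s * (lam * ?g s) = lam * (\<rho> 1 * frac_kernel (1 + \<rho> 1) s)"
      using mult_id_frac_kernel[of "\<rho> 1" s] rho1 s by (simp add: mult.left_commute[of s])
    ultimately have 2: "s * ?K s = (\<Sum>j=2..M. q j * ((\<rho> 1 - \<rho> j) * frac_kernel (1 + (\<rho> 1 - \<rho> j)) s)) +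
        lam * (\<rho> 1 * frac_kernel (1 + \<rho> 1) s)"
      by (simp add: full_kernel_def distrib_left)
    have "conv ?g ?N s = (\<Sum>j=1..M. q j * \<rho> j * frac_kernel (\<rho> 1 + (1 - \<rho> j)) s)"
      unfolding weighted_memory_def[abs_def] by (rule conv_frac_kernel_sum) (use rho rho1 s in auto)
    also have "\<dots> = \<rho> 1 * frac_kernel 1 s + (\<Sum>j=2..M. q j * \<rho> j * frac_kernel (1 + (\<rho> 1 - \<rho> j)) s)"
      by (simp add: sum_split_first q1 algebra_simps del: One_nat_def)
    also have "(\<Sum>j=2..M. q j * \<rho> j * frac_kernel (1 + (\<rho> 1 - \<rho> j)) s) =
       (\<Sum>j=2..M. \<rho> 1 * (q j * frac_kernel (1 + (\<rho> 1 - \<rho> j)) s) -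
          q j * ((\<rho> 1 - \<rho> j) * frac_kernel (1 + (\<rho> 1 - \<rho> j)) s))"
      by (rule sum.cong) (simp_all add: algebra_simps)
    also have "\<dots> = \<rho> 1 * (\<Sum>j=2..M. q j * frac_kernel (1 + (\<rho> 1 - \<rho> j)) s) -
       (\<Sum>j=2..M. q j * ((\<rho> 1 - \<rho> j) * frac_kernel (1 + (\<rho> 1 - \<rho> j)) s))"
      by (simp add: sum_subtractf sum_distrib_left)
    finally show ?thesis unfolding 1 2 by (simp add: algebra_simps)
  qed
  have Xeq: "X s + conv ?K X s = conv (conv ?g ?N) ?G s" if s: "0 < s" "s \<le> T" for s
  proof -
    have oneK: "weakly_singular T (conv (frac_kernel 1) ?K)" by (rule weakly_singular_conv[OF one K])
    have "s * (?G s + conv ?K ?G s) = s * ?g s" using green(2)[OF s] by simp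
    then have "X s + (conv (\<lambda>s. s * ?K s) ?G s + conv ?K X s) = \<rho> 1 * frac_kernel (1 + \<rho> 1) s"
      using mult_id_conv[OF K G s] mult_id_frac_kernel[OF rho1(1) s(1)]
      by (simp add: X_def[abs_def] distrib_left)
    also have "frac_kernel (1 + \<rho> 1) s = conv (frac_kernel 1) ?g s"
      using rho1 s by (intro frac_kernel_conv[symmetric]) auto
    also have "\<dots> = conv (frac_kernel 1) (\<lambda>s. ?G s + conv ?K ?G s) s"
      by (rule conv_cong) (use green(2) s in auto)
    also have "\<dots> = conv (frac_kernel 1) ?G s + conv (conv (frac_kernel 1) ?K) ?G s"
      using conv_add_right[OF one G weakly_singular_conv[OF K G] s] conv_assoc[OF one K G s] by simp
    finally have "X s + conv ?K X s = \<rho> 1 * conv (frac_kernel 1) ?G s +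
       (\<rho> 1 * conv (conv (frac_kernel 1) ?K) ?G s + (-1) * conv (\<lambda>s. s * ?K s) ?G s)"
      by (simp add: algebra_simps)
    also have "\<dots> = conv (\<lambda>s. \<rho> 1 * frac_kernel 1 s) ?G s +
        (conv (\<lambda>s. \<rho> 1 * conv (frac_kernel 1) ?K s) ?G s + conv (\<lambda>s. (-1) * (s * ?K s)) ?G s)"
      by (simp only: conv_mult_left)
    also have "\<dots> = conv (\<lambda>s. \<rho> 1 * frac_kernel 1 s + (\<rho> 1 * conv (frac_kernel 1) ?K s + (-1) * (s * ?K s))) ?G s"
      using conv_add_left[OF weakly_singular_mult[OF oneK, of "\<rho> 1"] weakly_singular_mult[OF idws[OF K], of "-1"] G s]
        conv_add_left[OF weakly_singular_mult[OF one, of "\<rho> 1"]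
          weakly_singular_add[OF weakly_singular_mult[OF oneK, of "\<rho> 1"] weakly_singular_mult[OF idws[OF K], of "-1"]] G s]
      by simp
    also have "\<dots> = conv (conv ?g ?N) ?G s"
      by (rule conv_cong) (use kernel s in auto)
    finally show ?thesis .
  qed
  have "X t - Y t = 0"
  proof (rule volterra_unique[OF K weakly_singular_diff[OF X Y] _ t])
    fix s assume s: "0 < s" "s \<le> T"
    show "X s - Y s + conv ?K (\<lambda>s. X s - Y s) s = 0"
      using Xeq[OF s] Yeq[OF s] conv_diff_right[OF K X Y s] by simp
  qed
  then show ?thesis by (simp add: X_def Y_def)
qed

text \<open>With \<open>G\<close> the fundamental solution and \<open>E\<close> the relaxation function,
  \<open>t * G = weighted_memory * G * G \<le> memory_kernel * G * G = E * G \<le> 1 * G\<close>, where the products of functions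
  are convolutions, and \<open>lam * (1 * G) = 1 - E \<le> 1\<close>.\<close>

lemma green_decay:
  assumes lam: "lam \<ge> 0" and t: "0 < t" "t \<le> T"
  shows "lam * (t * green lam t) \<le> 1"
proof -
  let ?G = "green lam" and ?one = "\<lambda>_::real. 1::real"
  note G = ws_green[of lam]
  have G0: "0 \<le> ?G s" if "0 < s" "s < t" for s using green_nonneg[OF lam, of s] that t by auto
  have "t * ?G t = conv ?G (conv weighted_memory ?G) t" by (rule mult_id_green[OF t])
  also have "\<dots> \<le> conv ?G ?one t"
  proof (rule conv_mono[OF G weakly_singular_conv[OF ws_weighted_memory G] ws_const t G0])
    fix s assume s: "0 < s" "s < t"
    then have s': "0 < s" "s \<le> T" using t by auto
    have "conv weighted_memory ?G s = conv ?G weighted_memory s" by (rule conv_commute)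
    also have "\<dots> \<le> conv ?G memory_kernel s"
      by (rule conv_mono[OF G ws_weighted_memory ws_memory s']) (use G0 s weighted_memory_le in auto)
    also have "\<dots> = relaxation lam s" unfolding relaxation_eq[OF s'] by (rule conv_commute)
    also have "\<dots> \<le> 1" by (rule relaxation_le_1[OF lam s'])
    finally show "conv weighted_memory ?G s \<le> 1" .
  qed
  also have "\<dots> = conv ?one ?G t" by (rule conv_commute)
  finally have "lam * (t * ?G t) \<le> lam * conv ?one ?G t" using lam by (rule mult_left_mono)
  also have "\<dots> \<le> 1" using relaxation_nonneg[OF lam t] by (simp add: relaxation_def)
  finally show ?thesis .
qed

text \<open>Geometric mean, with weights \<open>1 - \<epsilon>\<close> and \<open>\<epsilon>\<close>, of the bounds \<open>lam * G \<le> 1 / t\<close> and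
  \<open>G \<le> frac_kernel (\<rho> 1) t\<close>. The first bound alone is uniform in \<open>lam\<close> but not integrable at \<open>0\<close>; giving up
  \<open>lam powr \<epsilon>\<close> makes it integrable.\<close>

lemma green_interpolated:
  assumes lam: "lam > 0" and t: "0 < t" "t \<le> T" and e: "0 < \<epsilon>" "\<epsilon> < 1"
  shows "lam * green lam t \<le> lam powr \<epsilon> * (Gamma (\<rho> 1) powr (- \<epsilon>) * t powr (\<epsilon> * \<rho> 1 - 1))"
proof -
  let ?G = "green lam t"
  have G: "0 \<le> ?G" using green_nonneg[of lam t] lam t by simp
  have Gam: "Gamma (\<rho> 1) > 0" using rho1 by (simp add: Gamma_real_pos)
  have "lam * ?G \<le> 1 / t" using green_decay[of lam t] lam t by (simp add: field_simps)
  then have 1: "(lam * ?G) powr (1 - \<epsilon>) \<le> (1 / t) powr (1 - \<epsilon>)"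
    using lam G e by (intro powr_mono2) auto
  have 2: "?G powr \<epsilon> \<le> (t powr (\<rho> 1 - 1) / Gamma (\<rho> 1)) powr \<epsilon>"
    using green_le[of lam t] lam t G e by (intro powr_mono2) (auto simp: frac_kernel_def)
  have "lam * ?G = lam powr \<epsilon> * ((lam * ?G) powr (1 - \<epsilon>) * ?G powr \<epsilon>)"
  proof (cases "?G = 0")
    case False
    then have "?G > 0" using G by simp
    then show ?thesis using lam
      by (simp add: powr_mult powr_diff field_simps)
  qed simp
  also have "\<dots> \<le> lam powr \<epsilon> * ((1 / t) powr (1 - \<epsilon>) * (t powr (\<rho> 1 - 1) / Gamma (\<rho> 1)) powr \<epsilon>)"
    by (intro mult_left_mono mult_mono 1 2) auto
  also have "(1 / t) powr (1 - \<epsilon>) * (t powr (\<rho> 1 - 1) / Gamma (\<rho> 1)) powr \<epsilon> =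
      Gamma (\<rho> 1) powr (- \<epsilon>) * (t powr (- (1 - \<epsilon>)) * t powr ((\<rho> 1 - 1) * \<epsilon>))"
  proof -
    have "(1 / t) powr (1 - \<epsilon>) = t powr (- (1 - \<epsilon>))"
      using t by (simp only: powr_divide powr_one_eq_one powr_minus_divide)
    moreover have "(t powr (\<rho> 1 - 1) / Gamma (\<rho> 1)) powr \<epsilon> =
        t powr ((\<rho> 1 - 1) * \<epsilon>) * Gamma (\<rho> 1) powr (- \<epsilon>)"
      using Gam by (simp add: powr_divide powr_powr powr_minus_divide)
    ultimately show ?thesis by simp
  qed
  also have "t powr (- (1 - \<epsilon>)) * t powr ((\<rho> 1 - 1) * \<epsilon>) = t powr (\<epsilon> * \<rho> 1 - 1)"
    unfolding powr_add[symmetric] by (simp add: algebra_simps)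
  finally show ?thesis .
qed

end

section \<open>Spectral expansion of the solution\<close>

lemma weakly_singular_dominated:
  assumes w: "continuous_on {0<..T} w" and g: "weakly_singular T g"
    and le: "\<And>t. \<lbrakk>0 < t; t \<le> T\<rbrakk> \<Longrightarrow> norm (w t) \<le> g t"
  shows "weakly_singular T w"
proof -
  obtain a where a: "a > 0" "wsing T a g" using g unfolding weakly_singular_def by auto
  obtain C where C: "\<And>t. \<lbrakk>0 < t; t \<le> T\<rbrakk> \<Longrightarrow> norm (g t) \<le> C * t powr (a - 1)"
    using wsingE[OF a(2)] by metis
  have "wsing T a w"
  proof (rule wsingI[OF w])
    show "norm (w t) \<le> C * t powr (a - 1)" if "0 < t" "t \<le> T" for t
      using C[OF that] le[OF that] by simp
  qed
  then show ?thesis using a(1) unfolding weakly_singular_def by auto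
qed

lemma conv_inner:
  fixes w :: "real \<Rightarrow> 'a::{real_inner, banach, second_countable_topology}"
  assumes "weakly_singular T K" "weakly_singular T w" "0 < t" "t \<le> T"
  shows "conv K w t \<bullet> x = conv K (\<lambda>s. w s \<bullet> x) t"
  using conv_integrable[OF assms] unfolding conv_def set_lebesgue_integral_def set_integrable_def
  by (subst integral_inner_left[symmetric]) (auto simp: mult.assoc)

lemma weakly_singular_inner:
  fixes w :: "real \<Rightarrow> 'a::real_inner"
  assumes w: "weakly_singular T w"
  shows "weakly_singular T (\<lambda>s. w s \<bullet> x)"
proof (rule weakly_singular_dominated)
  show "weakly_singular T (\<lambda>s. norm x *\<^sub>R norm (w s))"
    by (intro weakly_singular_scaleR weakly_singular_norm w)
  have "continuous_on {0<..T} w" using w unfolding weakly_singular_def by (auto intro: wsing_continuous)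
  then show "continuous_on {0<..T} (\<lambda>s. w s \<bullet> x)" by (intro continuous_intros)
  show "norm (w s \<bullet> x) \<le> norm x *\<^sub>R norm (w s)" for s
    using Cauchy_Schwarz_ineq2[of "w s" x] by (simp add: mult.commute)
qed

text \<open>An eigenvector belongs to the domain of the adjoint.\<close>

lemma self_adjoint_coordinates:
  assumes sa: "self_adjoint_operator D A" and e: "e \<in> D" "A e = l *\<^sub>R e" and x: "x \<in> D"
  shows "A x \<bullet> e = l * (x \<bullet> e)"
proof -
  have "(\<forall>x\<in>D. A x \<bullet> e = x \<bullet> (l *\<^sub>R e)) \<longleftrightarrow> (e \<in> D \<and> A e = l *\<^sub>R e)"
    using sa unfolding self_adjoint_operator_def by blast
  then show ?thesis using e x by simp
qed

text \<open>For \<open>x\<close> in the domain both \<open>A x \<bullet> y\<close> and \<open>x \<bullet> z\<close> are sums of the products of the coordinates of \<open>x\<close> and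
  \<open>z\<close>, so \<open>y\<close> lies in the domain of the adjoint.\<close>

lemma self_adjoint_of_coordinates:
  fixes v :: "nat \<Rightarrow> 'a::{real_inner, banach}"
  assumes sa: "self_adjoint_operator D A" and e: "\<And>k. v k \<in> D \<and> A (v k) = lam k *\<^sub>R v k"
    and v: "orthonormal_basis v" and yz: "\<And>k. z \<bullet> v k = lam k * (y \<bullet> v k)"
  shows "y \<in> D \<and> A y = z"
proof -
  have "A x \<bullet> y = x \<bullet> z" if x: "x \<in> D" for x
  proof -
    have "(\<lambda>k. A x \<bullet> ((y \<bullet> v k) *\<^sub>R v k)) sums (A x \<bullet> y)"
      by (rule bounded_linear.sums[OF bounded_linear_inner_right orthonormal_sums[OF v]])
    moreover have "(\<lambda>k. x \<bullet> ((z \<bullet> v k) *\<^sub>R v k)) sums (x \<bullet> z)"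
      by (rule bounded_linear.sums[OF bounded_linear_inner_right orthonormal_sums[OF v]])
    moreover have "A x \<bullet> ((y \<bullet> v k) *\<^sub>R v k) = x \<bullet> ((z \<bullet> v k) *\<^sub>R v k)" for k
      using self_adjoint_coordinates[OF sa _ _ x, of "v k" "lam k"] e[of k] yz[of k] by simp
    ultimately show ?thesis using sums_unique2 by simp
  qed
  then show ?thesis using sa unfolding self_adjoint_operator_def by blast
qed

lemma pow_op_sums:
  fixes v :: "nat \<Rightarrow> 'a::{real_inner, banach}"
  assumes v: "orthonormal_basis v" and g: "g \<in> pow_domain v lam e"
  shows "(\<lambda>k. (lam k powr e * (g \<bullet> v k)) *\<^sub>R v k) sums pow_op v lam e g"
    and pow_op_inner: "pow_op v lam e g \<bullet> v k = lam k powr e * (g \<bullet> v k)"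
proof -
  have "lam k powr (2 * e) * \<bar>g \<bullet> v k\<bar>\<^sup>2 = (lam k powr e * (g \<bullet> v k))\<^sup>2" for k
    by (simp add: power_mult_distrib power2_eq_square powr_add[symmetric])
  then have "summable (\<lambda>k. (lam k powr e * (g \<bullet> v k))\<^sup>2)"
    using g by (simp add: pow_domain_def)
  note E = orthonormal_expansion[where S = "UNIV :: real set" and c = "\<lambda>k _. lam k powr e * (g \<bullet> v k)",
      OF v uniform_tails_summable[OF this] continuous_on_const]
  show "(\<lambda>k. (lam k powr e * (g \<bullet> v k)) *\<^sub>R v k) sums pow_op v lam e g"
    "pow_op v lam e g \<bullet> v k = lam k powr e * (g \<bullet> v k)"
    using E(2,3) by (simp_all add: pow_op_def)
qed

lemma pow_continuous_on_pow_op: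
  fixes v :: "nat \<Rightarrow> 'a::{real_inner, banach}"
  assumes v: "orthonormal_basis v" and f: "pow_continuous_on v lam e S f"
  shows "continuous_on S (\<lambda>s. pow_op v lam e (f s))"
  unfolding continuous_on_def
proof
  fix t assume t: "t \<in> S"
  have dom: "f s \<in> pow_domain v lam e" if "s \<in> S" for s
    using f that unfolding pow_continuous_on_def by auto
  have eq: "pow_norm v lam e (f s - f t) = norm (pow_op v lam e (f s) - pow_op v lam e (f t))" if s: "s \<in> S" for s
  proof -
    have "(\<lambda>k. (lam k powr e * ((f s - f t) \<bullet> v k)) *\<^sub>R v k) sums (pow_op v lam e (f s) - pow_op v lam e (f t))"
      using sums_diff[OF pow_op_sums(1)[OF v dom[OF s]] pow_op_sums(1)[OF v dom[OF t]]]
      by (simp add: inner_diff_left right_diff_distrib scaleR_diff_left)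
    then show ?thesis unfolding pow_norm_def by (subst pow_op_def) (simp add: sums_iff)
  qed
  have "((\<lambda>s. pow_norm v lam e (f s - f t)) \<longlongrightarrow> 0) (at t within S)"
    using f t unfolding pow_continuous_on_def by auto
  moreover have "\<forall>\<^sub>F s in at t within S. pow_norm v lam e (f s - f t) =
      norm (pow_op v lam e (f s) - pow_op v lam e (f t))"
    by (simp add: eventually_at_filter eq)
  ultimately have "((\<lambda>s. norm (pow_op v lam e (f s) - pow_op v lam e (f t))) \<longlongrightarrow> 0) (at t within S)"
    by (rule Lim_transform_eventually)
  then show "((\<lambda>s. pow_op v lam e (f s)) \<longlongrightarrow> pow_op v lam e (f t)) (at t within S)"
    using Lim_null tendsto_norm_zero_iff by blast
qed

lemma continuous_on_of_scaled_coordinates: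
  fixes f F :: "real \<Rightarrow> 'a::{real_inner, banach}"
  assumes v: "orthonormal_basis v" and l0: "0 < l0" and lam: "\<And>k. l0 \<le> lam k" and e: "0 \<le> e"
    and F: "continuous_on {0..T} F"
    and Ff: "\<And>s k. \<lbrakk>0 \<le> s; s \<le> T\<rbrakk> \<Longrightarrow> F s \<bullet> v k = lam k powr e * (f s \<bullet> v k)"
  shows "continuous_on {0..T} f"
proof -
  have pos: "l0 powr e > 0" "l0 powr e \<le> lam k powr e" "lam k powr e > 0" for k
    using l0 lam[of k] e by (auto intro: powr_mono2 simp: less_le_trans[of 0 l0 "lam k"])
  have tails: "uniform_tails {0..T} (\<lambda>k s. f s \<bullet> v k)"
  proof (rule uniform_tails_dominated[OF uniform_tails_compact[OF v compact_Icc F], where B = "1 / (l0 powr e)\<^sup>2"])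
    fix n N :: nat and s assume s: "s \<in> {0..T}"
    have "(f s \<bullet> v k)\<^sup>2 \<le> 1 / (l0 powr e)\<^sup>2 * (F s \<bullet> v k)\<^sup>2" for k
    proof -
      have "(l0 powr e)\<^sup>2 * (f s \<bullet> v k)\<^sup>2 \<le> (lam k powr e)\<^sup>2 * (f s \<bullet> v k)\<^sup>2"
        using pos(2)[of k] by (intro mult_right_mono power_mono) auto
      then show ?thesis using Ff[of s k] s pos(1) by (simp add: power_mult_distrib field_simps)
    qed
    then show "\<exists>y\<in>{0..T}. (\<Sum>k=n..<N. (f s \<bullet> v k)\<^sup>2) \<le> 1 / (l0 powr e)\<^sup>2 * (\<Sum>k=n..<N. (F y \<bullet> v k)\<^sup>2)"
      unfolding sum_distrib_left using s by (intro bexI[of _ s] sum_mono) auto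
  qed
  have "continuous_on {0..T} (\<lambda>s. f s \<bullet> v k)" for k
  proof (rule continuous_on_eq)
    show "continuous_on {0..T} (\<lambda>s. (F s \<bullet> v k) / lam k powr e)"
      using pos(3)[of k] by (intro continuous_intros F) auto
    show "(F s \<bullet> v k) / lam k powr e = f s \<bullet> v k" if "s \<in> {0..T}" for s
      using Ff[of s k] that pos(3)[of k] by simp
  qed
  from orthonormal_expansion(1)[OF v tails this] show ?thesis
    by (rule continuous_on_eq) (use orthonormal_sums[OF v] in \<open>simp add: sums_iff\<close>)
qed

context fractional_data
begin

text \<open>A bound for the integral over \<open>[0, t]\<close>, \<open>t \<le> T\<close>, of the function that dominates
  \<open>lam powr (1 - \<epsilon>) * green lam\<close> for all \<open>lam\<close>; hence the constant of the part of the estimate that comes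
  from the right-hand side.\<close>

definition smoothing_const :: "real \<Rightarrow> real" where
  "smoothing_const \<epsilon> = Gamma (\<rho> 1) powr (- \<epsilon>) * Beta (\<epsilon> * \<rho> 1) 1 * T powr (\<epsilon> * \<rho> 1)"

definition initial_const :: real where
  "initial_const = (\<Sum>j=1..M. q j / Gamma (2 - \<rho> j))"

lemma smoothing_const_nonneg: "0 < \<epsilon> \<Longrightarrow> 0 \<le> smoothing_const \<epsilon>"
  unfolding smoothing_const_def Beta_def using rho1
  by (intro mult_nonneg_nonneg divide_nonneg_nonneg Gamma_real_nonneg powr_ge_zero)
    (auto intro: add_pos_pos)

lemma initial_const_term_nonneg:
  assumes "i \<in> {1..M}"
  shows "0 \<le> q i / Gamma (2 - \<rho> i)"
  using q[OF assms] rho[OF assms] by (intro divide_nonneg_nonneg Gamma_real_nonneg) auto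

lemma initial_const_nonneg: "0 \<le> initial_const"
  unfolding initial_const_def by (intro sum_nonneg initial_const_term_nonneg)

lemma relaxation_bound:
  assumes lam: "lam \<ge> 0" and t: "0 < t" "t \<le> T"
  shows "lam * relaxation lam t \<le> initial_const * (\<Sum>j=1..M. t powr (- \<rho> j))"
proof -
  have "lam * relaxation lam t \<le> (\<Sum>j=1..M. q j / Gamma (2 - \<rho> j) * t powr (- \<rho> j))"
    by (rule relaxation_decay[OF lam t])
  also have "\<dots> \<le> (\<Sum>j=1..M. initial_const * t powr (- \<rho> j))"
  proof (intro sum_mono mult_right_mono)
    fix j assume j: "j \<in> {1..M}"
    show "q j / Gamma (2 - \<rho> j) \<le> initial_const"
      unfolding initial_const_def using j initial_const_term_nonneg by (intro member_le_sum) auto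
  qed simp
  finally show ?thesis by (simp add: sum_distrib_left)
qed

lemma green_conv_abs_le:
  fixes f :: "real \<Rightarrow> real"
  assumes lam: "lam > 0" and e: "0 < \<epsilon>" "\<epsilon> < 1" and f: "continuous_on {0..T} f" and t: "0 < t" "t \<le> T"
  shows "\<bar>lam * conv (green lam) f t\<bar> \<le>
    conv (\<lambda>s. Gamma (\<rho> 1) powr (- \<epsilon>) * s powr (\<epsilon> * \<rho> 1 - 1)) (\<lambda>s. lam powr \<epsilon> * \<bar>f s\<bar>) t"
proof -
  let ?h = "\<lambda>s. Gamma (\<rho> 1) powr (- \<epsilon>) * s powr (\<epsilon> * \<rho> 1 - 1)"
  have h: "weakly_singular T ?h" unfolding weakly_singular_def
    by (intro exI[of _ "\<epsilon> * \<rho> 1"] conjI wsingI[where C = "Gamma (\<rho> 1) powr (- \<epsilon>)"])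
      (use e rho1 in \<open>auto intro!: continuous_intros\<close>)
  have af: "weakly_singular T (\<lambda>s. \<bar>f s\<bar>)"
    by (intro weakly_singular_of_continuous continuous_intros f)
  have lf: "weakly_singular T (\<lambda>s. lam powr \<epsilon> * \<bar>f s\<bar>)" by (rule weakly_singular_mult[OF af])
  have G0: "0 \<le> green lam s" if "0 < s" "s < t" for s using green_nonneg[of lam s] that lam t by auto
  have "\<bar>conv (green lam) f t\<bar> \<le> conv (\<lambda>s. \<bar>green lam s\<bar>) (\<lambda>s. \<bar>f s\<bar>) t"
    using conv_norm_le[of "green lam" f t] by simp
  also have "\<dots> = conv (green lam) (\<lambda>s. \<bar>f s\<bar>) t" by (rule conv_cong) (use G0 in auto)
  finally have "lam * \<bar>conv (green lam) f t\<bar> \<le> lam * conv (green lam) (\<lambda>s. \<bar>f s\<bar>) t"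
    using lam by (intro mult_left_mono) auto
  also have "\<dots> = conv (\<lambda>s. \<bar>f s\<bar>) (\<lambda>s. lam * green lam s) t"
    by (simp add: conv_mult_right conv_commute[of "green lam"])
  also have "\<dots> \<le> conv (\<lambda>s. \<bar>f s\<bar>) (\<lambda>s. lam powr \<epsilon> * ?h s) t"
    by (rule conv_mono[OF af weakly_singular_mult[OF ws_green] weakly_singular_mult[OF h] t])
      (use green_interpolated[OF lam _ _ e] t in auto)
  also have "\<dots> = lam powr \<epsilon> * conv ?h (\<lambda>s. \<bar>f s\<bar>) t"
    using conv_mult_right[of "\<lambda>s. \<bar>f s\<bar>" "lam powr \<epsilon>" ?h t] conv_commute[of "\<lambda>s. \<bar>f s\<bar>" ?h t]
    by simp
  also have "\<dots> = conv ?h (\<lambda>s. lam powr \<epsilon> * \<bar>f s\<bar>) t" by (simp only: conv_mult_right)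
  finally show ?thesis using lam by (simp add: abs_mult)
qed

text \<open>Minkowski's integral inequality by duality: for \<open>b k = lam k * (green (lam k) * f k) t\<close>, the sum of the
  \<open>(b k)\<^sup>2\<close> is at most the convolution of the common kernel with \<open>\<Sum>\<^sub>k \<bar>b k\<bar> * \<bar>F s \<bullet> v k\<bar>\<close>, which by
  Cauchy--Schwarz is at most \<open>R\<close> times the norm of \<open>b\<close>; one factor of that norm cancels. It is essential that
  the kernel does not depend on \<open>k\<close>.\<close>

lemma green_conv_sum_squares_le:
  fixes v :: "nat \<Rightarrow> 'a::real_inner"
  assumes lam: "\<And>k. lam k > 0" and e: "0 < \<epsilon>" "\<epsilon> < 1" and F: "continuous_on {0..T} F"
    and f: "\<And>k s. \<lbrakk>0 \<le> s; s \<le> T\<rbrakk> \<Longrightarrow> F s \<bullet> v k = lam k powr \<epsilon> * f k s" and t: "0 \<le> t" "t \<le> T"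
    and J: "finite J" and R: "R \<ge> 0" "\<And>s. \<lbrakk>0 \<le> s; s \<le> T\<rbrakk> \<Longrightarrow> (\<Sum>k\<in>J. (F s \<bullet> v k)\<^sup>2) \<le> R\<^sup>2"
  shows "(\<Sum>k\<in>J. (lam k * conv (green (lam k)) (f k) t)\<^sup>2) \<le> (smoothing_const \<epsilon> * R)\<^sup>2"
proof (cases "t = 0")
  case False
  then have t': "0 < t" "t \<le> T" using t by auto
  let ?h = "\<lambda>s. Gamma (\<rho> 1) powr (- \<epsilon>) * s powr (\<epsilon> * \<rho> 1 - 1)"
  define b where "b k = lam k * conv (green (lam k)) (f k) t" for k
  define B where "B = L2_set b J"
  have B0: "B \<ge> 0" by (simp add: B_def L2_set_nonneg)
  have er: "\<epsilon> * \<rho> 1 > 0" using e rho1 by simp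
  have hb: "\<bar>?h s\<bar> \<le> Gamma (\<rho> 1) powr (- \<epsilon>) * s powr (\<epsilon> * \<rho> 1 - 1)" for s by simp
  have h: "weakly_singular T ?h" unfolding weakly_singular_def
    by (intro exI[of _ "\<epsilon> * \<rho> 1"] conjI wsingI[OF _ hb[unfolded real_norm_def[symmetric]]])
      (use er in \<open>auto intro!: continuous_intros\<close>)
  have Fk: "continuous_on {0..T} (\<lambda>s. F s \<bullet> v k)" for k by (intro continuous_intros F)
  have fk: "continuous_on {0..T} (f k)" for k
  proof (rule continuous_on_eq)
    show "continuous_on {0..T} (\<lambda>s. lam k powr (- \<epsilon>) * (F s \<bullet> v k))" by (intro continuous_intros F)
    show "lam k powr (- \<epsilon>) * (F s \<bullet> v k) = f k s" if "s \<in> {0..T}" for s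
      using f[of s k] that lam[of k] by (simp add: powr_minus)
  qed
  have ws: "weakly_singular T (\<lambda>s. \<bar>b k\<bar> * \<bar>F s \<bullet> v k\<bar>)" for k
    by (intro weakly_singular_of_continuous continuous_intros F)
  have "B\<^sup>2 = (\<Sum>k\<in>J. \<bar>b k\<bar> * \<bar>b k\<bar>)"
    by (simp add: B_def L2_set_def sum_nonneg power2_eq_square abs_mult_self_eq)
  also have "\<dots> \<le> (\<Sum>k\<in>J. conv ?h (\<lambda>s. \<bar>b k\<bar> * \<bar>F s \<bullet> v k\<bar>) t)"
  proof (rule sum_mono)
    fix k
    have "\<bar>b k\<bar> \<le> conv ?h (\<lambda>s. lam k powr \<epsilon> * \<bar>f k s\<bar>) t"
      unfolding b_def by (rule green_conv_abs_le[OF lam e fk t'])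
    also have "\<dots> = conv ?h (\<lambda>s. \<bar>F s \<bullet> v k\<bar>) t"
      by (rule conv_cong) (use f t lam in \<open>auto simp: abs_mult\<close>)
    finally have "\<bar>b k\<bar> * \<bar>b k\<bar> \<le> \<bar>b k\<bar> * conv ?h (\<lambda>s. \<bar>F s \<bullet> v k\<bar>) t"
      by (intro mult_left_mono) auto
    then show "\<bar>b k\<bar> * \<bar>b k\<bar> \<le> conv ?h (\<lambda>s. \<bar>b k\<bar> * \<bar>F s \<bullet> v k\<bar>) t" by (simp only: conv_mult_right)
  qed
  also have "\<dots> = conv ?h (\<lambda>s. \<Sum>k\<in>J. \<bar>b k\<bar> * \<bar>F s \<bullet> v k\<bar>) t"
    by (rule conv_sum_right[OF ws h t', symmetric])
  also have "\<dots> \<le> conv ?h (\<lambda>_. B * R) t"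
  proof (rule conv_mono[OF h weakly_singular_sum[OF ws] ws_const t'])
    fix s assume s: "0 < s" "s < t"
    have "(\<Sum>k\<in>J. \<bar>b k\<bar> * \<bar>F s \<bullet> v k\<bar>) \<le> L2_set b J * L2_set (\<lambda>k. F s \<bullet> v k) J"
      by (rule L2_set_mult_ineq)
    also have "\<dots> \<le> B * R"
      unfolding B_def using R s t
      by (intro mult_left_mono L2_set_nonneg) (auto simp: L2_set_def real_sqrt_le_iff intro!: real_le_lsqrt sum_nonneg)
    finally show "(\<Sum>k\<in>J. \<bar>b k\<bar> * \<bar>F s \<bullet> v k\<bar>) \<le> B * R" .
  qed simp
  also have "\<dots> \<le> Gamma (\<rho> 1) powr (- \<epsilon>) * (B * R) * Beta (\<epsilon> * \<rho> 1) 1 * t powr (\<epsilon> * \<rho> 1 + 1 - 1)"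
    by (rule order_trans[OF abs_ge_self], unfold real_norm_def[symmetric], rule norm_conv_le[OF er _ hb _ t'])
      (use B0 R(1) in auto)
  also have "\<dots> \<le> Gamma (\<rho> 1) powr (- \<epsilon>) * (B * R) * Beta (\<epsilon> * \<rho> 1) 1 * T powr (\<epsilon> * \<rho> 1)"
    using t' er B0 R(1) rho1 by (intro mult_left_mono) (auto simp: Beta_def Gamma_real_nonneg intro!: powr_mono2)
  also have "\<dots> = B * (smoothing_const \<epsilon> * R)" by (simp add: smoothing_const_def mult_ac)
  finally have "B * B \<le> B * (smoothing_const \<epsilon> * R)" by (simp add: power2_eq_square)
  then have "B \<le> smoothing_const \<epsilon> * R"
    using B0 smoothing_const_nonneg[OF e(1)] R(1) by (cases "B = 0") auto
  then have "B\<^sup>2 \<le> (smoothing_const \<epsilon> * R)\<^sup>2" using B0 by (rule power_mono)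
  then show ?thesis by (simp add: B_def L2_set_def sum_nonneg b_def)
qed simp

text \<open>The integrand \<open>p\<close> is determined by the Volterra equation with the kernel \<open>lower_kernel\<close>, in which
  \<open>lam * y\<close> counts as given. The integrand \<open>w\<close> obtained from \<open>green_conv\<close> for the data \<open>f - lam * c\<close> solves the
  same equation, so the two agree. The point is that \<open>p\<close> can be taken as a coordinate of a vector-valued
  function, since its equation does not involve \<open>lam\<close> except through \<open>lam * y\<close>.\<close>

lemma mode_integral_equation:
  fixes f :: "real \<Rightarrow> real"
  assumes f: "continuous_on {0..T} f"
    and y: "\<And>t. \<lbrakk>0 \<le> t; t \<le> T\<rbrakk> \<Longrightarrow> y t = c * relaxation lam t + conv (green lam) f t"
    and p: "weakly_singular T p"
    and eq: "\<And>t. \<lbrakk>0 < t; t \<le> T\<rbrakk> \<Longrightarrow> p t + conv lower_kernel p t = f t - lam * y t"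
    and t: "0 \<le> t" "t \<le> T"
  shows "y t = c + conv (frac_kernel (\<rho> 1)) p t"
proof -
  define r where "r s = f s - lam * c" for s
  have wf: "weakly_singular T f" by (rule weakly_singular_of_continuous[OF f])
  have "wsing T 1 r" unfolding r_def by (intro wsing_of_continuous continuous_intros f)
  from green_conv[OF this, of lam] obtain w where w: "weakly_singular T w"
    "\<forall>t\<in>{0<..T}. w t + conv (full_kernel lam) w t = r t"
    "\<forall>t\<in>{0..T}. conv (green lam) r t = conv (frac_kernel (\<rho> 1)) w t"
    by (elim exE conjE)
  have g: "weakly_singular T (frac_kernel (\<rho> 1))" using rho1 by (intro ws_frac)
  have yw: "conv (frac_kernel (\<rho> 1)) w s = y s - c" if s: "0 < s" "s \<le> T" for s
  proof -
    have "conv (frac_kernel (\<rho> 1)) w s = conv (green lam) r s" using w(3) s by simp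
    also have "\<dots> = conv (green lam) f s - conv (green lam) (\<lambda>_. lam * c * 1) s"
      unfolding r_def using conv_diff_right[OF ws_green wf ws_const[of "lam * c"] s] by simp
    also have "conv (green lam) (\<lambda>_. lam * c * 1) s = lam * c * conv (\<lambda>_. 1) (green lam) s"
      unfolding conv_mult_right by (simp add: conv_commute[of "green lam"])
    finally show ?thesis using y[of s] s by (simp add: relaxation_def algebra_simps)
  qed
  have pw: "p s = w s" if s: "0 < s" "s \<le> T" for s
  proof -
    have "p s - w s = 0"
    proof (rule volterra_unique[OF ws_lower weakly_singular_diff[OF p w(1)] _ s])
      fix s assume s: "0 < s" "s \<le> T"
      have "conv (full_kernel lam) w s = conv lower_kernel w s + lam * conv (frac_kernel (\<rho> 1)) w s"
        using conv_add_left[OF ws_lower weakly_singular_mult[OF g, of lam] w(1) s]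
        by (simp add: full_kernel_def[abs_def] conv_mult_left)
      moreover have "w s + conv (full_kernel lam) w s = f s - lam * c" using w(2) s by (simp add: r_def)
      ultimately have "w s + conv lower_kernel w s = f s - lam * y s"
        unfolding yw[OF s] by (simp add: right_diff_distrib)
      then show "p s - w s + conv lower_kernel (\<lambda>s. p s - w s) s = 0"
        using conv_diff_right[OF ws_lower p w(1) s] eq[OF s] by simp
    qed
    then show ?thesis by simp
  qed
  show ?thesis
  proof (cases "t = 0")
    case True
    then show ?thesis using y[of 0] T by (simp add: relaxation_def)
  next
    case False
    have "conv (frac_kernel (\<rho> 1)) p t = conv (frac_kernel (\<rho> 1)) w t"
      by (rule conv_cong) (use pw t in auto)
    then show ?thesis using yw[of t] False t by simp
  qed
qed

text \<open>Each block of coefficients is compared with the same block of \<open>F\<close> at the time where it is largest.\<close>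

lemma uniform_tails_green_conv:
  fixes v :: "nat \<Rightarrow> 'a::real_inner"
  assumes v: "orthonormal_basis v" and lam: "\<And>k. lam k > 0" and e: "0 < \<epsilon>" "\<epsilon> < 1"
    and F: "continuous_on {0..T} F"
    and f: "\<And>k s. \<lbrakk>0 \<le> s; s \<le> T\<rbrakk> \<Longrightarrow> F s \<bullet> v k = lam k powr \<epsilon> * f k s"
  shows "uniform_tails {0..T} (\<lambda>k t. lam k * conv (green (lam k)) (f k) t)"
proof (rule uniform_tails_dominated[OF uniform_tails_compact[OF v compact_Icc F],
      where B = "(smoothing_const \<epsilon>)\<^sup>2"])
  fix n N :: nat and t assume t: "t \<in> {0..T}"
  let ?g = "\<lambda>s. \<Sum>k=n..<N. (F s \<bullet> v k)\<^sup>2"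
  have "\<exists>y\<in>{0..T}. \<forall>s\<in>{0..T}. ?g s \<le> ?g y"
    by (rule continuous_attains_sup) (use T in \<open>auto intro!: continuous_intros F\<close>)
  then obtain y where y: "y \<in> {0..T}" "\<And>s. s \<in> {0..T} \<Longrightarrow> ?g s \<le> ?g y" by blast
  have g0: "0 \<le> ?g y" by (intro sum_nonneg) auto
  have "(\<Sum>k=n..<N. (lam k * conv (green (lam k)) (f k) t)\<^sup>2) \<le> (smoothing_const \<epsilon> * sqrt (?g y))\<^sup>2"
    by (rule green_conv_sum_squares_le[OF lam e F f]) (use t y g0 in auto)
  also have "\<dots> = (smoothing_const \<epsilon>)\<^sup>2 * ?g y" using g0 by (simp add: power_mult_distrib)
  finally show "\<exists>y\<in>{0..T}. (\<Sum>k=n..<N. (lam k * conv (green (lam k)) (f k) t)\<^sup>2)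
      \<le> (smoothing_const \<epsilon>)\<^sup>2 * ?g y" using y(1) by blast
qed

lemma powr_sum_antimono:
  assumes "0 < d" "d \<le> t"
  shows "(\<Sum>j=1..M. t powr (- \<rho> j)) \<le> (\<Sum>j=1..M. d powr (- \<rho> j))"
  by (intro sum_mono powr_mono2') (use assms rho in \<open>auto intro: less_imp_le\<close>)

lemma ws_powr_sum: "weakly_singular T (\<lambda>t. \<Sum>j=1..M. t powr (- \<rho> j))"
proof (intro weakly_singular_sum)
  fix j assume j: "j \<in> {1..M}"
  have "wsing T (1 - \<rho> j) (\<lambda>t. t powr (- \<rho> j))"
    by (rule wsingI[where C = 1]) (auto intro!: continuous_intros)
  then show "weakly_singular T (\<lambda>t. t powr (- \<rho> j))"
    unfolding weakly_singular_def using rho[OF j] by (intro exI[of _ "1 - \<rho> j"]) auto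
qed

text \<open>The solution is \<open>u = \<Sum>\<^sub>k (\<langle>\<phi>, v k\<rangle> * relaxation (lam k) + green (lam k) * \<langle>f, v k\<rangle>) v k\<close>, and \<open>V\<close> is
  the series with the coefficients of \<open>u\<close> multiplied by \<open>lam k\<close>. The uniform estimates make both series
  continuous, the second one only for \<open>t > 0\<close>. The Caputo derivatives of \<open>u\<close> are not computed term by term: the vector-valued Volterra equation
  \<open>w + lower_kernel * w = f - V\<close> is solved, and comparison of coordinates shows that \<open>u - \<phi>\<close> is the
  fractional integral of order \<open>\<rho> 1\<close> of \<open>w\<close>.\<close>

lemma spectral_solution:
  fixes v :: "nat \<Rightarrow> 'a::{real_inner, banach, second_countable_topology}"
  assumes v: "orthonormal_basis v" and l0: "0 < l0" "\<And>k. l0 \<le> lam k" and e: "0 < \<epsilon>" "\<epsilon> < 1"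
    and F: "continuous_on {0..T} F" and f: "continuous_on {0..T} f"
    and Ff: "\<And>k s. \<lbrakk>0 \<le> s; s \<le> T\<rbrakk> \<Longrightarrow> F s \<bullet> v k = lam k powr \<epsilon> * (f s \<bullet> v k)"
    and S: "S \<ge> 0" "\<And>s. \<lbrakk>0 \<le> s; s \<le> T\<rbrakk> \<Longrightarrow> norm (F s) \<le> S"
  shows "\<exists>u V. continuous_on {0..T} u \<and> u 0 = \<phi> \<and>
    (\<forall>t\<in>{0<..T}. (\<forall>k. V t \<bullet> v k = lam k * (u t \<bullet> v k)) \<and>
       norm (V t) \<le> initial_const * (\<Sum>j=1..M. t powr (- \<rho> j)) * norm \<phi> + smoothing_const \<epsilon> * S) \<and>
    (\<forall>t\<in>{0<..<T}. \<exists>d. (\<forall>j\<in>{1..M}. has_caputo_derivative (\<rho> j) u (d j) t) \<and>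
       (\<Sum>j=1..M. q j *\<^sub>R d j) + V t = f t)"
proof -
  have lam: "lam k > 0" for k using l0(1) l0(2)[of k] by linarith
  have lam0: "lam k \<ge> 0" for k using lam[of k] by simp
  define E where "E k t = relaxation (lam k) t" for k t
  define \<sigma> where "\<sigma> t = (\<Sum>j=1..M. t powr (- \<rho> j))" for t
  define b where "b k t = conv (green (lam k)) (\<lambda>s. f s \<bullet> v k) t" for k t
  define U1 where "U1 t = (\<Sum>k. ((\<phi> \<bullet> v k) * E k t) *\<^sub>R v k)" for t
  define V1 where "V1 t = (\<Sum>k. (lam k * ((\<phi> \<bullet> v k) * E k t)) *\<^sub>R v k)" for t
  define U2 where "U2 t = (\<Sum>k. b k t *\<^sub>R v k)" for t
  define V2 where "V2 t = (\<Sum>k. (lam k * b k t) *\<^sub>R v k)" for t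
  have \<sigma>0: "0 \<le> \<sigma> t" for t unfolding \<sigma>_def by (intro sum_nonneg) auto
  have fk: "continuous_on {0..T} (\<lambda>s. f s \<bullet> v k)" for k by (intro continuous_intros f)
  have contE: "continuous_on {0..T} (E k)" for k
    using relaxation_continuous unfolding E_def[abs_def] .
  have contb: "continuous_on {0..T} (b k)" for k
    unfolding b_def[abs_def] by (intro green_conv_continuous wsing_of_continuous fk)
  have E01: "0 \<le> E k t" "E k t \<le> 1" if "0 \<le> t" "t \<le> T" for k t
    using relaxation_nonneg[OF lam0, of t k] relaxation_le_1[OF lam0, of t k] that
    by (cases "t = 0"; simp add: E_def relaxation_def)+
  have Elam: "lam k * E k t \<le> initial_const * \<sigma> t" "0 \<le> lam k * E k t" if "0 < t" "t \<le> T" for k t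
    using relaxation_bound[OF lam0 that] E01[of t k] lam0[of k] that by (auto simp: E_def \<sigma>_def)
  have sqV1: "(lam k * ((\<phi> \<bullet> v k) * E k t))\<^sup>2 \<le> (initial_const * \<sigma> t)\<^sup>2 * (\<phi> \<bullet> v k)\<^sup>2" if "0 < t" "t \<le> T" for k t
  proof -
    have "(lam k * E k t)\<^sup>2 * (\<phi> \<bullet> v k)\<^sup>2 \<le> (initial_const * \<sigma> t)\<^sup>2 * (\<phi> \<bullet> v k)\<^sup>2"
      by (intro mult_right_mono power_mono Elam that) auto
    then show ?thesis by (simp add: power_mult_distrib mult_ac)
  qed
  have tU1: "uniform_tails {0..T} (\<lambda>k t. (\<phi> \<bullet> v k) * E k t)"
  proof (rule uniform_tails_dominated[OF uniform_tails_const[OF v, of "{0..T}" \<phi>], where B = 1])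
    fix n N :: nat and t assume t: "t \<in> {0..T}"
    have "((\<phi> \<bullet> v k) * E k t)\<^sup>2 \<le> (\<phi> \<bullet> v k)\<^sup>2" for k
    proof -
      have "(\<phi> \<bullet> v k)\<^sup>2 * (E k t)\<^sup>2 \<le> (\<phi> \<bullet> v k)\<^sup>2 * 1"
        using E01[of t k] t by (intro mult_left_mono power_le_one) auto
      then show ?thesis by (simp add: power_mult_distrib)
    qed
    then show "\<exists>y\<in>{0..T}. (\<Sum>k=n..<N. ((\<phi> \<bullet> v k) * E k t)\<^sup>2) \<le> 1 * (\<Sum>k=n..<N. (\<phi> \<bullet> v k)\<^sup>2)"
      using t by (auto intro!: bexI[of _ t] sum_mono)
  qed
  have cU1: "continuous_on {0..T} (\<lambda>t. (\<phi> \<bullet> v k) * E k t)" for k by (intro continuous_intros contE)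
  note eU1 = orthonormal_expansion[OF v tU1 cU1, folded U1_def]
  have tV2: "uniform_tails {0..T} (\<lambda>k t. lam k * b k t)"
    unfolding b_def by (rule uniform_tails_green_conv[OF v lam e F Ff])
  have cV2: "continuous_on {0..T} (\<lambda>t. lam k * b k t)" for k by (intro continuous_intros contb)
  note eV2 = orthonormal_expansion[OF v tV2 cV2, folded V2_def]
  have tU2: "uniform_tails {0..T} b"
  proof (rule uniform_tails_dominated[OF tV2, where B = "1 / l0\<^sup>2"])
    fix n N :: nat and t assume t: "t \<in> {0..T}"
    have "(b k t)\<^sup>2 \<le> 1 / l0\<^sup>2 * (lam k * b k t)\<^sup>2" for k
    proof -
      have "l0\<^sup>2 * (b k t)\<^sup>2 \<le> (lam k)\<^sup>2 * (b k t)\<^sup>2"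
        using l0 by (intro mult_right_mono power_mono) (auto intro: less_imp_le)
      then show ?thesis using l0(1) by (simp add: power_mult_distrib field_simps)
    qed
    then show "\<exists>y\<in>{0..T}. (\<Sum>k=n..<N. (b k t)\<^sup>2) \<le> 1 / l0\<^sup>2 * (\<Sum>k=n..<N. (lam k * b k y)\<^sup>2)"
      unfolding sum_distrib_left using t by (intro bexI[of _ t] sum_mono) auto
  qed
  note eU2 = orthonormal_expansion[OF v tU2 contb, folded U2_def]
  have tV1: "uniform_tails {d..T} (\<lambda>k t. lam k * ((\<phi> \<bullet> v k) * E k t))" if d: "0 < d" for d
  proof (rule uniform_tails_dominated[OF uniform_tails_const[OF v, of "{d..T}" \<phi>], where B = "(initial_const * \<sigma> d)\<^sup>2"])
    fix n N :: nat and t assume t: "t \<in> {d..T}"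
    have le: "(lam k * ((\<phi> \<bullet> v k) * E k t))\<^sup>2 \<le> (initial_const * \<sigma> d)\<^sup>2 * (\<phi> \<bullet> v k)\<^sup>2" for k
    proof -
      have "(initial_const * \<sigma> t)\<^sup>2 * (\<phi> \<bullet> v k)\<^sup>2 \<le> (initial_const * \<sigma> d)\<^sup>2 * (\<phi> \<bullet> v k)\<^sup>2"
        using powr_sum_antimono[OF d, of t] t initial_const_nonneg \<sigma>0[of t]
        by (intro mult_right_mono power_mono mult_left_mono) (auto simp: \<sigma>_def)
      then show ?thesis using sqV1[of t k] t d by auto
    qed
    show "\<exists>y\<in>{d..T}. (\<Sum>k=n..<N. (lam k * ((\<phi> \<bullet> v k) * E k t))\<^sup>2) \<le>
        (initial_const * \<sigma> d)\<^sup>2 * (\<Sum>k=n..<N. (\<phi> \<bullet> v k)\<^sup>2)"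
      unfolding sum_distrib_left using t le by (intro bexI[of _ t] sum_mono) auto
  qed
  have cV1: "continuous_on {d..T} (\<lambda>t. lam k * ((\<phi> \<bullet> v k) * E k t))" if "0 < d" for d k
    by (intro continuous_intros continuous_on_subset[OF contE]) (use that in auto)
  note eV1 = orthonormal_expansion[OF v tV1 cV1, folded V1_def]
  define u where "u t = U1 t + U2 t" for t
  define V where "V t = V1 t + V2 t" for t
  have contu: "continuous_on {0..T} u" unfolding u_def by (intro continuous_intros eU1(1) eU2(1))
  have uk: "u t \<bullet> v k = (\<phi> \<bullet> v k) * E k t + b k t" if "0 \<le> t" "t \<le> T" for t k
    using eU1(3)[of t k] eU2(3)[of t k] that by (simp add: u_def inner_add_left)
  have u0: "u 0 = \<phi>"
    by (rule orthonormal_basis_eqI[OF v]) (use uk[of 0] T in \<open>simp add: E_def relaxation_def b_def\<close>)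
  have Vk: "V t \<bullet> v k = lam k * (u t \<bullet> v k)" if "0 < t" "t \<le> T" for t k
    using eV1(3)[of t t k] eV2(3)[of t k] uk[of t k] that
    by (simp add: V_def inner_add_left distrib_left)
  have contV: "continuous_on {0<..T} V"
  proof -
    have "continuous_on {0<..T} V1" by (rule continuous_on_Ioc_of_Icc) (rule eV1(1))
    moreover have "continuous_on {0<..T} V2" by (rule continuous_on_subset[OF eV2(1)]) auto
    ultimately show ?thesis unfolding V_def by (intro continuous_intros)
  qed
  have Vnorm: "norm (V t) \<le> initial_const * \<sigma> t * norm \<phi> + smoothing_const \<epsilon> * S" if t: "0 < t" "t \<le> T" for t
  proof -
    have "norm (V1 t) \<le> initial_const * \<sigma> t * norm \<phi>"
    proof (rule norm_orthonormal_expansion_le[OF v eV1(2)[of t]])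
      fix N
      have "(\<Sum>k<N. (lam k * ((\<phi> \<bullet> v k) * E k t))\<^sup>2) \<le> (\<Sum>k<N. (initial_const * \<sigma> t)\<^sup>2 * (\<phi> \<bullet> v k)\<^sup>2)"
        by (intro sum_mono sqV1 t)
      also have "\<dots> = (initial_const * \<sigma> t)\<^sup>2 * (\<Sum>k<N. (\<phi> \<bullet> v k)\<^sup>2)" by (simp add: sum_distrib_left)
      also have "\<dots> \<le> (initial_const * \<sigma> t)\<^sup>2 * (norm \<phi>)\<^sup>2"
        by (intro mult_left_mono bessel_inequality[OF v]) auto
      finally show "(\<Sum>k<N. (lam k * ((\<phi> \<bullet> v k) * E k t))\<^sup>2) \<le> (initial_const * \<sigma> t * norm \<phi>)\<^sup>2"
        by (simp add: power_mult_distrib)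
    qed (use t initial_const_nonneg \<sigma>0 in auto)
    moreover have "norm (V2 t) \<le> smoothing_const \<epsilon> * S"
    proof (rule norm_orthonormal_expansion_le[OF v eV2(2)[of t]])
      show "(\<Sum>k<N. (lam k * b k t)\<^sup>2) \<le> (smoothing_const \<epsilon> * S)\<^sup>2" for N
        unfolding b_def
      proof (rule green_conv_sum_squares_le[OF lam e F Ff])
        show "(\<Sum>k<N. (F s \<bullet> v k)\<^sup>2) \<le> S\<^sup>2" if "0 \<le> s" "s \<le> T" for s
          using bessel_inequality[OF v, of "{..<N}" "F s"] power_mono[OF S(2)[OF that], of 2] by simp
      qed (use t S in auto)
    qed (use t smoothing_const_nonneg[OF e(1)] S(1) in auto)
    ultimately show ?thesis unfolding V_def by (intro order_trans[OF norm_triangle_ineq add_mono])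
  qed
  define W where "W t = f t - V t" for t
  have "weakly_singular T W"
  proof (rule weakly_singular_dominated)
    show "continuous_on {0<..T} W"
      unfolding W_def by (intro continuous_intros contV continuous_on_subset[OF f]) auto
    show "weakly_singular T (\<lambda>t. norm (f t) + ((initial_const * norm \<phi>) * \<sigma> t + smoothing_const \<epsilon> * S))"
      unfolding \<sigma>_def
      by (intro weakly_singular_add weakly_singular_mult ws_powr_sum ws_const weakly_singular_norm)
        (use wsing_of_continuous[OF f] in \<open>auto simp: weakly_singular_def intro!: exI[of _ 1]\<close>)
    show "norm (W t) \<le> norm (f t) + ((initial_const * norm \<phi>) * \<sigma> t + smoothing_const \<epsilon> * S)"
      if "0 < t" "t \<le> T" for t
      unfolding W_def
      by (rule order_trans[OF norm_triangle_ineq4]) (use Vnorm[OF that] in \<open>simp add: mult_ac\<close>)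
  qed
  then obtain a where a: "a > 0" "wsing T a W" unfolding weakly_singular_def by auto
  obtain w where w: "wsing T a w" "\<forall>t\<in>{0<..T}. w t + conv lower_kernel w t = W t"
    using volterra_exists[OF ws_lower a(2,1) T] by (elim exE conjE)
  have ww: "weakly_singular T w" using w(1) a(1) unfolding weakly_singular_def by auto
  have g: "weakly_singular T (frac_kernel (\<rho> 1))" using rho1 by (intro ws_frac)
  have uw: "u t = \<phi> + conv (frac_kernel (\<rho> 1)) w t" if t: "0 \<le> t" "t \<le> T" for t
  proof (rule orthonormal_basis_eqI[OF v])
    fix k
    have "u t \<bullet> v k = (\<phi> \<bullet> v k) + conv (frac_kernel (\<rho> 1)) (\<lambda>s. w s \<bullet> v k) t"
    proof (rule mode_integral_equation[OF fk, where lam = "lam k"])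
      show "u s \<bullet> v k = (\<phi> \<bullet> v k) * relaxation (lam k) s + conv (green (lam k)) (\<lambda>s. f s \<bullet> v k) s"
        if "0 \<le> s" "s \<le> T" for s using uk[OF that] by (simp add: E_def b_def)
      show "weakly_singular T (\<lambda>s. w s \<bullet> v k)" by (rule weakly_singular_inner[OF ww])
      fix s assume s: "0 < s" "s \<le> T"
      have "(w s + conv lower_kernel w s) \<bullet> v k = W s \<bullet> v k" using w(2) s by simp
      then show "w s \<bullet> v k + conv lower_kernel (\<lambda>s. w s \<bullet> v k) s = f s \<bullet> v k - lam k * (u s \<bullet> v k)"
        using conv_inner[OF ws_lower ww s, of "v k"] Vk[OF s]
        by (simp add: inner_add_left W_def inner_diff_left)
    qed (use t in auto)
    then show "u t \<bullet> v k = (\<phi> + conv (frac_kernel (\<rho> 1)) w t) \<bullet> v k"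
      using conv_inner[OF g ww, of t "v k"] t by (cases "t = 0") (auto simp: inner_add_left)
  qed
  have "\<exists>d. (\<forall>j\<in>{1..M}. has_caputo_derivative (\<rho> j) u (d j) t) \<and> (\<Sum>j=1..M. q j *\<^sub>R d j) + V t = f t"
    if t: "0 < t" "t < T" for t
  proof -
    have "\<exists>d. (\<forall>j\<in>{1..M}. has_caputo_derivative (\<rho> j) u (d j) t) \<and>
        (\<Sum>j=1..M. q j *\<^sub>R d j) = w t + conv lower_kernel w t"
      by (rule caputo_sum_of_frac_integral[OF ww contu uw t])
    then obtain d where "\<forall>j\<in>{1..M}. has_caputo_derivative (\<rho> j) u (d j) t"
      "(\<Sum>j=1..M. q j *\<^sub>R d j) = w t + conv lower_kernel w t"
      by (elim exE conjE)
    then show ?thesis using w(2) t by (intro exI[of _ d]) (auto simp: W_def)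
  qed
  then show ?thesis
    using contu u0 Vk Vnorm unfolding \<sigma>_def by (intro exI[of _ u] exI[of _ V]) auto
qed

text \<open>The coordinates of the difference of two solutions satisfy a homogeneous equation; the comparison
  principle in both directions makes them vanish on \<open>[0, T)\<close>, and continuity at \<open>T\<close>.\<close>

lemma solution_unique:
  fixes w u :: "real \<Rightarrow> 'a::{real_inner, banach}"
  assumes v: "orthonormal_basis v" and lam: "\<And>k. lam k > 0"
    and A: "\<And>x k. x \<in> D \<Longrightarrow> A x \<bullet> v k = lam k * (x \<bullet> v k)"
    and w: "is_solution D A M \<rho> q T f \<phi> w" and u: "is_solution D A M \<rho> q T f \<phi> u" and t: "t \<in> {0..T}"
  shows "w t = u t"
proof -
  have one_sided: "0 \<le> (w s - u s) \<bullet> v k"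
    if w: "is_solution D A M \<rho> q T f \<phi> w" and u: "is_solution D A M \<rho> q T f \<phi> u" and s: "0 \<le> s" "s < T"
    for w u s k
  proof (rule caputo_comparison[where lam = "lam k" and T = T, OF _ _ _ M rho q _ s])
    show "continuous_on {0..T} (\<lambda>s. (w s - u s) \<bullet> v k)"
      using w u unfolding is_solution_def by (intro continuous_intros) auto
    show "0 \<le> (w 0 - u 0) \<bullet> v k" using w u unfolding is_solution_def by simp
    show "0 \<le> lam k" using lam[of k] by simp
    fix r assume r: "0 < r" "r < T"
    obtain d where d: "\<forall>j\<in>{1..M}. has_caputo_derivative (\<rho> j) w (d j) r"
      "(\<Sum>j=1..M. q j *\<^sub>R d j) + A (w r) = f r" "w r \<in> D"
      using w r unfolding is_solution_def by (meson greaterThanLessThan_iff)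
    obtain d' where d': "\<forall>j\<in>{1..M}. has_caputo_derivative (\<rho> j) u (d' j) r"
      "(\<Sum>j=1..M. q j *\<^sub>R d' j) + A (u r) = f r" "u r \<in> D"
      using u r unfolding is_solution_def by (meson greaterThanLessThan_iff)
    have "has_caputo_derivative (\<rho> j) (\<lambda>s. (w s - u s) \<bullet> v k) ((d j - d' j) \<bullet> v k) r" if "j \<in> {1..M}" for j
      by (rule has_caputo_derivative_linear[OF bounded_linear_inner_left
            has_caputo_derivative_diff[OF d(1)[rule_format, OF that] d'(1)[rule_format, OF that]]])
    moreover have "(\<Sum>j=1..M. q j * ((d j - d' j) \<bullet> v k)) + lam k * ((w r - u r) \<bullet> v k) = 0"
    proof -
      have "((\<Sum>j=1..M. q j *\<^sub>R d j) + A (w r)) \<bullet> v k - ((\<Sum>j=1..M. q j *\<^sub>R d' j) + A (u r)) \<bullet> v k = 0"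
        using d(2) d'(2) by simp
      then show ?thesis
        by (simp add: inner_add_left inner_diff_left inner_sum_left A d(3) d'(3)
            sum_subtractf right_diff_distrib)
    qed
    ultimately show "\<exists>d. (\<forall>j\<in>{1..M}. has_caputo_derivative (\<rho> j) (\<lambda>s. (w s - u s) \<bullet> v k) (d j) r) \<and>
        0 \<le> (\<Sum>j=1..M. q j * d j) + lam k * ((w r - u r) \<bullet> v k)"
      by (intro exI[of _ "\<lambda>j. (d j - d' j) \<bullet> v k"]) auto
  qed
  have eq: "w s - u s = 0" if s: "s \<in> {0..<T}" for s
  proof (rule orthonormal_basis_eqI[OF v])
    show "(w s - u s) \<bullet> v k = 0 \<bullet> v k" for k
      using one_sided[OF w u, of s k] one_sided[OF u w, of s k] s by (auto simp: inner_diff_left)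
  qed
  have "closure {0..<T} \<subseteq> {s \<in> {0..T}. w s - u s \<in> {0}}"
  proof (rule closure_minimal)
    show "closed {s \<in> {0..T}. w s - u s \<in> {0}}"
      using w u unfolding is_solution_def
      by (intro continuous_closed_preimage[unfolded vimage_def Int_def, simplified] continuous_intros) auto
  qed (use eq in auto)
  then show ?thesis using t T by auto
qed

end

section \<open>Well-posedness of the forward problem\<close>

theorem theorem3p1:
  fixes D :: "'a::{real_inner, banach, second_countable_topology} set"
    and A :: "'a \<Rightarrow> 'a" and v :: "nat \<Rightarrow> 'a" and lam :: "nat \<Rightarrow> real"
    and M :: nat and \<rho> q :: "nat \<Rightarrow> real" and T \<epsilon> :: real
  assumes "self_adjoint_operator D A" and "positive_operator D A" and "compact_inverse D A"
    and "eigen_system D A v lam"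
    and "T > 0" and "M \<ge> 1"
    and "0 < \<rho> M" and "\<rho> 1 < 1"
    and "\<forall>i\<in>{1..M}. \<forall>j\<in>{1..M}. i < j \<longrightarrow> \<rho> j < \<rho> i"
    and "\<forall>j\<in>{1..M}. q j > 0" and "q 1 = 1"
    and "0 < \<epsilon>" and "\<epsilon> < 1"
  shows "\<exists>C. \<forall>\<phi> f. pow_continuous_on v lam \<epsilon> {0..T} f \<longrightarrow>
     (\<exists>u. is_solution D A M \<rho> q T f \<phi> u \<and>
          (\<forall>w. is_solution D A M \<rho> q T f \<phi> w \<longrightarrow> (\<forall>t\<in>{0..T}. w t = u t)) \<and>
          (\<forall>t\<in>{0<..T}. u t \<in> D \<and>
             pow_norm v lam 1 (u t) \<le>
               C * (norm \<phi> * (\<Sum>j=1..M. t powr (- \<rho> j)) +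
                    (SUP s\<in>{0..T}. pow_norm v lam \<epsilon> (f s)))))"
proof -
  have v: "orthonormal_basis v" and l0: "0 < lam 0"
    using assms(4) unfolding eigen_system_def orthonormal_basis_def by auto
  have "mono lam" using assms(4) unfolding eigen_system_def by auto
  then have lam: "lam 0 \<le> lam k" for k by (simp add: monoD)
  then have lam0: "0 < lam k" for k using l0 order_less_le_trans by blast
  interpret fractional_data M \<rho> q T
  proof
    fix j assume j: "j \<in> {1..M}"
    have "\<rho> M \<le> \<rho> j" using assms(6,9) j by (cases "j = M") (auto intro: less_imp_le)
    moreover have "\<rho> j \<le> \<rho> 1" using assms(6,9) j by (cases "j = 1") (auto intro: less_imp_le)
    ultimately show "0 < \<rho> j \<and> \<rho> j < 1" using assms(7,8) by linarith
  qed (use assms in auto)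
  have inD: "y \<in> D" "A y = z" if "\<And>k. z \<bullet> v k = lam k * (y \<bullet> v k)" for y z
    using self_adjoint_of_coordinates[where y = y and z = z and lam = lam, OF assms(1) _ v] assms(4) that
    unfolding eigen_system_def by auto
  have Av: "A x \<bullet> v k = lam k * (x \<bullet> v k)" if "x \<in> D" for x k
    using self_adjoint_coordinates[OF assms(1) _ _ that, of "v k" "lam k"] assms(4)
    unfolding eigen_system_def by auto
  define C where "C = initial_const + smoothing_const \<epsilon>"
  have ic: "0 \<le> initial_const" by (rule initial_const_nonneg)
  have sc: "0 \<le> smoothing_const \<epsilon>" by (rule smoothing_const_nonneg[OF assms(12)])
  show ?thesis
  proof (intro exI[of _ C] allI impI)
    fix \<phi> f assume pc: "pow_continuous_on v lam \<epsilon> {0..T} f"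
    define F where "F s = pow_op v lam \<epsilon> (f s)" for s
    define S where "S = (SUP s\<in>{0..T}. pow_norm v lam \<epsilon> (f s))"
    have F: "continuous_on {0..T} F"
      unfolding F_def by (rule pow_continuous_on_pow_op[OF v pc])
    have Ff: "F s \<bullet> v k = lam k powr \<epsilon> * (f s \<bullet> v k)" if "0 \<le> s" "s \<le> T" for s k
      unfolding F_def using pow_op_inner[OF v, of "f s" lam \<epsilon> k] pc that
      unfolding pow_continuous_on_def by auto
    have f: "continuous_on {0..T} f"
      by (rule continuous_on_of_scaled_coordinates[OF v l0 lam _ F Ff]) (use assms(12) in auto)
    have "compact ((\<lambda>s. norm (F s)) ` {0..T})"
      by (intro compact_continuous_image continuous_intros F) auto
    then have "bdd_above ((\<lambda>s. norm (F s)) ` {0..T})" by (intro bounded_imp_bdd_above compact_imp_bounded)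
    then have S1: "norm (F s) \<le> S" if "0 \<le> s" "s \<le> T" for s
      unfolding S_def pow_norm_def F_def[symmetric] using that by (intro cSUP_upper) auto
    have S0: "0 \<le> S" using S1[of 0] T norm_ge_zero order_trans by (metis order_refl less_imp_le)
    have "\<exists>u V. continuous_on {0..T} u \<and> u 0 = \<phi> \<and>
      (\<forall>t\<in>{0<..T}. (\<forall>k. V t \<bullet> v k = lam k * (u t \<bullet> v k)) \<and>
         norm (V t) \<le> initial_const * (\<Sum>j=1..M. t powr (- \<rho> j)) * norm \<phi> + smoothing_const \<epsilon> * S) \<and>
      (\<forall>t\<in>{0<..<T}. \<exists>d. (\<forall>j\<in>{1..M}. has_caputo_derivative (\<rho> j) u (d j) t) \<and>
         (\<Sum>j=1..M. q j *\<^sub>R d j) + V t = f t)"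
      by (rule spectral_solution[OF v l0 lam assms(12,13) F f Ff S0 S1])
    then obtain u V where u: "continuous_on {0..T} u" "u 0 = \<phi>"
      and V: "\<forall>t\<in>{0<..T}. (\<forall>k. V t \<bullet> v k = lam k * (u t \<bullet> v k)) \<and>
         norm (V t) \<le> initial_const * (\<Sum>j=1..M. t powr (- \<rho> j)) * norm \<phi> + smoothing_const \<epsilon> * S"
      and d: "\<forall>t\<in>{0<..<T}. \<exists>d. (\<forall>j\<in>{1..M}. has_caputo_derivative (\<rho> j) u (d j) t) \<and>
         (\<Sum>j=1..M. q j *\<^sub>R d j) + V t = f t"
      by (elim exE conjE)
    have uD: "u t \<in> D" "A (u t) = V t" if "t \<in> {0<..T}" for t
      using inD[of "V t" "u t"] V that by auto
    have sol: "is_solution D A M \<rho> q T f \<phi> u"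
      unfolding is_solution_def using u d uD by auto
    have bound: "pow_norm v lam 1 (u t) \<le> C * (norm \<phi> * (\<Sum>j=1..M. t powr (- \<rho> j)) + S)" if t: "t \<in> {0<..T}" for t
    proof -
      let ?\<sigma> = "\<Sum>j=1..M. t powr (- \<rho> j)"
      have \<sigma>: "0 \<le> ?\<sigma>" by (intro sum_nonneg) auto
      have "pow_op v lam 1 (u t) = (\<Sum>k. (V t \<bullet> v k) *\<^sub>R v k)"
        unfolding pow_op_def using V t lam0 by (simp add: less_imp_le)
      also have "\<dots> = V t" using orthonormal_sums[OF v, of "V t"] by (simp add: sums_iff)
      finally have "pow_norm v lam 1 (u t) \<le> initial_const * ?\<sigma> * norm \<phi> + smoothing_const \<epsilon> * S"
        using V t by (simp add: pow_norm_def)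
      also have "\<dots> \<le> C * (?\<sigma> * norm \<phi>) + C * S"
        unfolding C_def mult.assoc using ic sc S0 \<sigma> by (intro add_mono mult_right_mono) auto
      finally show ?thesis by (simp add: algebra_simps)
    qed
    show "\<exists>u. is_solution D A M \<rho> q T f \<phi> u \<and>
          (\<forall>w. is_solution D A M \<rho> q T f \<phi> w \<longrightarrow> (\<forall>t\<in>{0..T}. w t = u t)) \<and>
          (\<forall>t\<in>{0<..T}. u t \<in> D \<and>
             pow_norm v lam 1 (u t) \<le>
               C * (norm \<phi> * (\<Sum>j=1..M. t powr (- \<rho> j)) +
                    (SUP s\<in>{0..T}. pow_norm v lam \<epsilon> (f s))))"
    proof (intro exI[of _ u] conjI sol allI impI ballI)
      show "w t = u t" if "is_solution D A M \<rho> q T f \<phi> w" "t \<in> {0..T}" for w t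
        by (rule solution_unique[OF v lam0 Av that(1) sol that(2)])
      show "u t \<in> D" if "t \<in> {0<..T}" for t by (rule uD(1)[OF that])
      show "pow_norm v lam 1 (u t) \<le> C * (norm \<phi> * (\<Sum>j=1..M. t powr (- \<rho> j)) +
          (SUP s\<in>{0..T}. pow_norm v lam \<epsilon> (f s)))" if "t \<in> {0<..T}" for t
        using bound[OF that] unfolding S_def .
    qed
  qed
qed

end
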